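(* Let $\mu$ be a compactly supported, locally bounded probability measure on $\mathbb{R}^2$, and let $\{x_n\}_{n\in\mathbb{N}}$ be i.i.d. samples from $\mu$. (1) If $0<\alpha<2$, there are positive real constants $\gamma\leq\Gamma$ (depending on $\mu$ and $\alpha$) such that $$\lim_{n\to\infty}\mathbb{P}\left(\gamma\leq n^{-\frac{2-\alpha}{2}}E_\alpha^1(x_1,\ldots,x_n)\leq\Gamma\right)=1.$$ In fact, the upper bound holds with probability one: almost surely, $$\limsup_{n\to\infty}n^{-\frac{2-\alpha}{2}}E_\alpha^1(x_1,\ldots,x_n)\leq\Gamma.$$ (2) There exists a constant $D$ such that, with probability one, $$\limsup_{n\to\infty}\frac{1}{\log n}E_2^1(x_1,\ldots,x_n)\leq D.$$
   Context: A probability measure $\mu$ on $\mathbb{R}^m$ is locally bounded if there are a set $A\subset\mathbb{R}^m$ with positive volume and real numbers $a_1\geq a_0>0$ such that $a_0\,\mathrm{vol}(B)\leq\mu(B)\leq a_1\,\mathrm{vol}(B)$ for all Borel sets $B\subset A$. The ambient metric space is $M=\mathbb{R}^2$ with the Euclidean metric. For $X\subset M$ and $\epsilon>0$, let $X_\epsilon=\{x\in M: d(x,X)<\epsilon\}$. Let $H_i$ denote reduced homology with coefficients in a fixed field. For a finite set $X\subset M$, $PH_i(X)$ is the multiset of intervals $(b,d)$ such that for all $0<\epsilon_0<\epsilon_1$ the rank of the map $H_i(X_{\epsilon_0})\to H_i(X_{\epsilon_1})$ induced by inclusion equals the number of intervals of $PH_i(X)$ containing $(\epsilon_0,\epsilon_1)$.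 Define $$E_\alpha^i(x_1,\ldots,x_n)=\sum_{(b,d)\in PH_i(\{x_1,\ldots,x_n\})}(d-b)^\alpha.$$
   Formalization: An interval (b,d) of PH_i(X) is counted for (ε0,ε1) when b<ε0 and ε1≤d; if ε0=b were also allowed, as "containing" literally says, PH_1 would not exist for the open neighbourhoods X_ε (e.g. for the vertices of an equilateral triangle). *)

theory Defs
  imports
    "HOL-Probability.Probability"
    "HOL-Homology.Homology"
    "Jordan_Normal_Form.VS_Connect"
begin

text \<open>
  The singular chains of HOL-Homology have integer coefficients. Here the coefficients are taken in
  a field; simplices and faces are those of HOL-Homology, and the chain boundary follows the
  integral one.
\<close>

type_synonym ('a, 'k) field_chain = "((nat \<Rightarrow> real) \<Rightarrow> 'a) \<Rightarrow>\<^sub>0 'k"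

definition field_chains :: "nat \<Rightarrow> 'a topology \<Rightarrow> ('a, 'k::field) field_chain set" where
  "field_chains p X = {c. Poly_Mapping.keys c \<subseteq> singular_simplex_set p X}"

definition chain_scale :: "'k::field \<Rightarrow> ('a, 'k) field_chain \<Rightarrow> ('a, 'k) field_chain" where
  "chain_scale a = Poly_Mapping.map ((*) a)"

definition field_boundary :: "nat \<Rightarrow> ('a, 'k::field) field_chain \<Rightarrow> ('a, 'k) field_chain" where
  "field_boundary p c =
     (if p = 0 then 0
      else \<Sum>f\<in>Poly_Mapping.keys c. \<Sum>k\<le>p.
             Poly_Mapping.single (singular_face p k f) ((-1) ^ k * Poly_Mapping.lookup c f))"

definition augmentation :: "('a, 'k::field) field_chain \<Rightarrow> 'k" where
  "augmentation c = (\<Sum>f\<in>Poly_Mapping.keys c. Poly_Mapping.lookup c f)"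

text \<open>In degree \<open>0\<close> the boundary is replaced by the augmentation: the homology is reduced.\<close>

definition reduced_cycles :: "nat \<Rightarrow> 'a topology \<Rightarrow> ('a, 'k::field) field_chain set" where
  "reduced_cycles p X =
     {c \<in> field_chains p X. if p = 0 then augmentation c = 0 else field_boundary p c = 0}"

definition boundaries :: "nat \<Rightarrow> 'a topology \<Rightarrow> ('a, 'k::field) field_chain set" where
  "boundaries p X = field_boundary (Suc p) ` field_chains (Suc p) X"

definition cycle_module :: "nat \<Rightarrow> 'a topology \<Rightarrow> ('k::field, ('a, 'k) field_chain) module" where
  "cycle_module p X =
     \<lparr>carrier = reduced_cycles p X, mult = undefined, one = undefined, zero = 0, add = (+),
      smult = chain_scale\<rparr>"

definition quotient_module ::
    "('k, 'c, 'm) module_scheme \<Rightarrow> 'c set \<Rightarrow> ('k, 'c set) module" where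
  "quotient_module V W =
     \<lparr>carrier = a_rcosets\<^bsub>V\<^esub> W, mult = undefined, one = undefined, zero = W, add = set_add V,
      smult = (\<lambda>a S. \<Union>s\<in>S. W +>\<^bsub>V\<^esub> (a \<odot>\<^bsub>V\<^esub> s))\<rparr>"

definition reduced_homology ::
    "nat \<Rightarrow> 'a topology \<Rightarrow> ('k::field, ('a, 'k) field_chain set) module" where
  "reduced_homology p X = quotient_module (cycle_module p X) (boundaries p X)"

text \<open>
  On a homology class \<open>S\<close> of a subspace of \<open>Y\<close> all cosets in the union below coincide, so this is
  the map on homology that is induced by the inclusion.
\<close>

definition inclusion_induced ::
    "nat \<Rightarrow> 'a topology \<Rightarrow> ('a, 'k::field) field_chain set \<Rightarrow> ('a, 'k) field_chain set" where
  "inclusion_induced p Y S = (\<Union>z\<in>S. boundaries p Y +>\<^bsub>cycle_module p Y\<^esub> z)"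

definition inclusion_rank ::
    "'k::field itself \<Rightarrow> nat \<Rightarrow> 'a topology \<Rightarrow> 'a topology \<Rightarrow> nat" where
  "inclusion_rank _ p X Y =
     vectorspace.dim (class_ring :: 'k ring)
       ((reduced_homology p Y)
          \<lparr>carrier := inclusion_induced p Y `
             carrier (reduced_homology p X :: ('k, ('a, 'k) field_chain set) module)\<rparr>)"

text \<open>
  The side condition is needed because \<open>infdist x {} = 0\<close>, whereas the distance to the empty set
  should be infinite.
\<close>

definition neighbourhood :: "real \<Rightarrow> 'a::metric_space set \<Rightarrow> 'a set" where
  "neighbourhood \<epsilon> X = {x. X \<noteq> {} \<and> infdist x X < \<epsilon>}"

text \<open>
  Neighbourhoods are open, so a class that belongs to the interval with end points \<open>b\<close> and \<open>d\<close> is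
  absent at \<open>b\<close> and still present at \<open>d\<close>. Hence an interval contributes to the rank between
  \<open>\<epsilon>\<^sub>0\<close> and \<open>\<epsilon>\<^sub>1\<close> iff \<open>b < \<epsilon>\<^sub>0\<close> and \<open>\<epsilon>\<^sub>1 \<le> d\<close>; with \<open>b \<le> \<epsilon>\<^sub>0\<close> in place of \<open>b < \<epsilon>\<^sub>0\<close> no multiset
  would have the required property once some \<open>b\<close> is positive.
  For finite subsets of a Euclidean space, reduced homology has no interval of infinite length,
  so real end points suffice. The bounds \<open>0 \<le> b < d\<close> make the multiset unique.
\<close>

definition is_persistence_multiset ::
    "'k::field itself \<Rightarrow> nat \<Rightarrow> 'a::metric_space set \<Rightarrow> (real \<times> real) multiset \<Rightarrow> bool" where
  "is_persistence_multiset K i X D \<longleftrightarrow>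
     (\<forall>(b, d) \<in># D. 0 \<le> b \<and> b < d) \<and>
     (\<forall>\<epsilon>\<^sub>0 \<epsilon>\<^sub>1. 0 < \<epsilon>\<^sub>0 \<and> \<epsilon>\<^sub>0 < \<epsilon>\<^sub>1 \<longrightarrow>
        inclusion_rank K i (top_of_set (neighbourhood \<epsilon>\<^sub>0 X)) (top_of_set (neighbourhood \<epsilon>\<^sub>1 X)) =
        size {#(b, d) \<in># D. b < \<epsilon>\<^sub>0 \<and> \<epsilon>\<^sub>1 \<le> d#})"

definition PH :: "'k::field itself \<Rightarrow> nat \<Rightarrow> 'a::metric_space set \<Rightarrow> (real \<times> real) multiset" where
  "PH K i X = (THE D. is_persistence_multiset K i X D)"

definition E_sum :: "'k::field itself \<Rightarrow> nat \<Rightarrow> real \<Rightarrow> 'a::metric_space set \<Rightarrow> real" where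
  "E_sum K i \<alpha> X = (\<Sum>(b, d) \<in># PH K i X. (d - b) powr \<alpha>)"

definition locally_bounded :: "'a::euclidean_space measure \<Rightarrow> bool" where
  "locally_bounded \<mu> \<longleftrightarrow>
     (\<exists>A a\<^sub>0 a\<^sub>1. A \<in> sets lebesgue \<and> emeasure lebesgue A > 0 \<and> 0 < a\<^sub>0 \<and> a\<^sub>0 \<le> a\<^sub>1 \<and>
        (\<forall>B \<in> sets borel. B \<subseteq> A \<longrightarrow>
           ennreal a\<^sub>0 * emeasure lborel B \<le> emeasure \<mu> B \<and>
           emeasure \<mu> B \<le> ennreal a\<^sub>1 * emeasure lborel B))"

definition compactly_supported :: "'a::euclidean_space measure \<Rightarrow> bool" where
  "compactly_supported \<mu> \<longleftrightarrow> (\<exists>C. compact C \<and> emeasure \<mu> (- C) = 0)"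

definition iid_samples ::
    "'a::euclidean_space measure \<Rightarrow> 'w measure \<Rightarrow> (nat \<Rightarrow> 'w \<Rightarrow> 'a) \<Rightarrow> bool" where
  "iid_samples \<mu> P x \<longleftrightarrow>
     prob_space P \<and> (\<forall>n. x n \<in> borel_measurable P \<and> distr P borel (x n) = \<mu>) \<and>
     prob_space.indep_vars P (\<lambda>_. borel) x UNIV"

end

theory Submission
  imports Defs "HOL-Complex_Analysis.Winding_Numbers"
begin

text \<open>
  By Alexander duality, which is proved here with winding numbers of cycles on a fine grid, the rank
  of \<open>H\<^sub>1(X\<^sub>s) \<rightarrow> H\<^sub>1(X\<^sub>t)\<close> is the number of bounded components of \<open>{d(\<cdot>, X) \<ge> s}\<close> that reach the
  height \<open>t\<close>. The persistence intervals are therefore the bars of the merge tree of the function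
  \<open>d(\<cdot>, X)\<close>, one for each peak that is not absorbed at once.

  For the upper bounds, peaks that belong to bars of length at least \<open>l\<close> are at distance at least \<open>l\<close>
  from one another, so that in a disc of radius \<open>R\<close> the \<open>k\<close>-th longest bar has length
  \<open>O(R k\<^sup>-\<^sup>1\<^sup>/\<^sup>2)\<close>. Together with the linear bound on the number of peaks this gives
  \<open>n\<^sup>1\<^sup>-\<^sup>\<alpha>\<^sup>/\<^sup>2\<close>, and \<open>log n\<close> for \<open>\<alpha> = 2\<close>.

  For the lower bound, cut a square that the lower density bound almost fills into about \<open>n\<close> small
  squares. In each of them, with probability bounded below, the samples form a ring around an empty
  middle, which creates an interval of length comparable to \<open>n\<^sup>-\<^sup>1\<^sup>/\<^sup>2\<close>. These events are almost
  independent, so by the second moment method a fixed proportion of them occurs.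
\<close>

text \<open>Hence ties between peaks are broken by a total order, and the number of peaks is bounded
  by an injection instead of by counting the triangles of a Delaunay triangulation.
  \<open>PH\<close> is a definite description built on dimensions over an arbitrary field. Ranks
  have to be computed exactly and the multiset shown to be unique before anything can be estimated.
  The dimension is read off from a dual pair of winding number functionals and cycles, without exact
  sequences. Since \<open>measure\<close> is zero on nonmeasurable sets, convergence in probability
  also requires measurability of \<open>E_sum\<close>, which its definition does not reveal; it
  comes from the stability of the ranks. The number of samples is fixed, so disjoint cells are not
  independent. But \<open>(1 - a) ^ n\<close> and \<open>exp (- n * a)\<close> differ by order
  \<open>1 / n\<close> when \<open>a\<close> has order \<open>1 / n\<close>, which is close enough
  to independence for second moments.\<close>

no_notation Matrix.vec_index (infixl "$" 100)

section \<open>Superlevel sets of the distance function and their maxima\<close>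

definition superlevel :: "'a::metric_space set \<Rightarrow> real \<Rightarrow> 'a set" where
  "superlevel X t = {x. t \<le> infdist x X}"

lemma neighbourhood_eq_superlevel:
  "X \<noteq> {} \<Longrightarrow> neighbourhood t X = - superlevel X t"
  by (auto simp: neighbourhood_def superlevel_def)

lemma closed_superlevel: "closed (superlevel X t)"
  unfolding superlevel_def by (intro closed_Collect_le continuous_intros)

lemma superlevel_mono: "s \<le> t \<Longrightarrow> superlevel X t \<subseteq> superlevel X s"
  by (auto simp: superlevel_def)

lemma infdist_finite_attained:
  fixes X :: "'a::heine_borel set"
  assumes "finite X" "X \<noteq> {}"
  obtains x where "x \<in> X" "infdist p X = dist p x"
  by (rule infdist_attains_inf[OF finite_imp_closed[OF assms(1)] assms(2), of p]) (rule that)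

text \<open>
  The points at which the distance to \<open>X\<close> can be maximal on a component of a superlevel set:
  the nearest points of \<open>X\<close> surround them strictly.
\<close>

definition peaks :: "'a::real_inner set \<Rightarrow> 'a set" where
  "peaks X = {p. \<forall>v. v \<noteq> 0 \<longrightarrow> (\<exists>x\<in>X. dist x p = infdist p X \<and> 0 < inner (x - p) v)}"

text \<open>If no nearest point lies strictly on the side of \<open>v\<close>, a step along
  \<open>v\<close> increases the squared distance to every nearest point by at least
  \<open>s\<^sup>2 * inner v v\<close>, and the other points of \<open>X\<close> are too far away to
  interfere.\<close>

lemma not_peak_increase:
  fixes X :: "'a::euclidean_space set"
  assumes X: "finite X" "X \<noteq> {}" and p: "p \<notin> peaks X"
  obtains v e where "e > 0" "\<And>s. 0 < s \<Longrightarrow> s \<le> e \<Longrightarrow> infdist p X < infdist (p + s *\<^sub>R v) X"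
proof -
  define d where "d = infdist p X"
  obtain v where v: "v \<noteq> 0" and le: "\<And>x. x \<in> X \<Longrightarrow> dist x p = d \<Longrightarrow> inner (x - p) v \<le> 0"
    using p unfolding peaks_def d_def by (force simp: not_less)
  \<comment> \<open>\<open>m\<close> is a gap between the least distance and the next one; steps of
    length at most \<open>m / 2\<close> respect it.\<close>
  have "\<exists>m>0. \<forall>x\<in>X. dist x p \<noteq> d \<longrightarrow> d + m \<le> dist x p"
  proof (cases "{x\<in>X. dist x p \<noteq> d} = {}")
    case False
    define m where "m = Min ((\<lambda>x. dist x p - d) ` {x\<in>X. dist x p \<noteq> d})"
    have "d < dist x p" if "x \<in> X" "dist x p \<noteq> d" for x
      using infdist_le[OF that(1), of p] that(2) by (simp add: d_def dist_commute)
    then have "m > 0" unfolding m_def using X False by (subst Min_gr_iff) auto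
    moreover have "d + m \<le> dist x p" if "x \<in> X" "dist x p \<noteq> d" for x
    proof -
      have "m \<le> dist x p - d" unfolding m_def using X that by (intro Min_le) auto
      then show ?thesis by simp
    qed
    ultimately show ?thesis by blast
  qed (auto intro: exI[of _ 1])
  then obtain m where m: "m > 0" "\<And>x. x \<in> X \<Longrightarrow> dist x p \<noteq> d \<Longrightarrow> d + m \<le> dist x p" by blast
  show ?thesis
  proof (rule that)
    show "m / (2 * norm v) > 0" using m v by simp
    fix s assume s: "0 < s" "s \<le> m / (2 * norm v)"
    obtain x where x: "x \<in> X" "infdist (p + s *\<^sub>R v) X = dist (p + s *\<^sub>R v) x"
      using infdist_finite_attained[OF X] by blast
    have "d < dist (p + s *\<^sub>R v) x"
    proof (cases "dist x p = d")
      case True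
      have "0 \<le> d" by (simp add: d_def infdist_nonneg)
      have "(dist (p + s *\<^sub>R v) x)\<^sup>2 = inner ((p - x) + s *\<^sub>R v) ((p - x) + s *\<^sub>R v)"
        by (simp add: dist_norm power2_norm_eq_inner algebra_simps)
      also have "\<dots> = inner (p - x) (p - x) + 2 * s * inner (p - x) v + s\<^sup>2 * inner v v"
        by (simp add: inner_add_left inner_add_right inner_commute power2_eq_square algebra_simps)
      also have "inner (p - x) (p - x) = d\<^sup>2"
        using True by (simp add: power2_norm_eq_inner[symmetric] dist_norm norm_minus_commute)
      finally have eq: "(dist (p + s *\<^sub>R v) x)\<^sup>2 = d\<^sup>2 + 2 * s * inner (p - x) v + s\<^sup>2 * inner v v" .
      have "inner (p - x) v \<ge> 0"
        using le[OF x(1) True] by (simp add: inner_diff_left)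
      moreover have "s\<^sup>2 * inner v v > 0" using s v by simp
      ultimately have "d\<^sup>2 < (dist (p + s *\<^sub>R v) x)\<^sup>2"
        using s eq mult_nonneg_nonneg[of "2 * s" "inner (p - x) v"] by linarith
      then show ?thesis by (rule power2_less_imp_less) simp
    next
      case False
      have "dist x p \<le> dist (p + s *\<^sub>R v) x + dist (p + s *\<^sub>R v) p"
        by (metis dist_commute dist_triangle)
      moreover have "dist (p + s *\<^sub>R v) p \<le> m / 2"
        using s v by (simp add: dist_norm field_simps)
      ultimately show ?thesis using m(2)[OF x(1) False] m(1) by linarith
    qed
    then show "infdist p X < infdist (p + s *\<^sub>R v) X" using x(2) by (simp add: d_def)
  qed
qed

text \<open>Otherwise a short segment from \<open>p\<close> in a direction of increase stays above
  level \<open>t\<close>, hence inside \<open>C\<close>, and leads to a higher point of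
  \<open>C\<close>.\<close>

lemma component_max_is_peak:
  fixes X :: "'a::euclidean_space set"
  assumes X: "finite X" "X \<noteq> {}"
    and C: "C \<in> components (superlevel X t)" "p \<in> C"
    and mx: "\<And>y. y \<in> C \<Longrightarrow> infdist y X \<le> infdist p X"
  shows "p \<in> peaks X"
proof (rule ccontr)
  assume "p \<notin> peaks X"
  then obtain v e where e: "e > 0"
    and inc: "\<And>s. 0 < s \<Longrightarrow> s \<le> e \<Longrightarrow> infdist p X < infdist (p + s *\<^sub>R v) X"
    using not_peak_increase[OF X] by blast
  have tp: "t \<le> infdist p X"
    using C in_components_subset[OF C(1)] by (auto simp: superlevel_def)
  have "closed_segment p (p + e *\<^sub>R v) \<subseteq> superlevel X t"
  proof
    fix y assume "y \<in> closed_segment p (p + e *\<^sub>R v)"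
    then obtain u where u: "0 \<le> u" "u \<le> 1" "y = p + (u * e) *\<^sub>R v"
      by (auto simp: closed_segment_def algebra_simps)
    show "y \<in> superlevel X t"
    proof (cases "u = 0")
      case False
      then have "0 < u * e" "u * e \<le> e" using u e by (auto simp: mult_left_le_one_le)
      from inc[OF this] tp u show ?thesis by (simp add: superlevel_def)
    qed (use u tp in \<open>simp add: superlevel_def\<close>)
  qed
  then have "closed_segment p (p + e *\<^sub>R v) \<subseteq> C"
    using C by (intro components_maximal[OF C(1)]) auto
  then have "p + e *\<^sub>R v \<in> C" by auto
  from mx[OF this] inc[of e] e show False by simp
qed

lemma component_closed_superlevel: "C \<in> components (superlevel X t) \<Longrightarrow> closed C"
  using closed_components[OF closed_superlevel] by blast

lemma bounded_component_peak:
  fixes X :: "'a::euclidean_space set"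
  assumes X: "finite X" "X \<noteq> {}"
    and C: "C \<in> components (superlevel X t)" "bounded C"
  obtains p where "p \<in> C" "p \<in> peaks X" "\<And>y. y \<in> C \<Longrightarrow> infdist y X \<le> infdist p X"
proof -
  have "compact C" using C component_closed_superlevel compact_eq_bounded_closed by blast
  moreover have "C \<noteq> {}" using C in_components_nonempty by blast
  ultimately obtain p where "p \<in> C" "\<And>y. y \<in> C \<Longrightarrow> infdist y X \<le> infdist p X"
    using continuous_attains_sup[of C "\<lambda>y. infdist y X"] continuous_on_infdist[OF continuous_on_id]
    by fastforce
  then show ?thesis using that component_max_is_peak[OF X C(1)] by blast
qed

text \<open>Take \<open>v = p\<close> in the definition of a peak: some nearest point has an inner
  product with \<open>p\<close> above \<open>norm p ^ 2\<close>, hence a larger norm than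
  \<open>p\<close>.\<close>

lemma peaks_norm_le:
  fixes X :: "'a::real_inner set"
  assumes "X \<subseteq> cball 0 R" "p \<in> peaks X" "0 \<le> R"
  shows "norm p \<le> R"
proof (cases "p = 0")
  case False
  then obtain x where x: "x \<in> X" "0 < inner (x - p) p"
    using assms by (auto simp: peaks_def)
  have "norm p * norm p < inner x p"
    using x by (simp add: inner_diff_left power2_norm_eq_inner[symmetric] power2_eq_square)
  also have "\<dots> \<le> norm x * norm p" by (rule norm_cauchy_schwarz)
  finally have "norm p < norm x" using False by simp
  moreover have "norm x \<le> R" using x assms by auto
  ultimately show ?thesis by linarith
qed (use assms in simp)

subsection \<open>The number of peaks in the plane\<close>

lemma inner_real2: "inner x y = x $ 1 * y $ 1 + x $ 2 * y $ (2::2)" for x y :: "real ^ 2"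
  by (simp add: inner_vec_def sum_2)

lemma real2_eq_iff: "x = y \<longleftrightarrow> x $ 1 = y $ 1 \<and> x $ 2 = y $ (2::2)" for x y :: "real ^ 2"
  by (simp add: Finite_Cartesian_Product.vec_eq_iff forall_2)

lemma generic_linear_functional:
  fixes X :: "(real ^ 2) set"
  assumes "finite X"
  obtains \<tau> where "inj_on (\<lambda>x. x $ 1 + \<tau> * x $ 2) X"
proof -
  \<comment> \<open>The values of \<open>\<tau>\<close> for which two points collide. Pairs with
    equal second coordinate only contribute \<open>0\<close>, because division by zero gives
    zero.\<close>
  define B where "B = (\<lambda>(x, y). - (x $ 1 - y $ 1) / (x $ 2 - y $ (2::2))) ` (X \<times> X)"
  have "finite B" using assms by (simp add: B_def)
  then obtain \<tau> :: real where \<tau>: "\<tau> \<notin> B" using ex_new_if_finite infinite_UNIV_char_0 by blast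
  have "inj_on (\<lambda>x. x $ 1 + \<tau> * x $ 2) X"
  proof (rule inj_onI, rule ccontr)
    fix x y :: "real ^ 2" assume xy: "x \<in> X" "y \<in> X" "x $ 1 + \<tau> * x $ 2 = y $ 1 + \<tau> * y $ 2" "x \<noteq> y"
    have e: "\<tau> * (x $ 2 - y $ 2) = - (x $ 1 - y $ 1)" using xy by (simp add: algebra_simps)
    have "x $ 2 \<noteq> y $ 2"
    proof
      assume "x $ 2 = y $ 2"
      then have "x = y" using e by (simp add: real2_eq_iff)
      then show False using xy by simp
    qed
    then have "\<tau> = - (x $ 1 - y $ 1) / (x $ 2 - y $ 2)" using e by (simp add: field_simps)
    then have "\<tau> \<in> B" using xy by (force simp: B_def)
    then show False using \<tau> by simp
  qed
  then show ?thesis by (rule that)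
qed

text \<open>\<open>l\<close> and \<open>h\<close> are the extreme nearest points for
  \<open>g\<close>. The line through them has a normal \<open>v\<close> on whose side, as seen from
  \<open>p\<close>, neither of them lies strictly. A peak has a nearest point \<open>m\<close> that
  does, so \<open>m\<close> is off that line.\<close>

lemma peak_three_nearest:
  fixes X :: "(real ^ 2) set" and g :: "real ^ 2 \<Rightarrow> real"
  assumes X: "finite X" and inj: "inj_on g X" and p: "p \<in> peaks X"
  obtains l m h where "{l, m, h} \<subseteq> {x \<in> X. dist x p = infdist p X}" "g l < g m" "g m < g h"
    "(l - m) $ 1 * (h - m) $ 2 - (l - m) $ 2 * (h - m) $ 1 \<noteq> 0"
proof -
  define N where "N = {x \<in> X. dist x p = infdist p X}"
  have ex: "\<exists>x\<in>N. 0 < inner (x - p) v" if "v \<noteq> 0" for v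
    using p that by (auto simp: peaks_def N_def)
  have "(vector [1, 0] :: real ^ 2) \<noteq> 0" by (simp add: real2_eq_iff)
  then have "N \<noteq> {}" using ex by blast
  have fN: "finite N" using X by (simp add: N_def)
  obtain l where l: "l \<in> N" "\<And>x. x \<in> N \<Longrightarrow> g l \<le> g x"
    using arg_min_if_finite(1)[OF fN \<open>N \<noteq> {}\<close>] arg_min_least[OF fN \<open>N \<noteq> {}\<close>] by metis
  obtain h where h: "h \<in> N" "\<And>x. x \<in> N \<Longrightarrow> g x \<le> g h"
    using arg_min_if_finite(1)[OF fN \<open>N \<noteq> {}\<close>, of "\<lambda>x. - g x"]
      arg_min_least[OF fN \<open>N \<noteq> {}\<close>, of _ "\<lambda>x. - g x"] by (metis neg_le_iff_le)
  have "h \<noteq> l"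
  proof
    assume "h = l"
    then have "\<And>x. x \<in> N \<Longrightarrow> g x = g l" using l h by (meson order_antisym)
    then have "\<And>x. x \<in> N \<Longrightarrow> x = l" using inj l unfolding N_def inj_on_def by blast
    then have 1: "\<And>v. v \<noteq> 0 \<Longrightarrow> 0 < inner (l - p) v" using ex by blast
    have "0 < inner (l - p) (vector [1,0])" "0 < inner (l - p) (- vector [1,0])"
      using 1[OF \<open>vector [1, 0] \<noteq> 0\<close>] 1[of "- vector [1,0]"] \<open>vector [1, 0] \<noteq> 0\<close> by auto
    then show False by simp
  qed
  \<comment> \<open>The vector \<open>h - l\<close> turned by a right angle.\<close>
  define w :: "real ^ 2" where "w = vector [- (h - l) $ 2, (h - l) $ 1]"
  have w0: "w \<noteq> 0" using \<open>h \<noteq> l\<close> by (auto simp: w_def real2_eq_iff)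
  have orth: "inner (h - l) w = 0" by (simp add: inner_real2 w_def algebra_simps)
  define v where "v = (if inner (h - p) w \<le> 0 then w else - w)"
  have v0: "v \<noteq> 0" and hv: "inner (h - p) v \<le> 0" using w0 by (auto simp: v_def)
  have "inner (h - l) v = 0" using orth by (simp add: v_def)
  then have lv: "inner (l - p) v = inner (h - p) v" by (simp add: inner_diff_left)
  obtain m where m: "m \<in> N" "0 < inner (m - p) v" using ex[OF v0] by blast
  have "m \<noteq> l" "m \<noteq> h" using m hv lv by auto
  then have "g m \<noteq> g l" "g m \<noteq> g h" using inj m l h unfolding N_def inj_on_def by blast+
  then have lt: "g l < g m" "g m < g h" using l(2)[OF m(1)] h(2)[OF m(1)] by auto
  have "inner (m - h) v \<noteq> 0" using m hv by (simp add: inner_diff_left)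
  then have "inner (m - h) w \<noteq> 0" by (auto simp: v_def split: if_splits)
  then have "(l - m) $ 1 * (h - m) $ 2 - (l - m) $ 2 * (h - m) $ 1 \<noteq> 0"
    by (simp add: inner_real2 w_def algebra_simps)
  then show ?thesis using that[of l m h] l h m lt by (auto simp: N_def)
qed

text \<open>
  The affine function \<open>|z - p|\<^sup>2 - d(p)\<^sup>2 - |z - p'|\<^sup>2 + d(p')\<^sup>2\<close> separates the nearest points of
  \<open>p\<close> from those of \<open>p'\<close>; its increment is this inner product.
\<close>

lemma nearest_points_separated:
  fixes X :: "'a::real_inner set"
  assumes "m \<in> X" "dist m p = infdist p X" "dist m p' = infdist p' X"
    and "z \<in> X" "dist z p = infdist p X"
  shows "0 \<le> inner (z - m) (p - p')"
proof -
  have "dist m p' \<le> dist z p'"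
    using infdist_le[OF assms(4), of p'] assms(3) by (simp add: dist_commute)
  then have "(dist m p')\<^sup>2 \<le> (dist z p')\<^sup>2" by (simp add: power_mono)
  moreover have "(dist z p)\<^sup>2 = (dist m p)\<^sup>2" using assms by simp
  ultimately show ?thesis
    unfolding dist_norm power2_norm_eq_inner
    by (simp add: inner_diff_left inner_diff_right inner_commute)
qed

text \<open>Coordinates are relative to the common middle point, and \<open>a\<close> is the
  difference of two peaks. The combination \<open>gh * l - gl * h\<close>, with positive weights
  \<open>gh\<close> and \<open>- gl\<close>, equals \<open>- k\<close> times
  \<open>(- \<tau>, 1)\<close>, a vector on which the linear functional vanishes. Equal signs of
  \<open>k\<close> and \<open>k'\<close> put both combinations on the same half of this line, so the
  separation inequalities bound \<open>J\<close> by zero from both sides.\<close>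

lemma separation_forces_zero:
  fixes a1 a2 \<tau> :: real and l1 l2 h1 h2 l1' l2' h1' h2' :: real
  assumes gl: "l1 + \<tau> * l2 < 0" "h1 + \<tau> * h2 > 0" and gl': "l1' + \<tau> * l2' < 0" "h1' + \<tau> * h2' > 0"
    and s: "0 \<le> l1 * a1 + l2 * a2" "0 \<le> h1 * a1 + h2 * a2"
    and s': "l1' * a1 + l2' * a2 \<le> 0" "h1' * a1 + h2' * a2 \<le> 0"
    and k: "l1 * h2 - l2 * h1 \<noteq> 0" "l1' * h2' - l2' * h1' \<noteq> 0"
    and sgn: "0 < l1 * h2 - l2 * h1 \<longleftrightarrow> 0 < l1' * h2' - l2' * h1'"
  shows "a1 = 0 \<and> a2 = 0"
proof -
  define gl gh gl' gh' where "gl = l1 + \<tau> * l2" "gh = h1 + \<tau> * h2"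
    "gl' = l1' + \<tau> * l2'" "gh' = h1' + \<tau> * h2'"
  note gd = this
  define J where "J = a2 - \<tau> * a1"
  define k k' where "k = l1 * h2 - l2 * h1" "k' = l1' * h2' - l2' * h1'"
  note kd = this
  have e: "gh * (l1 * a1 + l2 * a2) - gl * (h1 * a1 + h2 * a2) = - k * J"
    unfolding gd J_def kd by (simp add: algebra_simps)
  have e': "gh' * (l1' * a1 + l2' * a2) - gl' * (h1' * a1 + h2' * a2) = - k' * J"
    unfolding gd J_def kd by (simp add: algebra_simps)
  have pos: "gh > 0" "gl < 0" "gh' > 0" "gl' < 0" using assms by (auto simp: gd)
  have t1: "0 \<le> gh * (l1 * a1 + l2 * a2)" "0 \<le> - gl * (h1 * a1 + h2 * a2)"
    using pos s by (auto intro!: mult_nonneg_nonneg mult_nonpos_nonneg)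
  have t2: "gh' * (l1' * a1 + l2' * a2) \<le> 0" "- gl' * (h1' * a1 + h2' * a2) \<le> 0"
    using pos s' by (auto intro!: mult_nonneg_nonpos mult_nonpos_nonpos)
  have "0 \<le> - k * J" "- k' * J \<le> 0" using e e' t1 t2 by auto
  moreover have "k \<noteq> 0" "k' \<noteq> 0" "0 < k \<longleftrightarrow> 0 < k'" using assms by (auto simp: kd)
  ultimately have "J = 0"
    by (cases "0 < k") (auto simp: mult_le_0_iff zero_le_mult_iff)
  then have z: "gh * (l1 * a1 + l2 * a2) = 0" "gl * (h1 * a1 + h2 * a2) = 0"
    using e t1 by (auto simp: algebra_simps)
  then have zz: "l1 * a1 + l2 * a2 = 0" "h1 * a1 + h2 * a2 = 0" using pos by auto
  \<comment> \<open>Cramer's rule for the two equations \<open>zz\<close> with determinant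
    \<open>k\<close>.\<close>
  have "k * a1 = (l1 * a1 + l2 * a2) * h2 - (h1 * a1 + h2 * a2) * l2"
    "k * a2 = (h1 * a1 + h2 * a2) * l1 - (l1 * a1 + l2 * a2) * h1"
    by (auto simp: kd algebra_simps)
  then have "k * a1 = 0" "k * a2 = 0" unfolding zz by simp_all
  then show ?thesis using \<open>k \<noteq> 0\<close> by simp
qed

text \<open>
  Of three nearest points of a peak take the one that is in the middle for a generic linear
  functional. Together with the orientation of the triple it determines the peak.
\<close>

lemma finite_peaks: "finite X \<Longrightarrow> finite (peaks X)"
  and card_peaks_le: "finite X \<Longrightarrow> card (peaks X) \<le> 2 * card X" for X :: "(real ^ 2) set"
proof -
  assume X: "finite X"
  obtain \<tau> where inj: "inj_on (\<lambda>x. x $ 1 + \<tau> * x $ 2) X"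
    using generic_linear_functional[OF X] by blast
  define g where "g = (\<lambda>x::real^2. x $ 1 + \<tau> * x $ 2)"
  define T where "T p l m h \<longleftrightarrow> {l, m, h} \<subseteq> {x \<in> X. dist x p = infdist p X} \<and> g l < g m \<and> g m < g h \<and>
    (l - m) $ 1 * (h - m) $ 2 - (l - m) $ 2 * (h - m) $ 1 \<noteq> 0" for p l m h
  have "\<exists>l m h. T p l m h" if "p \<in> peaks X" for p
    by (rule peak_three_nearest[OF X inj[folded g_def] that]) (unfold T_def, blast)
  then have "\<forall>p. \<exists>z. p \<in> peaks X \<longrightarrow> T p (fst z) (fst (snd z)) (snd (snd z))" by fastforce
  then obtain z where z: "\<And>p. p \<in> peaks X \<Longrightarrow> T p (fst (z p)) (fst (snd (z p))) (snd (snd (z p)))"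
    using choice[of "\<lambda>p z. p \<in> peaks X \<longrightarrow> T p (fst z) (fst (snd z)) (snd (snd z))"] by blast
  define l m h where "l p = fst (z p)" "m p = fst (snd (z p))" "h p = snd (snd (z p))" for p
  then have T: "\<And>p. p \<in> peaks X \<Longrightarrow> T p (l p) (m p) (h p)" using z by simp
  define \<Phi> where "\<Phi> p = (m p, 0 < (l p - m p) $ 1 * (h p - m p) $ 2 - (l p - m p) $ 2 * (h p - m p) $ 1)" for p
  have "inj_on \<Phi> (peaks X)"
  proof (rule inj_onI)
    fix p q assume pq: "p \<in> peaks X" "q \<in> peaks X" "\<Phi> p = \<Phi> q"
    note Tp = T[OF pq(1), unfolded T_def] and Tq = T[OF pq(2), unfolded T_def]
    have m: "m q = m p" using pq by (simp add: \<Phi>_def)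
    have 1: "0 \<le> inner (z - m p) (p - q)" if "z \<in> {l p, h p}" for z
      using Tp Tq m that by (intro nearest_points_separated[of _ X]) auto
    have 2: "0 \<le> inner (z - m q) (q - p)" if "z \<in> {l q, h q}" for z
      using Tp Tq m that by (intro nearest_points_separated[of _ X]) auto
    have "(p - q) $ 1 = 0 \<and> (p - q) $ 2 = 0"
    proof (rule separation_forces_zero[of "(l p - m p) $ 1" \<tau> "(l p - m p) $ 2"
          "(h p - m p) $ 1" "(h p - m p) $ 2" "(l q - m q) $ 1" "(l q - m q) $ 2"
          "(h q - m q) $ 1" "(h q - m q) $ 2"])
      show "(l q - m q) $ 1 * (p - q) $ 1 + (l q - m q) $ 2 * (p - q) $ 2 \<le> 0"
        using 2[of "l q"] by (simp add: inner_real2 algebra_simps)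
      show "(h q - m q) $ 1 * (p - q) $ 1 + (h q - m q) $ 2 * (p - q) $ 2 \<le> 0"
        using 2[of "h q"] by (simp add: inner_real2 algebra_simps)
      show "0 < (l p - m p) $ 1 * (h p - m p) $ 2 - (l p - m p) $ 2 * (h p - m p) $ 1 \<longleftrightarrow>
         0 < (l q - m q) $ 1 * (h q - m q) $ 2 - (l q - m q) $ 2 * (h q - m q) $ 1"
        using pq(3) unfolding \<Phi>_def prod.inject by blast
      show "0 \<le> (l p - m p) $ 1 * (p - q) $ 1 + (l p - m p) $ 2 * (p - q) $ 2"
        using 1[of "l p"] by (simp add: inner_real2)
      show "0 \<le> (h p - m p) $ 1 * (p - q) $ 1 + (h p - m p) $ 2 * (p - q) $ 2"
        using 1[of "h p"] by (simp add: inner_real2)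
      have g_diff: "(x - y) $ 1 + \<tau> * (x - y) $ 2 = g x - g y" for x y
        by (simp add: g_def algebra_simps)
      show "(l p - m p) $ 1 + \<tau> * (l p - m p) $ 2 < 0" "0 < (h p - m p) $ 1 + \<tau> * (h p - m p) $ 2"
        "(l q - m q) $ 1 + \<tau> * (l q - m q) $ 2 < 0" "0 < (h q - m q) $ 1 + \<tau> * (h q - m q) $ 2"
        unfolding g_diff using Tp Tq by auto
      show "(l p - m p) $ 1 * (h p - m p) $ 2 - (l p - m p) $ 2 * (h p - m p) $ 1 \<noteq> 0"
        "(l q - m q) $ 1 * (h q - m q) $ 2 - (l q - m q) $ 2 * (h q - m q) $ 1 \<noteq> 0"
        using Tp Tq by blast+
    qed
    then show "p = q" by (simp add: real2_eq_iff)
  qed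
  moreover have sub: "\<Phi> ` peaks X \<subseteq> X \<times> UNIV" using T by (auto simp: \<Phi>_def T_def)
  moreover have fin: "finite (X \<times> (UNIV :: bool set))" using X by simp
  ultimately show "finite (peaks X)" by (meson finite_imageD finite_subset)
  show "card (peaks X) \<le> 2 * card X"
    using card_inj_on_le[OF \<open>inj_on \<Phi> (peaks X)\<close> sub fin] by (simp add: card_cartesian_product)
qed

subsection \<open>The merge tree of the distance function\<close>

text \<open>The elder rule: \<open>q\<close> outranks \<open>p\<close>. The lexicographic tie-break
  makes this a strict total order, so that exactly one peak of a bounded component is not outranked
  within it.\<close>

definition older :: "(real ^ 2) set \<Rightarrow> real ^ 2 \<Rightarrow> real ^ 2 \<Rightarrow> bool" where
  "older X p q \<longleftrightarrow> infdist p X < infdist q X \<or>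
     infdist p X = infdist q X \<and> (p $ 1 < q $ 1 \<or> p $ 1 = q $ 1 \<and> p $ 2 < q $ 2)"

abbreviation level_component :: "'a::metric_space set \<Rightarrow> real \<Rightarrow> 'a \<Rightarrow> 'a set" where
  "level_component X t p \<equiv> connected_component_set (superlevel X t) p"

text \<open>An unbounded component counts as merged because it carries no class: only the bounded
  components of the complement of a neighbourhood contribute to its first homology.\<close>

definition merged :: "(real ^ 2) set \<Rightarrow> real ^ 2 \<Rightarrow> real \<Rightarrow> bool" where
  "merged X p t \<longleftrightarrow> \<not> bounded (level_component X t p) \<or>
     (\<exists>q\<in>peaks X. older X p q \<and> q \<in> level_component X t p)"

text \<open>As the level decreases, this is where the component of \<open>p\<close> first meets an
  older peak or becomes unbounded. The inserted \<open>0\<close> keeps the set nonempty.\<close>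

definition merge_level :: "(real ^ 2) set \<Rightarrow> real ^ 2 \<Rightarrow> real" where
  "merge_level X p = Sup (insert 0 {t. 0 < t \<and> t \<le> infdist p X \<and> merged X p t})"

definition persistent_components :: "'a::metric_space set \<Rightarrow> real \<Rightarrow> real \<Rightarrow> 'a set set" where
  "persistent_components X s t =
     {C \<in> components (superlevel X s). bounded C \<and> C \<inter> superlevel X t \<noteq> {}}"

definition bars :: "(real ^ 2) set \<Rightarrow> (real \<times> real) multiset" where
  "bars X = image_mset (\<lambda>p. (merge_level X p, infdist p X))
     (mset_set {p \<in> peaks X. merge_level X p < infdist p X})"

lemma older_irrefl: "\<not> older X p p"
  by (auto simp: older_def)

lemma older_trans: "older X p q \<Longrightarrow> older X q r \<Longrightarrow> older X p r"
  by (auto simp: older_def)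

lemma older_total: "p \<noteq> q \<Longrightarrow> older X p q \<or> older X q p"
  by (auto simp: older_def real2_eq_iff)

lemma older_infdist_le: "older X p q \<Longrightarrow> infdist p X \<le> infdist q X"
  by (auto simp: older_def)

lemma ex_oldest:
  assumes "finite A" "A \<noteq> {}"
  obtains p where "p \<in> A" "\<And>q. q \<in> A \<Longrightarrow> \<not> older X p q"
proof -
  have "\<exists>p\<in>A. \<forall>q\<in>A. \<not> older X p q"
    using assms
  proof (induction A rule: finite_ne_induct)
    case (singleton x)
    then show ?case by (simp add: older_irrefl)
  next
    case (insert x F)
    then obtain p where p: "p \<in> F" "\<forall>q\<in>F. \<not> older X p q" by blast
    show ?case
    proof (cases "older X p x")
      case True
      then have "\<not> older X x q" if "q \<in> insert x F" for q
        using that p older_irrefl older_trans by blast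
      then show ?thesis by blast
    qed (use p in blast)
  qed
  then show ?thesis using that by blast
qed

lemma merged_antimono: "merged X p t \<Longrightarrow> s \<le> t \<Longrightarrow> merged X p s"
  unfolding merged_def
  using connected_component_mono[OF superlevel_mono[of s t X], of p] bounded_subset by blast

text \<open>The component \<open>C\<close> of \<open>p\<close> has a compact, relatively open
  neighbourhood \<open>A\<close> in the superlevel set that avoids all older peaks. On the set
  \<open>F\<close> at distance \<open>d / 2\<close> from \<open>A\<close> the distance to
  \<open>X\<close> stays below some \<open>s < t\<close>, so the component of \<open>p\<close> at
  level \<open>s\<close> cannot leave the vicinity of \<open>A\<close>.\<close>

lemma not_merged_open:
  assumes X: "finite X" and t: "0 < t" "t \<le> infdist p X" and nm: "\<not> merged X p t"
  obtains s where "0 < s" "s < t" "\<not> merged X p s"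
proof -
  define K where "K = superlevel X t"
  define C where "C = level_component X t p"
  define Q where "Q = {q \<in> peaks X. older X p q}"
  have pK: "p \<in> K" using t by (simp add: K_def superlevel_def)
  have clK: "closed K" unfolding K_def by (rule closed_superlevel)
  have C: "C \<in> components K" "p \<in> C" using pK by (auto simp: C_def K_def components_def)
  have "bounded C" "Q \<inter> C = {}" using nm by (auto simp: merged_def C_def Q_def)
  have "closed C" using closed_components[OF clK C(1)] .
  then have "compact C" using \<open>bounded C\<close> compact_eq_bounded_closed by blast
  have "finite Q" using finite_peaks[OF X] by (simp add: Q_def)
  then have "open (- Q)" by (simp add: finite_imp_closed open_Compl)
  \<comment> \<open>\<open>C\<close> itself is not known to be relatively open, so the clopen set
    \<open>A\<close> takes its place.\<close>
  then obtain A where A: "openin (top_of_set K) A" "compact A" "C \<subseteq> A" "A \<subseteq> - Q"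
    using Sura_Bura_clopen_subset[OF closed_imp_locally_compact[OF clK] C(1) \<open>compact C\<close>, of "- Q"]
      \<open>Q \<inter> C = {}\<close> by blast
  define B where "B = K - A"
  have "closedin (top_of_set K) B" using A(1) by (auto simp: B_def)
  then have "closed B" using clK closedin_closed_trans by blast
  have "A \<inter> B = {}" by (auto simp: B_def)
  then obtain d where d: "d > 0" "\<And>x y. x \<in> A \<Longrightarrow> y \<in> B \<Longrightarrow> d \<le> dist x y"
    using separate_compact_closed[OF A(2) \<open>closed B\<close>] by blast
  have A0: "A \<noteq> {}" using A(3) C(2) by blast
  have att: "\<exists>a\<in>A. infdist x A = dist x a" for x
    using infdist_attains_inf[OF compact_imp_closed[OF A(2)] A0, of x] by metis
  define F where "F = {x. infdist x A = d / 2}"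
  obtain r where r: "\<And>a. a \<in> A \<Longrightarrow> norm a \<le> r"
    using compact_imp_bounded[OF A(2)] unfolding bounded_iff by blast
  have nb: "norm x \<le> r + d" if "infdist x A \<le> d / 2" for x
  proof -
    obtain a where a: "a \<in> A" "infdist x A = dist x a" using att by blast
    have "norm x \<le> norm a + dist x a" by (metis dist_norm norm_triangle_sub)
    then show ?thesis using r[OF a(1)] a that d by linarith
  qed
  have nearK: "x \<in> A" if "x \<in> K" "infdist x A \<le> d / 2" for x
  proof (rule ccontr)
    assume "x \<notin> A"
    then have "x \<in> B" using that by (simp add: B_def)
    obtain a where a: "a \<in> A" "infdist x A = dist x a" using att by blast
    show False using d(2)[OF a(1) \<open>x \<in> B\<close>] a that d(1) by (simp add: dist_commute)
  qed
  have "F \<inter> K = {}"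
  proof -
    have "x \<notin> K" if "x \<in> F" for x
    proof
      assume "x \<in> K"
      have eq: "infdist x A = d / 2" using that by (simp add: F_def)
      then have "x \<in> A" using nearK[OF \<open>x \<in> K\<close>] by simp
      then show False using eq d by simp
    qed
    then show ?thesis by blast
  qed
  have "closed F" unfolding F_def by (intro closed_Collect_eq continuous_intros)
  moreover have "bounded F" unfolding bounded_iff
  proof (intro exI ballI)
    fix x assume "x \<in> F"
    then have "infdist x A \<le> d / 2" by (simp add: F_def)
    then show "norm x \<le> r + d" by (rule nb)
  qed
  ultimately have "compact F" by (simp add: compact_eq_bounded_closed)
  have "\<exists>s. 0 < s \<and> s < t \<and> (\<forall>x\<in>F. infdist x X < s)"
  proof (cases "F = {}")
    case False
    then obtain m where m: "m \<in> F" "\<And>x. x \<in> F \<Longrightarrow> infdist x X \<le> infdist m X"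
      using continuous_attains_sup[OF \<open>compact F\<close>, of "\<lambda>y. infdist y X"]
        continuous_on_infdist[OF continuous_on_id] by blast
    have "infdist m X < t" using m \<open>F \<inter> K = {}\<close> by (auto simp: K_def superlevel_def)
    then obtain s where "infdist m X < s" "s < t" using dense by blast
    then show ?thesis using m(2) infdist_nonneg[of m X] by (intro exI[of _ s]) force
  qed (use t in \<open>auto intro: exI[of _ "t / 2"]\<close>)
  then obtain s where s: "0 < s" "s < t" "\<And>x. x \<in> F \<Longrightarrow> infdist x X < s" by blast
  define S where "S = level_component X s p"
  have pS: "p \<in> S" using t s by (simp add: S_def superlevel_def)
  have Ssub: "S \<subseteq> superlevel X s" unfolding S_def by (rule connected_component_subset)
  have "connected S" by (simp add: S_def)
  have SF: "S \<inter> F = {}" using Ssub s(3) by (force simp: superlevel_def)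
  have SW: "infdist x A < d / 2" if "x \<in> S" for x
  proof (rule ccontr)
    assume "\<not> infdist x A < d / 2"
    then have x: "infdist x A > d / 2" using SF that by (auto simp: F_def)
    have o: "open {x. infdist x A < d / 2}" "open {x. d / 2 < infdist x A}"
      by (intro open_Collect_less continuous_intros)+
    have "p \<in> {x. infdist x A < d / 2}" using C A(3) d by auto
    moreover have "S \<subseteq> {x. infdist x A < d / 2} \<union> {x. d / 2 < infdist x A}"
      using SF by (force simp: F_def)
    moreover have "{x. infdist x A < d / 2} \<inter> {x. d / 2 < infdist x A} \<inter> S = {}" by auto
    ultimately show False
      using connectedD[OF \<open>connected S\<close> o] pS that x by blast
  qed
  have "bounded S" unfolding bounded_iff
  proof (intro exI ballI)
    fix x assume "x \<in> S"
    then show "norm x \<le> r + d" by (intro nb less_imp_le[OF SW])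
  qed
  moreover have "q \<notin> S" if "q \<in> peaks X" "older X p q" for q
  proof
    assume "q \<in> S"
    \<comment> \<open>An older peak is at least as high as \<open>p\<close>, so it already belongs
      to the superlevel set at level \<open>t\<close>; being close to \<open>A\<close>, it would lie
      in \<open>A\<close>.\<close>
    have "q \<in> K" using older_infdist_le[OF that(2)] t by (simp add: K_def superlevel_def)
    then have "q \<in> A" using nearK less_imp_le[OF SW[OF \<open>q \<in> S\<close>]] by blast
    then show False using A(4) that by (auto simp: Q_def)
  qed
  ultimately have "\<not> merged X p s" by (auto simp: merged_def S_def)
  then show ?thesis using that s by blast
qed

lemma bdd_merge_levels: "bdd_above (insert 0 {t. 0 < t \<and> t \<le> infdist p X \<and> merged X p t})"
  by (rule bdd_aboveI[of _ "infdist p X"]) (auto simp: infdist_nonneg)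

lemma merge_level_nonneg: "0 \<le> merge_level X p"
  unfolding merge_level_def by (rule cSup_upper[OF _ bdd_merge_levels]) simp

text \<open>By \<open>not_merged_open\<close> a positive supremum is attained. Hence the interval of
  \<open>p\<close> is alive at \<open>s\<close> exactly for \<open>merge_level X p < s\<close>, the
  strict inequality of \<open>is_persistence_multiset\<close>.\<close>

lemma merged_iff:
  assumes X: "finite X" and t: "0 < t" "t \<le> infdist p X"
  shows "merged X p t \<longleftrightarrow> t \<le> merge_level X p"
proof
  assume "merged X p t"
  then show "t \<le> merge_level X p"
    unfolding merge_level_def using t by (intro cSup_upper bdd_merge_levels) simp
next
  assume le: "t \<le> merge_level X p"
  show "merged X p t"
  proof (rule ccontr)
    assume "\<not> merged X p t"
    then obtain s where s: "0 < s" "s < t" "\<not> merged X p s" using not_merged_open[OF X t] by blast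
    have "merge_level X p \<le> s"
      unfolding merge_level_def
    proof (rule cSup_least)
      fix u assume "u \<in> insert 0 {t. 0 < t \<and> t \<le> infdist p X \<and> merged X p t}"
      then show "u \<le> s" using s merged_antimono[of X p u s] by fastforce
    qed simp
    then show False using le s by simp
  qed
qed

text \<open>Each bounded component is represented by its peak of highest rank. This peak reaches the
  maximum of the distance on the component, because that maximum is itself attained at a
  peak.\<close>

lemma persistent_components_bij:
  assumes X: "finite X" "X \<noteq> {}" and st: "0 < s" "s \<le> t"
  shows "bij_betw (level_component X s) {p \<in> peaks X. merge_level X p < s \<and> t \<le> infdist p X}
           (persistent_components X s t)"
proof (rule bij_betwI')
  fix p q assume p: "p \<in> {p \<in> peaks X. merge_level X p < s \<and> t \<le> infdist p X}"
    and q: "q \<in> {p \<in> peaks X. merge_level X p < s \<and> t \<le> infdist p X}"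
  have nm: "\<not> merged X p s" "\<not> merged X q s" using p q merged_iff[OF X(1) st(1)] st by auto
  have self: "p \<in> level_component X s p" "q \<in> level_component X s q"
    using p q st by (auto simp: superlevel_def)
  show "(level_component X s p = level_component X s q) = (p = q)"
  proof
    assume eq: "level_component X s p = level_component X s q"
    show "p = q"
    proof (rule ccontr)
      assume "p \<noteq> q"
      then consider "older X p q" | "older X q p" using older_total by blast
      then show False using nm self eq p q unfolding merged_def by cases blast+
    qed
  qed simp
next
  fix p assume p: "p \<in> {p \<in> peaks X. merge_level X p < s \<and> t \<le> infdist p X}"
  then have nm: "\<not> merged X p s" using merged_iff[OF X(1) st(1)] st by auto
  have pK: "p \<in> superlevel X s" "p \<in> superlevel X t" using p st by (auto simp: superlevel_def)
  have "level_component X s p \<in> components (superlevel X s)" using pK by (auto simp: components_def)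
  moreover have "p \<in> level_component X s p" using pK by simp
  then have "level_component X s p \<inter> superlevel X t \<noteq> {}" using pK by blast
  ultimately show "level_component X s p \<in> persistent_components X s t"
    using nm pK by (auto simp: persistent_components_def merged_def)
next
  fix C assume C: "C \<in> persistent_components X s t"
  then have CC: "C \<in> components (superlevel X s)" "bounded C"
    by (auto simp: persistent_components_def)
  obtain y where y: "y \<in> C" "t \<le> infdist y X"
    using C by (auto simp: persistent_components_def superlevel_def)
  obtain p0 where p0: "p0 \<in> C" "p0 \<in> peaks X" "\<And>y. y \<in> C \<Longrightarrow> infdist y X \<le> infdist p0 X"
    using bounded_component_peak[OF X CC] by blast
  have "finite (peaks X \<inter> C)" "peaks X \<inter> C \<noteq> {}" using finite_peaks[OF X(1)] p0 by auto
  then obtain p where p: "p \<in> peaks X \<inter> C" "\<And>q. q \<in> peaks X \<inter> C \<Longrightarrow> \<not> older X p q"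
    using ex_oldest by blast
  have "infdist p0 X \<le> infdist p X" using p(2)[of p0] p0 by (auto simp: older_def)
  then have tp: "t \<le> infdist p X" using p0(3)[OF y(1)] y by linarith
  have Cp: "C = level_component X s p"
    using CC(1) p(1) by (metis IntD2 components_iff connected_component_eq)
  then have "\<not> merged X p s" using p CC by (auto simp: merged_def)
  then have "merge_level X p < s" using merged_iff[OF X(1) st(1), of p] st tp by auto
  then show "\<exists>p\<in>{p \<in> peaks X. merge_level X p < s \<and> t \<le> infdist p X}. C = level_component X s p"
    using p tp Cp by blast
qed

lemma finite_persistent_components:
  fixes X :: "(real ^ 2) set"
  assumes "finite X" "X \<noteq> {}" "0 < s" "s \<le> t"
  shows "finite (persistent_components X s t)"
proof -
  have "finite {p \<in> peaks X. merge_level X p < s \<and> t \<le> infdist p X}"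
    using finite_peaks[OF assms(1)] by simp
  then show ?thesis using bij_betw_finite[OF persistent_components_bij[OF assms]] by blast
qed

lemma size_bars:
  assumes "finite X"
  shows "size {#(b, d) \<in># bars X. P b d#} =
    card {p \<in> peaks X. merge_level X p < infdist p X \<and> P (merge_level X p) (infdist p X)}"
proof -
  have "{#(b, d) \<in># bars X. P b d#} = image_mset (\<lambda>p. (merge_level X p, infdist p X))
      {#p \<in># mset_set {p \<in> peaks X. merge_level X p < infdist p X}. P (merge_level X p) (infdist p X)#}"
    unfolding bars_def filter_mset_image_mset by (simp only: prod.case)
  moreover define S where "S = {p \<in> peaks X. merge_level X p < infdist p X}"
  moreover have "finite S" using finite_peaks[OF assms] by (simp add: S_def)
  ultimately have "size {#(b, d) \<in># bars X. P b d#} = card {p \<in> S. P (merge_level X p) (infdist p X)}"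
    by (simp only: size_image_mset filter_mset_mset_set size_mset_set)
  moreover have "{p \<in> S. P (merge_level X p) (infdist p X)} =
      {p \<in> peaks X. merge_level X p < infdist p X \<and> P (merge_level X p) (infdist p X)}"
    by (auto simp: S_def)
  ultimately show ?thesis by simp
qed

lemma card_persistent_components:
  assumes "finite X" "X \<noteq> {}" "0 < s" "s \<le> t"
  shows "card (persistent_components X s t) = size {#(b, d) \<in># bars X. b < s \<and> t \<le> d#}"
proof -
  have "{p \<in> peaks X. merge_level X p < infdist p X \<and> merge_level X p < s \<and> t \<le> infdist p X} =
      {p \<in> peaks X. merge_level X p < s \<and> t \<le> infdist p X}"
    using assms(4) by auto
  then show ?thesis
    using bij_betw_same_card[OF persistent_components_bij[OF assms]]
      size_bars[OF assms(1), of "\<lambda>b d. b < s \<and> t \<le> d"] by metis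
qed

lemma in_bars_bounds: "finite X \<Longrightarrow> (b, d) \<in># bars X \<Longrightarrow> 0 \<le> b \<and> b < d"
  using finite_peaks[of X] merge_level_nonneg[of X] unfolding bars_def by auto

subsection \<open>Packing bounds on the bars\<close>

text \<open>The distance to \<open>X\<close> is 1-Lipschitz, so the ball of radius
  \<open>dist p q\<close> around \<open>p\<close> stays above level
  \<open>infdist p X - dist p q\<close> and connects \<open>p\<close> to \<open>q\<close>
  there.\<close>

lemma older_peak_dist:
  assumes X: "finite X" and pq: "q \<in> peaks X" "older X p q"
  shows "infdist p X - merge_level X p \<le> dist p q"
proof (rule ccontr)
  assume "\<not> ?thesis"
  then have lt: "merge_level X p < infdist p X - dist p q" by simp
  define t where "t = infdist p X - dist p q"
  have t: "0 < t" "t \<le> infdist p X" using lt merge_level_nonneg[of X p] by (auto simp: t_def)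
  have "cball p (dist p q) \<subseteq> superlevel X t"
  proof
    fix y assume "y \<in> cball p (dist p q)"
    then show "y \<in> superlevel X t"
      using infdist_triangle[of p X y] by (auto simp: superlevel_def t_def)
  qed
  then have "cball p (dist p q) \<subseteq> level_component X t p"
    by (intro connected_component_maximal) auto
  then have "q \<in> level_component X t p" by auto
  then have "merged X p t" using pq by (auto simp: merged_def)
  then show False using merged_iff[OF X t] lt by (simp add: t_def)
qed

text \<open>Of two peaks in the set one is older, so they are at least \<open>\<delta>\<close>
  apart. A square of side \<open>\<delta> / 2\<close> therefore contains at most one of them, and it
  remains to count such squares.\<close>

lemma card_long_bars:
  assumes X: "finite X" "X \<noteq> {}" "X \<subseteq> cball 0 R" and d: "\<delta> > 0"
  shows "real (card {p \<in> peaks X. \<delta> \<le> infdist p X - merge_level X p}) * \<delta>\<^sup>2 \<le> 100 * R\<^sup>2"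
proof (cases "{p \<in> peaks X. \<delta> \<le> infdist p X - merge_level X p} = {}")
  case False
  define S where "S = {p \<in> peaks X. \<delta> \<le> infdist p X - merge_level X p}"
  have R0: "0 \<le> R" using X by (metis cball_empty not_less subset_empty)
  have nrm: "norm p \<le> R" if "p \<in> S" for p
    using peaks_norm_le[OF X(3) _ R0] that by (simp add: S_def)
  obtain p where p: "p \<in> S" using False by (auto simp: S_def)
  obtain x where x: "x \<in> X" using X by blast
  have "infdist p X \<le> dist p x" by (rule infdist_le[OF x])
  also have "\<dots> \<le> norm p + norm x" by (metis dist_norm norm_triangle_ineq4)
  also have "\<dots> \<le> 2 * R" using nrm[OF p] X(3) x by auto
  \<comment> \<open>No bar is longer than its peak is high. The resulting
    \<open>1 \<le> 2 * R / \<delta>\<close> absorbs the rounding: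
    \<open>2 * k + 1 \<le> 5 * (2 * R / \<delta>)\<close>, whence the constant
    \<open>100 = 10\<^sup>2\<close>.\<close>
  finally have d2R: "\<delta> \<le> 2 * R" using p merge_level_nonneg[of X p] by (simp add: S_def)
  define k where "k = \<lceil>2 * R / \<delta>\<rceil>"
  define \<Phi> where "\<Phi> p = (\<lfloor>2 * p $ 1 / \<delta>\<rfloor>, \<lfloor>2 * p $ (2::2) / \<delta>\<rfloor>)" for p :: "real ^ 2"
  have "inj_on \<Phi> S"
  proof (rule inj_onI, rule ccontr)
    fix p q assume pq: "p \<in> S" "q \<in> S" "\<Phi> p = \<Phi> q" "p \<noteq> q"
    have far: "\<delta> \<le> dist p q"
      using older_total[OF pq(4), of X]
    proof
      assume "older X p q"
      from older_peak_dist[OF X(1) _ this] pq(1,2) show ?thesis by (simp add: S_def)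
    next
      assume "older X q p"
      from older_peak_dist[OF X(1) _ this] pq(1,2) show ?thesis by (simp add: S_def dist_commute)
    qed
    have near: "\<bar>a - b\<bar> \<le> \<delta> / 2" if "\<lfloor>2 * a / \<delta>\<rfloor> = \<lfloor>2 * b / \<delta>\<rfloor>" for a b
    proof -
      have "\<bar>2 * a / \<delta> - 2 * b / \<delta>\<bar> \<le> 1" using that by linarith
      moreover have "2 * a / \<delta> - 2 * b / \<delta> = 2 * (a - b) / \<delta>"
        by (simp add: diff_divide_distrib right_diff_distrib)
      ultimately have "\<bar>2 * (a - b)\<bar> \<le> \<delta>" using d by (simp add: abs_divide)
      then have "2 * \<bar>a - b\<bar> \<le> \<delta>" by (simp only: abs_mult abs_numeral)
      then show ?thesis by simp
    qed
    have "\<bar>(p - q) $ 1\<bar> \<le> \<delta> / 2" "\<bar>(p - q) $ 2\<bar> \<le> \<delta> / 2"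
      using near[of "p $ 1" "q $ 1"] near[of "p $ 2" "q $ 2"] pq(3) by (auto simp: \<Phi>_def)
    then have "((p - q) $ 1)\<^sup>2 \<le> (\<delta> / 2)\<^sup>2" "((p - q) $ 2)\<^sup>2 \<le> (\<delta> / 2)\<^sup>2"
      by (metis abs_ge_zero power2_abs power_mono)+
    moreover have "(dist p q)\<^sup>2 = ((p - q) $ 1)\<^sup>2 + ((p - q) $ 2)\<^sup>2"
      unfolding dist_norm power2_norm_eq_inner inner_real2 by (simp add: power2_eq_square)
    moreover have "\<delta>\<^sup>2 \<le> (dist p q)\<^sup>2" using far d by (simp add: power_mono)
    moreover have "\<delta>\<^sup>2 > 0" using d by simp
    ultimately show False by (simp add: power_divide)
  qed
  moreover have "\<Phi> ` S \<subseteq> {-k..k} \<times> {-k..k}"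
  proof -
    have "- k \<le> \<lfloor>2 * a / \<delta>\<rfloor> \<and> \<lfloor>2 * a / \<delta>\<rfloor> \<le> k" if "\<bar>a\<bar> \<le> R" for a
    proof -
      have "\<bar>2 * a / \<delta>\<bar> \<le> 2 * R / \<delta>" using that d by (simp add: abs_mult divide_right_mono)
      then show ?thesis unfolding k_def by linarith
    qed
    moreover have "\<bar>p $ i\<bar> \<le> R" if "p \<in> S" for p :: "real ^ 2" and i
      using nrm[OF that] component_le_norm_cart[of p i] by linarith
    ultimately show ?thesis by (auto simp: \<Phi>_def)
  qed
  ultimately have "card S \<le> card ({-k..k} \<times> {-k..k})"
    by (intro card_inj_on_le) auto
  also have "\<dots> = (nat (2 * k + 1))\<^sup>2" by (simp add: card_cartesian_product power2_eq_square algebra_simps)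
  finally have "real (card S) \<le> (real (nat (2 * k + 1)))\<^sup>2"
    by (metis of_nat_le_iff of_nat_power)
  also have "\<dots> \<le> (10 * R / \<delta>)\<^sup>2"
  proof (rule power_mono)
    have "1 \<le> 2 * R / \<delta>" using d2R d by simp
    moreover have "real_of_int k \<le> 2 * R / \<delta> + 1" unfolding k_def by linarith
    moreover have "10 * R / \<delta> = 5 * (2 * R / \<delta>)" by simp
    ultimately show "real (nat (2 * k + 1)) \<le> 10 * R / \<delta>" by linarith
  qed simp
  finally have "real (card S) * \<delta>\<^sup>2 \<le> (10 * R / \<delta>)\<^sup>2 * \<delta>\<^sup>2" by (rule mult_right_mono) simp
  also have "\<dots> = 100 * R\<^sup>2" using d by (simp add: power_divide power_mult_distrib)
  finally show ?thesis by (simp add: S_def)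
next
  case True
  show ?thesis unfolding True by simp
qed

text \<open>Remove the shortest element \<open>p\<close>. With \<open>\<delta> = l p\<close> the
  packing bound counts all of \<open>S\<close>, so \<open>card S * (l p)\<^sup>2 \<le> B\<close>;
  this is the last term on the right.\<close>

lemma sum_powr_le_of_packing:
  fixes l :: "'a \<Rightarrow> real"
  assumes "finite S" "\<And>p. p \<in> S \<Longrightarrow> 0 < l p" "0 < \<alpha>"
    and "\<And>\<delta>. \<delta> > 0 \<Longrightarrow> real (card {p \<in> S. \<delta> \<le> l p}) * \<delta>\<^sup>2 \<le> B"
  shows "(\<Sum>p\<in>S. l p powr \<alpha>) \<le> (\<Sum>k=1..card S. (B / real k) powr (\<alpha> / 2))"
  using assms(1,2,4)
proof (induction "card S" arbitrary: S)
  case (Suc n)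
  then have "S \<noteq> {}" by auto
  obtain p where p: "p \<in> S" "\<And>q. q \<in> S \<Longrightarrow> l p \<le> l q"
    using arg_min_if_finite(1)[OF Suc.prems(1) \<open>S \<noteq> {}\<close>] arg_min_least[OF Suc.prems(1) \<open>S \<noteq> {}\<close>] by metis
  have c: "card (S - {p}) = n" using Suc.hyps(2) p Suc.prems(1) by simp
  have "real (card {q \<in> S - {p}. \<delta> \<le> l q}) * \<delta>\<^sup>2 \<le> B" if "\<delta> > 0" for \<delta>
  proof -
    have "card {q \<in> S - {p}. \<delta> \<le> l q} \<le> card {q \<in> S. \<delta> \<le> l q}"
      using Suc.prems(1) by (intro card_mono) auto
    then have "real (card {q \<in> S - {p}. \<delta> \<le> l q}) * \<delta>\<^sup>2 \<le> real (card {q \<in> S. \<delta> \<le> l q}) * \<delta>\<^sup>2"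
      by (intro mult_right_mono) auto
    also have "\<dots> \<le> B" using Suc.prems(3)[OF that] .
    finally show ?thesis .
  qed
  then have IH: "(\<Sum>q\<in>S - {p}. l q powr \<alpha>) \<le> (\<Sum>k=1..n. (B / real k) powr (\<alpha> / 2))"
    using Suc.hyps(1)[of "S - {p}"] c Suc.prems by auto
  have lp: "0 < l p" using Suc.prems p by blast
  have "{q \<in> S. l p \<le> l q} = S" using p by auto
  then have "real (Suc n) * (l p)\<^sup>2 \<le> B" using Suc.prems(3)[OF lp] Suc.hyps(2) by simp
  then have "(l p)\<^sup>2 \<le> B / real (Suc n)" by (simp add: field_simps)
  then have "((l p)\<^sup>2) powr (\<alpha> / 2) \<le> (B / real (Suc n)) powr (\<alpha> / 2)"
    using assms(3) by (intro powr_mono2) auto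
  moreover have "((l p)\<^sup>2) powr (\<alpha> / 2) = l p powr \<alpha>"
    using lp by (simp add: powr_powr flip: powr_numeral)
  ultimately have "l p powr \<alpha> \<le> (B / real (Suc n)) powr (\<alpha> / 2)" by simp
  moreover have "(\<Sum>q\<in>S. l q powr \<alpha>) = l p powr \<alpha> + (\<Sum>q\<in>S - {p}. l q powr \<alpha>)"
    using p Suc.prems(1) by (simp add: sum.remove)
  moreover have "(\<Sum>k=1..card S. (B / real k) powr (\<alpha> / 2)) =
      (B / real (Suc n)) powr (\<alpha> / 2) + (\<Sum>k=1..n. (B / real k) powr (\<alpha> / 2))"
    unfolding Suc.hyps(2)[symmetric] by (simp add: add.commute)
  ultimately show ?case using IH by linarith
qed simp

text \<open>Comparison with the integral of \<open>x powr (- a)\<close>, term by term by the mean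
  value theorem. The antiderivative is not differentiable at \<open>0\<close>, so the first term is
  treated separately.\<close>

lemma sum_inverse_powr_le:
  fixes a :: real
  assumes "0 < a" "a < 1"
  shows "(\<Sum>k=1..m. (1 / real k) powr a) \<le> real m powr (1 - a) / (1 - a)"
proof (induction m)
  case (Suc m)
  have "(1 / real (Suc m)) powr a \<le> (real (Suc m) powr (1 - a) - real m powr (1 - a)) / (1 - a)"
  proof (cases "m = 0")
    case False
    have "\<exists>z. real m < z \<and> z < real (Suc m) \<and>
        real (Suc m) powr (1 - a) - real m powr (1 - a) = (real (Suc m) - real m) * ((1 - a) * z powr (- a))"
      using False by (intro MVT2) (auto intro!: derivative_eq_intros)
    then obtain z where z: "real m < z" "z < real (Suc m)"
      "real (Suc m) powr (1 - a) - real m powr (1 - a) = (1 - a) * z powr (- a)"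
      by auto
    have "real (Suc m) powr (- a) \<le> z powr (- a)"
      using z False assms by (intro powr_mono2') auto
    then show ?thesis using z(3) assms by (simp add: powr_minus_divide powr_divide)
  qed (use assms in simp)
  then show ?case using Suc by (simp add: diff_divide_distrib)
qed (use assms in simp)

lemma sum_bars_le:
  assumes X: "finite X" "X \<noteq> {}" "X \<subseteq> cball 0 R" and \<alpha>: "0 < \<alpha>" and n: "card X \<le> n"
  shows "(\<Sum>(b, d)\<in>#bars X. (d - b) powr \<alpha>) \<le>
    (100 * R\<^sup>2) powr (\<alpha> / 2) * (\<Sum>k=1..2 * n. (1 / real k) powr (\<alpha> / 2))"
proof -
  define S where "S = {p \<in> peaks X. merge_level X p < infdist p X}"
  have fin: "finite S" using finite_peaks[OF X(1)] by (simp add: S_def)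
  have "(\<Sum>(b, d)\<in>#bars X. (d - b) powr \<alpha>) = (\<Sum>p\<in>S. (infdist p X - merge_level X p) powr \<alpha>)"
    by (simp add: bars_def S_def[symmetric] image_mset.compositionality o_def sum_unfold_sum_mset)
  also have "\<dots> \<le> (\<Sum>k=1..card S. (100 * R\<^sup>2 / real k) powr (\<alpha> / 2))"
  proof (rule sum_powr_le_of_packing[OF fin _ \<alpha>])
    fix \<delta> :: real assume "\<delta> > 0"
    then have "{p \<in> S. \<delta> \<le> infdist p X - merge_level X p} =
        {p \<in> peaks X. \<delta> \<le> infdist p X - merge_level X p}" by (auto simp: S_def)
    then show "real (card {p \<in> S. \<delta> \<le> infdist p X - merge_level X p}) * \<delta>\<^sup>2 \<le> 100 * R\<^sup>2"
      using card_long_bars[OF X \<open>\<delta> > 0\<close>] by simp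
  qed (simp add: S_def)
  also have "\<dots> \<le> (\<Sum>k=1..2 * n. (100 * R\<^sup>2 / real k) powr (\<alpha> / 2))"
  proof (rule sum_mono2)
    have "card S \<le> card (peaks X)" using finite_peaks[OF X(1)] by (intro card_mono) (auto simp: S_def)
    then show "{1..card S} \<subseteq> {1..2 * n}" using card_peaks_le[OF X(1)] n by auto
  qed auto
  also have "\<dots> = (100 * R\<^sup>2) powr (\<alpha> / 2) * (\<Sum>k=1..2 * n. (1 / real k) powr (\<alpha> / 2))"
    by (simp add: sum_distrib_left powr_divide)
  finally show ?thesis .
qed

subsection \<open>Stability of the rank function\<close>

text \<open>Interleaving: mark a point of height \<open>t + \<eta>\<close> in each component for
  \<open>X\<close>. Its component for \<open>Y\<close> at level \<open>s\<close> is contained in the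
  original one, so it is bounded, and different originals yield different components.\<close>

lemma card_persistent_components_le:
  fixes X Y :: "(real ^ 2) set"
  assumes Y: "finite Y" "Y \<noteq> {}" and close: "\<And>x. \<bar>infdist x X - infdist x Y\<bar> \<le> \<eta>"
    and st: "0 < s" "s \<le> t"
  shows "card (persistent_components X (s - \<eta>) (t + \<eta>)) \<le> card (persistent_components Y s t)"
proof -
  have ex: "\<exists>y. y \<in> C \<and> y \<in> superlevel X (t + \<eta>)" if "C \<in> persistent_components X (s - \<eta>) (t + \<eta>)" for C
    using that by (auto simp: persistent_components_def)
  then obtain y where y: "\<And>C. C \<in> persistent_components X (s - \<eta>) (t + \<eta>) \<Longrightarrow>
      y C \<in> C \<and> y C \<in> superlevel X (t + \<eta>)"
    by metis
  have sub: "superlevel X (t + \<eta>) \<subseteq> superlevel Y t" "superlevel Y s \<subseteq> superlevel X (s - \<eta>)"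
    "superlevel Y t \<subseteq> superlevel Y s"
  proof -
    have b: "infdist x X - \<eta> \<le> infdist x Y" "infdist x Y - \<eta> \<le> infdist x X" for x
      using close[of x] by linarith+
    show "superlevel X (t + \<eta>) \<subseteq> superlevel Y t" "superlevel Y s \<subseteq> superlevel X (s - \<eta>)"
      unfolding superlevel_def using order_trans[OF _ b(1)] order_trans[OF _ b(2)] by force+
    show "superlevel Y t \<subseteq> superlevel Y s" by (rule superlevel_mono[OF st(2)])
  qed
  have main: "level_component Y s (y C) \<in> persistent_components Y s t \<and> y C \<in> level_component Y s (y C) \<and>
      level_component Y s (y C) \<subseteq> C"
    if C: "C \<in> persistent_components X (s - \<eta>) (t + \<eta>)" for C
  proof -
    have yC: "y C \<in> C" "y C \<in> superlevel Y t" "y C \<in> superlevel Y s" using y[OF C] sub by blast+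
    have CC: "C \<in> components (superlevel X (s - \<eta>))" "bounded C"
      using C by (auto simp: persistent_components_def)
    have self: "y C \<in> level_component Y s (y C)" using yC by simp
    have "level_component Y s (y C) \<subseteq> superlevel X (s - \<eta>)"
      using connected_component_subset sub by blast
    then have le: "level_component Y s (y C) \<subseteq> C"
    proof (rule components_maximal[OF CC(1) connected_connected_component])
      show "C \<inter> level_component Y s (y C) \<noteq> {}" using self yC(1) by blast
    qed
    moreover have "level_component Y s (y C) \<in> components (superlevel Y s)"
      using yC by (auto simp: components_def)
    ultimately show ?thesis
      using self yC CC bounded_subset unfolding persistent_components_def by blast
  qed
  have "inj_on (\<lambda>C. level_component Y s (y C)) (persistent_components X (s - \<eta>) (t + \<eta>))"
  proof (rule inj_onI)
    fix C C' assume C: "C \<in> persistent_components X (s - \<eta>) (t + \<eta>)"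
      "C' \<in> persistent_components X (s - \<eta>) (t + \<eta>)"
      "level_component Y s (y C) = level_component Y s (y C')"
    then have "C \<inter> C' \<noteq> {}" using main by blast
    then show "C = C'"
      using C(1,2) components_nonoverlap unfolding persistent_components_def by blast
  qed
  then show ?thesis
    using main by (intro card_inj_on_le[OF _ _ finite_persistent_components[OF Y st]]) auto
qed

lemma infdist_image_close:
  assumes "finite J" "J \<noteq> {}" "\<And>j. j \<in> J \<Longrightarrow> dist (x j) (y j) \<le> \<eta>"
  shows "\<bar>infdist p (x ` J) - infdist p (y ` J)\<bar> \<le> \<eta>"
proof -
  have "infdist p (u ` J) \<le> infdist p (v ` J) + \<eta>" if "\<And>j. j \<in> J \<Longrightarrow> dist (u j) (v j) \<le> \<eta>"
    for u v :: "_ \<Rightarrow> 'b"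
  proof -
    have eq: "infdist p (v ` J) = (INF z\<in>v ` J. dist p z)"
      using assms(2) by (simp add: infdist_notempty)
    have "infdist p (u ` J) - \<eta> \<le> infdist p (v ` J)"
      unfolding eq
    proof (rule cINF_greatest)
      show "v ` J \<noteq> {}" using assms by simp
      fix z assume "z \<in> v ` J"
      then obtain j where j: "j \<in> J" "z = v j" by blast
      have "infdist p (u ` J) \<le> dist p (u j)" using j by (intro infdist_le) auto
      also have "\<dots> \<le> dist p (v j) + dist (u j) (v j)" by (metis dist_commute dist_triangle)
      finally show "infdist p (u ` J) - \<eta> \<le> dist p z" using that[OF j(1)] j by simp
    qed
    then show ?thesis by simp
  qed
  from this[of x y] this[of y x] assms(3) show ?thesis by (simp add: dist_commute abs_le_iff)
qed

subsection \<open>Field chains as a vector space\<close>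

lemma lookup_chain_scale [simp]: "Poly_Mapping.lookup (chain_scale a c) f = a * Poly_Mapping.lookup c f"
  by (simp add: chain_scale_def Poly_Mapping.map.rep_eq when_def)

lemma chain_scale_algebra:
  "chain_scale a (c + c') = chain_scale a c + chain_scale a c'"
  "chain_scale (a + b) c = chain_scale a c + chain_scale b c"
  "chain_scale (a * b) c = chain_scale a (chain_scale b c)"
  "chain_scale 1 c = c" "chain_scale 0 c = 0" "chain_scale a 0 = 0"
  by (auto intro!: poly_mapping_eqI simp: lookup_add algebra_simps)

lemma chain_scale_sum: "chain_scale a (sum g I) = (\<Sum>i\<in>I. chain_scale a (g i))"
  by (induction I rule: infinite_finite_induct) (auto simp: chain_scale_algebra)

lemma chain_scale_minus_one: "chain_scale (- 1) c = - c"
  by (auto intro!: poly_mapping_eqI)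

definition chain_subspace :: "('a, 'k::field) field_chain set \<Rightarrow> bool" where
  "chain_subspace S \<longleftrightarrow> 0 \<in> S \<and> (\<forall>c\<in>S. \<forall>c'\<in>S. c + c' \<in> S) \<and> (\<forall>a. \<forall>c\<in>S. chain_scale a c \<in> S)"

lemma chain_subspaceD:
  assumes "chain_subspace S"
  shows "0 \<in> S" "c \<in> S \<Longrightarrow> c' \<in> S \<Longrightarrow> c + c' \<in> S" "c \<in> S \<Longrightarrow> chain_scale a c \<in> S"
    "c \<in> S \<Longrightarrow> - c \<in> S" "c \<in> S \<Longrightarrow> c' \<in> S \<Longrightarrow> c - c' \<in> S"
proof -
  show z: "0 \<in> S" "c \<in> S \<Longrightarrow> c' \<in> S \<Longrightarrow> c + c' \<in> S" "c \<in> S \<Longrightarrow> chain_scale a c \<in> S" for c c' a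
    using assms by (auto simp: chain_subspace_def)
  show n: "c \<in> S \<Longrightarrow> - c \<in> S" for c using z(3)[of c "- 1"] by (simp add: chain_scale_minus_one)
  show "c \<in> S \<Longrightarrow> c' \<in> S \<Longrightarrow> c - c' \<in> S" using z(2)[of c "- c'"] n[of c'] by simp
qed

lemma chain_subspace_sum:
  "chain_subspace S \<Longrightarrow> (\<And>i. i \<in> I \<Longrightarrow> g i \<in> S) \<Longrightarrow> sum g I \<in> S"
  by (induction I rule: infinite_finite_induct) (auto intro: chain_subspaceD)

lemma chain_subspace_minus_swap:
  "chain_subspace S \<Longrightarrow> c - c' \<in> S \<longleftrightarrow> c' - c \<in> S"
  using chain_subspaceD(4)[of S "c - c'"] chain_subspaceD(4)[of S "c' - c"] by auto

text \<open>The order of the summands is that of the right cosets in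
  \<open>quotient_module\<close>.\<close>

definition coset :: "('a, 'k::field) field_chain set \<Rightarrow> ('a, 'k) field_chain \<Rightarrow> ('a, 'k) field_chain set" where
  "coset B z = (\<lambda>b. b + z) ` B"

lemma coset_eq_iff:
  assumes "chain_subspace B"
  shows "coset B z = coset B z' \<longleftrightarrow> z - z' \<in> B"
proof
  assume eq: "coset B z = coset B z'"
  have "z \<in> coset B z" using chain_subspaceD(1)[OF assms] by (force simp: coset_def)
  then obtain b where "b \<in> B" "z = b + z'" using eq by (auto simp: coset_def)
  then show "z - z' \<in> B" by simp
next
  assume d: "z - z' \<in> B"
  then have d': "z' - z \<in> B" using chain_subspace_minus_swap[OF assms] by blast
  have "b + z \<in> coset B z'" "b + z' \<in> coset B z" if "b \<in> B" for b
  proof -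
    have "b + z = (b + (z - z')) + z'" "b + z' = (b + (z' - z)) + z" by simp_all
    then show "b + z \<in> coset B z'" "b + z' \<in> coset B z"
      unfolding coset_def using chain_subspaceD(2)[OF assms that d] chain_subspaceD(2)[OF assms that d']
      by blast+
  qed
  then show "coset B z = coset B z'" by (auto simp: coset_def)
qed

lemma coset_add:
  assumes "chain_subspace B"
  shows "{x + y |x y. x \<in> coset B z \<and> y \<in> coset B z'} = coset B (z + z')"
proof (intro equalityI subsetI)
  fix w assume "w \<in> {x + y |x y. x \<in> coset B z \<and> y \<in> coset B z'}"
  then obtain b b' where "b \<in> B" "b' \<in> B" "w = (b + z) + (b' + z')" by (auto simp: coset_def)
  then show "w \<in> coset B (z + z')"
    using chain_subspaceD(2)[OF assms] by (auto simp: coset_def image_iff algebra_simps intro!: bexI[of _ "b + b'"])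
next
  fix w assume "w \<in> coset B (z + z')"
  then obtain b where b: "b \<in> B" "w = b + (z + z')" by (auto simp: coset_def)
  have "b + z \<in> coset B z" "0 + z' \<in> coset B z'"
    using b chain_subspaceD(1)[OF assms] by (auto simp: coset_def)
  moreover have "w = (b + z) + (0 + z')" using b by (simp add: algebra_simps)
  ultimately show "w \<in> {x + y |x y. x \<in> coset B z \<and> y \<in> coset B z'}" by blast
qed

lemma coset_scale:
  assumes "chain_subspace B"
  shows "(\<Union>s\<in>coset B z. coset B (chain_scale a s)) = coset B (chain_scale a z)"
proof -
  have "coset B (chain_scale a s) = coset B (chain_scale a z)" if "s \<in> coset B z" for s
  proof -
    from that obtain b where b: "b \<in> B" "s = b + z" by (auto simp: coset_def)
    then show ?thesis
      using coset_eq_iff[OF assms] chain_subspaceD(3)[OF assms b(1)] by (simp add: chain_scale_algebra)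
  qed
  moreover have "coset B z \<noteq> {}" using chain_subspaceD(1)[OF assms] by (auto simp: coset_def)
  ultimately show ?thesis by auto
qed

text \<open>The classes of the \<open>e i\<close> form a basis: the functionals separate them, and
  \<open>z - (\<Sum>i\<in>I. chain_scale (w i z) (e i))\<close> is killed by all functionals, hence
  lies in \<open>B\<close>. \<open>B\<close> may reach beyond \<open>Z\<close>: with the cycles of a
  subspace as \<open>Z\<close> and the boundaries of the larger space as \<open>B\<close>,
  \<open>V\<close> is the image of the induced map on homology.\<close>

lemma dim_quotient_eq:
  fixes Z B :: "('a, 'k::field) field_chain set" and V :: "('k, ('a, 'k) field_chain set) module"
  assumes Z: "chain_subspace Z" and B: "chain_subspace B"
    and V: "carrier V = coset B ` Z" "zero V = B"
    "\<And>z z'. z \<in> Z \<Longrightarrow> z' \<in> Z \<Longrightarrow> add V (coset B z) (coset B z') = coset B (z + z')"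
    "\<And>a z. z \<in> Z \<Longrightarrow> smult V a (coset B z) = coset B (chain_scale a z)"
    and finI: "finite I"
    and lin: "\<And>i a z. i \<in> I \<Longrightarrow> w i (chain_scale a z) = a * (w i z :: 'k)"
    "\<And>i z z'. i \<in> I \<Longrightarrow> w i (z + z') = w i z + w i z'"
    and ker: "\<And>z. z \<in> Z \<Longrightarrow> z \<in> B \<longleftrightarrow> (\<forall>i\<in>I. w i z = 0)"
    and dual: "\<And>i. i \<in> I \<Longrightarrow> e i \<in> Z" "\<And>i j. i \<in> I \<Longrightarrow> j \<in> I \<Longrightarrow> w j (e i) = (if i = j then 1 else 0)"
  shows "vectorspace.dim (class_ring :: 'k ring) V = card I"
proof -
  have zB: "coset B 0 = B" by (simp add: coset_def)
  have "abelian_group V"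
  proof (rule abelian_groupI)
    fix x y z assume "x \<in> carrier V" "y \<in> carrier V" "z \<in> carrier V"
    then obtain x' y' z' where *: "x' \<in> Z" "y' \<in> Z" "z' \<in> Z" "x = coset B x'" "y = coset B y'" "z = coset B z'"
      by (auto simp: V)
    then show "x \<oplus>\<^bsub>V\<^esub> y \<in> carrier V" "x \<oplus>\<^bsub>V\<^esub> y \<oplus>\<^bsub>V\<^esub> z = x \<oplus>\<^bsub>V\<^esub> (y \<oplus>\<^bsub>V\<^esub> z)" "x \<oplus>\<^bsub>V\<^esub> y = y \<oplus>\<^bsub>V\<^esub> x"
      using chain_subspaceD(2)[OF Z] by (auto simp: V algebra_simps)
    have "\<zero>\<^bsub>V\<^esub> = coset B 0" using zB V by simp
    then show "\<zero>\<^bsub>V\<^esub> \<oplus>\<^bsub>V\<^esub> x = x" using * chain_subspaceD(1)[OF Z] by (simp add: V(3))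
    have "coset B (- x') \<in> carrier V" "coset B (- x') \<oplus>\<^bsub>V\<^esub> x = \<zero>\<^bsub>V\<^esub>"
      using * chain_subspaceD(4)[OF Z] zB by (auto simp: V)
    then show "\<exists>y\<in>carrier V. y \<oplus>\<^bsub>V\<^esub> x = \<zero>\<^bsub>V\<^esub>" by blast
  next
    show "\<zero>\<^bsub>V\<^esub> \<in> carrier V" using zB chain_subspaceD(1)[OF Z] by (auto simp: V intro!: image_eqI[of _ _ 0])
  qed
  moreover have "module_axioms (class_ring :: 'k ring) V"
    by (unfold_locales) (auto simp: V chain_subspaceD[OF Z] chain_scale_algebra)
  ultimately have "Module.module (class_ring :: 'k ring) V"
    by (intro Module.module.intro fieldE(1)[OF class_field])
  then interpret vectorspace "class_ring :: 'k ring" V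
    by (intro vectorspace.intro class_field)
  have fs: "finsum V (\<lambda>i. coset B (g i)) J = coset B (sum g J)"
    if "finite J" "\<And>i. i \<in> J \<Longrightarrow> g i \<in> Z" for g J
    using that
  proof (induction J rule: finite_induct)
    case (insert i J)
    have "sum g J \<in> Z" using insert by (intro chain_subspace_sum[OF Z]) auto
    then show ?case using insert by (subst finsum_insert) (auto simp: V)
  qed (simp add: zB V)
  define A where "A = (\<lambda>i. coset B (e i)) ` I"
  have inj: "inj_on (\<lambda>i. coset B (e i)) I"
  proof (rule inj_onI)
    fix i j assume ij: "i \<in> I" "j \<in> I" "coset B (e i) = coset B (e j)"
    then have "e i - e j \<in> B" using coset_eq_iff[OF B] by blast
    moreover have "e i - e j \<in> Z" using dual ij chain_subspaceD(5)[OF Z] by blast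
    ultimately have "w i (e i - e j) = 0" using ker ij by blast
    moreover have "w i (e i - e j) = w i (e i) - w i (e j)"
      using lin(2)[OF ij(1), of "e i - e j" "e j"] by simp
    ultimately show "i = j" using dual(2) ij by (auto split: if_splits)
  qed
  have lc: "lincomb a A = coset B (\<Sum>i\<in>I. chain_scale (a (coset B (e i))) (e i))" for a
  proof -
    have "lincomb a A = finsum V (\<lambda>v. smult V (a v) v) ((\<lambda>i. coset B (e i)) ` I)"
      by (simp add: lincomb_def A_def)
    also have "\<dots> = finsum V (\<lambda>i. smult V (a (coset B (e i))) (coset B (e i))) I"
      using dual(1) by (intro finsum_reindex inj) (auto simp: V chain_subspaceD[OF Z])
    also have "\<dots> = finsum V (\<lambda>i. coset B (chain_scale (a (coset B (e i))) (e i))) I"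
      using dual(1) by (intro finsum_cong') (auto simp: V chain_subspaceD[OF Z])
    also have "\<dots> = coset B (\<Sum>i\<in>I. chain_scale (a (coset B (e i))) (e i))"
      using finI dual(1) by (intro fs) (auto simp: chain_subspaceD[OF Z])
    finally show ?thesis .
  qed
  have w0: "w j 0 = 0" if "j \<in> I" for j using lin(1)[OF that, of 0 0] by (simp add: chain_scale_algebra)
  have wsum: "w j (\<Sum>i\<in>I. chain_scale (c i) (e i)) = c j" if "j \<in> I" for c j
  proof -
    have "w j (\<Sum>i\<in>J. chain_scale (c i) (e i)) = (\<Sum>i\<in>J. c i * w j (e i))" if "finite J" for J
      using that by (induction J rule: finite_induct) (auto simp: w0 lin \<open>j \<in> I\<close>)
    from this[OF finI] show ?thesis using dual(2) that finI by (simp add: if_distrib sum.delta cong: if_cong)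
  qed
  have sumZ: "(\<Sum>i\<in>I. chain_scale (c i) (e i)) \<in> Z" for c
    using dual(1) chain_subspaceD(3)[OF Z] by (intro chain_subspace_sum[OF Z]) auto
  have AV: "A \<subseteq> carrier V" using dual(1) by (auto simp: A_def V)
  have "lin_indpt A"
  proof (rule finite_lin_indpt2[OF _ AV])
    show "finite A" using finI by (simp add: A_def)
    fix a assume "lincomb a A = \<zero>\<^bsub>V\<^esub>"
    then have "coset B (\<Sum>i\<in>I. chain_scale (a (coset B (e i))) (e i)) = coset B 0"
      by (simp add: lc zB V)
    then have "(\<Sum>i\<in>I. chain_scale (a (coset B (e i))) (e i)) \<in> B" using coset_eq_iff[OF B] by fastforce
    then have "\<forall>j\<in>I. a (coset B (e j)) = 0" using ker[OF sumZ] wsum by simp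
    then show "\<forall>v\<in>A. a v = \<zero>\<^bsub>class_ring :: 'k ring\<^esub>" by (simp add: A_def)
  qed
  moreover have "gen_set A"
  proof -
    have "v \<in> span A" if v: "v \<in> carrier V" for v
    proof -
      obtain z where z: "z \<in> Z" "v = coset B z" using v by (auto simp: V)
      \<comment> \<open>\<open>lincomb\<close> takes coefficients indexed by vectors, so the index
        is recovered from the coset.\<close>
      define a where "a u = w (the_inv_into I (\<lambda>i. coset B (e i)) u) z" for u
      have a: "a (coset B (e i)) = w i z" if "i \<in> I" for i
        using the_inv_into_f_f[OF inj that] by (simp add: a_def)
      define s where "s = (\<Sum>i\<in>I. chain_scale (w i z) (e i))"
      have "w j (z - s) = 0" if "j \<in> I" for j
        using lin(2)[OF that, of "z - s" s] wsum[OF that, of "\<lambda>i. w i z"] by (simp add: s_def)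
      moreover have "z - s \<in> Z" using z sumZ chain_subspaceD(5)[OF Z] by (simp add: s_def)
      ultimately have "z - s \<in> B" using ker by blast
      then have "v = coset B s" using coset_eq_iff[OF B] z by blast
      also have "s = (\<Sum>i\<in>I. chain_scale (a (coset B (e i))) (e i))" by (simp add: s_def a)
      finally have "v = lincomb a A" using lc by simp
      then show ?thesis unfolding span_def using finI by (auto simp: A_def)
    qed
    moreover have "span A \<subseteq> carrier V" using AV by (rule span_is_subset2)
    ultimately show ?thesis by blast
  qed
  ultimately have "basis A" unfolding basis_def using AV by blast
  then have "dim = card A" using finI by (intro dim_basis) (auto simp: A_def)
  then show ?thesis using inj by (simp add: A_def card_image)
qed

subsection \<open>Linear functionals and linear extensions on chains\<close>

definition chain_eval :: "(((nat \<Rightarrow> real) \<Rightarrow> 'a) \<Rightarrow> 'k) \<Rightarrow> ('a, 'k::field) field_chain \<Rightarrow> 'k" where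
  "chain_eval w c = (\<Sum>f\<in>Poly_Mapping.keys c. Poly_Mapping.lookup c f * w f)"

lemma chain_eval_superset:
  "finite A \<Longrightarrow> Poly_Mapping.keys c \<subseteq> A \<Longrightarrow> chain_eval w c = (\<Sum>f\<in>A. Poly_Mapping.lookup c f * w f)"
  unfolding chain_eval_def by (intro sum.mono_neutral_left) (auto simp: in_keys_iff)

lemma chain_eval_add: "chain_eval w (c + c') = chain_eval w c + chain_eval w c'"
  unfolding chain_eval_def by (rule setsum_keys_plus_distrib) (auto simp: algebra_simps)

lemma chain_eval_scale: "chain_eval w (chain_scale a c) = a * chain_eval w c"
proof -
  have "Poly_Mapping.keys (chain_scale a c) \<subseteq> Poly_Mapping.keys c" by (auto simp: in_keys_iff)
  then show ?thesis
    by (simp add: chain_eval_superset[of "Poly_Mapping.keys c"] sum_distrib_left mult.assoc)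
qed

lemma chain_eval_0 [simp]: "chain_eval w 0 = 0"
  by (simp add: chain_eval_def)

lemma chain_eval_uminus: "chain_eval w (- c) = - chain_eval w c"
  using chain_eval_scale[of w "- 1" c] by (simp add: chain_scale_minus_one)

lemma chain_eval_diff: "chain_eval w (c - c') = chain_eval w c - chain_eval w c'"
  using chain_eval_add[of w c "- c'"] by (simp add: chain_eval_uminus)

lemma chain_eval_sum: "chain_eval w (sum g I) = (\<Sum>i\<in>I. chain_eval w (g i))"
  by (induction I rule: infinite_finite_induct) (auto simp: chain_eval_add)

lemma chain_eval_single [simp]: "chain_eval w (Poly_Mapping.single f a) = a * w f"
  by (simp add: chain_eval_def)

lemmas chain_eval_simps = chain_eval_add chain_eval_scale chain_eval_uminus chain_eval_diff chain_eval_sum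

lemma chain_scale_single: "chain_scale a (Poly_Mapping.single f b) = Poly_Mapping.single f (a * b)"
  by (auto intro!: poly_mapping_eqI simp: lookup_single when_def)

lemma chain_eq_sum:
  "c = (\<Sum>f\<in>Poly_Mapping.keys c. chain_scale (Poly_Mapping.lookup c f) (Poly_Mapping.single f 1))"
proof (rule poly_mapping_eqI)
  fix g
  show "Poly_Mapping.lookup c g = Poly_Mapping.lookup
    (\<Sum>f\<in>Poly_Mapping.keys c. chain_scale (Poly_Mapping.lookup c f) (Poly_Mapping.single f 1)) g"
    by (simp add: lookup_sum lookup_single when_def if_distrib sum.delta in_keys_iff cong: if_cong)
qed

lemma field_boundary_Suc: "field_boundary (Suc p) c =
    (\<Sum>f\<in>Poly_Mapping.keys c. \<Sum>k\<le>Suc p.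
       chain_scale (Poly_Mapping.lookup c f) (Poly_Mapping.single (singular_face (Suc p) k f) ((-1) ^ k)))"
  by (simp add: field_boundary_def chain_scale_single mult.commute)

lemma field_boundary_superset:
  assumes "finite A" "Poly_Mapping.keys c \<subseteq> A"
  shows "field_boundary (Suc p) c = (\<Sum>f\<in>A. \<Sum>k\<le>Suc p.
       chain_scale (Poly_Mapping.lookup c f) (Poly_Mapping.single (singular_face (Suc p) k f) ((-1) ^ k)))"
  unfolding field_boundary_Suc using assms
  by (intro sum.mono_neutral_left) (auto simp: in_keys_iff chain_scale_algebra)

lemma field_boundary_add: "field_boundary p (c + c') = field_boundary p c + field_boundary p c'"
proof (cases p)
  case (Suc q)
  then show ?thesis
    unfolding Suc field_boundary_Suc
    by (intro setsum_keys_plus_distrib) (auto simp: chain_scale_algebra sum.distrib)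
qed (simp add: field_boundary_def)

lemma field_boundary_scale: "field_boundary p (chain_scale a c) = chain_scale a (field_boundary p c)"
proof (cases p)
  case (Suc q)
  have "Poly_Mapping.keys (chain_scale a c) \<subseteq> Poly_Mapping.keys c" by (auto simp: in_keys_iff)
  then show ?thesis
    unfolding Suc by (simp only: field_boundary_superset[of "Poly_Mapping.keys c"] finite_keys
        chain_scale_sum chain_scale_algebra lookup_chain_scale order_refl)
qed (simp add: field_boundary_def chain_scale_algebra)

lemma field_boundary_0 [simp]: "field_boundary p 0 = 0"
  by (simp add: field_boundary_def)

lemma field_boundary_sum: "field_boundary p (sum g I) = (\<Sum>i\<in>I. field_boundary p (g i))"
  by (induction I rule: infinite_finite_induct) (auto simp: field_boundary_add)

lemma field_boundary_single:
  "field_boundary (Suc p) (Poly_Mapping.single f 1) =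
     (\<Sum>k\<le>Suc p. Poly_Mapping.single (singular_face (Suc p) k f) ((-1) ^ k))"
  by (simp add: field_boundary_Suc chain_scale_algebra)

lemma subspace_field_chains: "chain_subspace (field_chains p X :: ('a, 'k::field) field_chain set)"
proof -
  have "Poly_Mapping.keys (c + c') \<subseteq> S"
    if "Poly_Mapping.keys c \<subseteq> S" "Poly_Mapping.keys c' \<subseteq> S" for c c' :: "('a, 'k) field_chain" and S
    using keys_add[of c c'] that by blast
  moreover have "Poly_Mapping.keys (chain_scale a c) \<subseteq> S"
    if "Poly_Mapping.keys c \<subseteq> S" for a and c :: "('a, 'k) field_chain" and S
    using that by (auto simp: in_keys_iff)
  ultimately show ?thesis unfolding chain_subspace_def field_chains_def by simp
qed

lemma subspace_boundaries: "chain_subspace (boundaries p X :: ('a, 'k::field) field_chain set)"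
proof -
  let ?F = "field_chains (Suc p) X :: ('a, 'k) field_chain set"
  note f = chain_subspaceD[OF subspace_field_chains[of "Suc p" X, where 'k = 'k]]
  have "c + c' \<in> field_boundary (Suc p) ` ?F"
    if "c \<in> field_boundary (Suc p) ` ?F" "c' \<in> field_boundary (Suc p) ` ?F" for c c'
    using that f(2) by (force simp: field_boundary_add[symmetric])
  moreover have "chain_scale a c \<in> field_boundary (Suc p) ` ?F"
    if "c \<in> field_boundary (Suc p) ` ?F" for c a
    using that f(3) by (force simp: field_boundary_scale[symmetric])
  moreover have "0 \<in> field_boundary (Suc p) ` ?F" using f(1) by (intro image_eqI[of _ _ 0]) auto
  ultimately show ?thesis unfolding chain_subspace_def boundaries_def by blast
qed

lemma subspace_reduced_cycles: "chain_subspace (reduced_cycles 1 X :: ('a, 'k::field) field_chain set)"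
  using chain_subspaceD[OF subspace_field_chains[of 1 X, where 'k = 'k]]
  by (simp add: reduced_cycles_def chain_subspace_def field_boundary_add field_boundary_scale
      chain_scale_algebra)

lemma field_chains_mono:
  assumes "V \<subseteq> W"
  shows "field_chains p (top_of_set V) \<subseteq> field_chains p (top_of_set W)"
proof -
  have "singular_simplex_set p (top_of_set V) \<subseteq> singular_simplex_set p (top_of_set W)"
    by (intro Collect_mono impI) (erule singular_simplex_mono[OF _ assms])
  then show ?thesis unfolding field_chains_def by (intro Collect_mono impI) (erule subset_trans)
qed

lemma boundaries_mono: "V \<subseteq> W \<Longrightarrow> boundaries p (top_of_set V) \<subseteq> boundaries p (top_of_set W)"
  unfolding boundaries_def by (intro image_mono field_chains_mono)

lemma reduced_cycles_mono:
  assumes "V \<subseteq> W"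
  shows "reduced_cycles p (top_of_set V) \<subseteq> reduced_cycles p (top_of_set W)"
  unfolding reduced_cycles_def using field_chains_mono[OF assms] by (intro Collect_mono) blast

subsection \<open>Paths as singular 1-simplices\<close>

text \<open>The barycentric coordinate \<open>x 1\<close> is the path parameter. Off the simplex the
  value is \<open>undefined\<close>, as for every singular simplex; only so is
  \<open>path_simplex (simplex_path f)\<close> equal to \<open>f\<close>.\<close>

definition path_simplex :: "(real \<Rightarrow> 'a) \<Rightarrow> (nat \<Rightarrow> real) \<Rightarrow> 'a" where
  "path_simplex g = restrict (\<lambda>x. g (x 1)) (standard_simplex 1)"

definition simplex_path :: "((nat \<Rightarrow> real) \<Rightarrow> 'a) \<Rightarrow> real \<Rightarrow> 'a" where
  "simplex_path f t = f (\<lambda>i. if i = 0 then 1 - t else if i = 1 then t else 0)"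

definition path_chain :: "(real \<Rightarrow> 'a) \<Rightarrow> ('a, 'k::field) field_chain" where
  "path_chain g = Poly_Mapping.single (path_simplex g) 1"

definition point_chain :: "'a \<Rightarrow> ('a, 'k::field) field_chain" where
  "point_chain x = Poly_Mapping.single (restrict (\<lambda>_. x) (standard_simplex 0)) 1"

lemma edge_point_in_simplex:
  "t \<in> {0..1} \<Longrightarrow> (\<lambda>i. if i = 0 then 1 - t else if i = 1 then t else (0::real)) \<in> standard_simplex 1"
  by (auto simp: standard_simplex_def)

lemma standard_simplex_1_eq:
  assumes "x \<in> standard_simplex 1"
  shows "x 1 \<in> {0..1}" "(\<lambda>i. if i = 0 then 1 - x 1 else if i = 1 then x 1 else 0) = x" "x 0 = 1 - x 1"
proof -
  have "x 0 + x 1 = 1" "\<forall>i>1. x i = 0" "0 \<le> x 1" "x 1 \<le> 1"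
    using assms by (auto simp: standard_simplex_def)
  then show "x 1 \<in> {0..1}" "(\<lambda>i. if i = 0 then 1 - x 1 else if i = 1 then x 1 else 0) = x" "x 0 = 1 - x 1"
    by (auto simp: fun_eq_iff intro: antisym)
qed

lemma simplex_path_path_simplex: "t \<in> {0..1} \<Longrightarrow> simplex_path (path_simplex g) t = g t"
  using edge_point_in_simplex[of t] by (simp add: simplex_path_def path_simplex_def)

lemma path_simplex_simplex_path:
  assumes "singular_simplex 1 X f"
  shows "path_simplex (simplex_path f) = f"
proof
  fix x
  show "path_simplex (simplex_path f) x = f x"
  proof (cases "x \<in> standard_simplex 1")
    case True
    have "path_simplex (simplex_path f) x = simplex_path f (x 1)"
      by (simp only: path_simplex_def restrict_apply True if_True)
    also have "\<dots> = f x" by (simp only: simplex_path_def standard_simplex_1_eq(2)[OF True])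
    finally show ?thesis .
  next
    case False
    have "f \<in> extensional (standard_simplex 1)" using assms by (simp only: singular_simplex_def)
    then have "f x = undefined" using False by (rule extensional_arb)
    then show ?thesis by (simp only: path_simplex_def restrict_apply False if_False)
  qed
qed

lemma singular_simplex_top_of_set:
  fixes f :: "(nat \<Rightarrow> real) \<Rightarrow> 'a::topological_space"
  shows "singular_simplex p (top_of_set V) f \<longleftrightarrow> continuous_on (standard_simplex p) f \<and>
    f ` standard_simplex p \<subseteq> V \<and> f \<in> extensional (standard_simplex p)"
  unfolding singular_simplex_def euclidean_product_topology continuous_map_in_subtopology
    continuous_map_iff_continuous topspace_euclidean_subtopology image_subset_iff_funcset
  by (rule conj_assoc)

lemma path_simplex_singular:
  fixes g :: "real \<Rightarrow> 'a::topological_space"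
  assumes "continuous_on {0..1} g" "g ` {0..1} \<subseteq> V"
  shows "singular_simplex 1 (top_of_set V) (path_simplex g)"
proof -
  have "continuous_on (standard_simplex 1) (\<lambda>x. g (x 1))"
    using standard_simplex_1_eq(1)
    by (intro continuous_on_compose2[OF assms(1)] continuous_on_subset[OF continuous_on_product_coordinates]) auto
  then have "continuous_on (standard_simplex 1) (path_simplex g)"
    by (rule continuous_on_eq) (simp add: path_simplex_def)
  then show ?thesis
    using standard_simplex_1_eq(1) assms(2)
    by (auto simp: singular_simplex_top_of_set path_simplex_def)
qed

lemma path_chain_in_chains:
  fixes g :: "real \<Rightarrow> 'a::topological_space"
  assumes "continuous_on {0..1} g" "g ` {0..1} \<subseteq> V"
  shows "path_chain g \<in> field_chains 1 (top_of_set V)"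
  unfolding field_chains_def path_chain_def using path_simplex_singular[OF assms] by simp

lemma simplex_path_continuous:
  fixes f :: "(nat \<Rightarrow> real) \<Rightarrow> 'a::topological_space"
  assumes "singular_simplex 1 (top_of_set V) f"
  shows "continuous_on {0..1} (simplex_path f)" "simplex_path f ` {0..1} \<subseteq> V"
proof -
  have f: "continuous_on (standard_simplex 1) f" "f ` standard_simplex 1 \<subseteq> V"
    using assms unfolding singular_simplex_top_of_set by blast+
  have c: "continuous_on {0..1::real} (\<lambda>t i. if i = (0::nat) then 1 - t else if i = 1 then t else 0)"
  proof (rule continuous_on_coordinatewise_then_product)
    fix i :: nat
    show "continuous_on {0..1::real} (\<lambda>t. if i = 0 then 1 - t else if i = 1 then t else 0)"
      by (cases "i = 0"; cases "i = 1") (simp_all add: continuous_on_diff)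
  qed
  show "continuous_on {0..1} (simplex_path f)"
    unfolding simplex_path_def
    by (rule continuous_on_compose2[OF f(1) c]) (rule image_subsetI, erule edge_point_in_simplex)
  show "simplex_path f ` {0..1} \<subseteq> V"
    unfolding simplex_path_def using f(2) edge_point_in_simplex by blast
qed

text \<open>Face \<open>0\<close> omits vertex \<open>0\<close> and is thus the end point; face
  \<open>1\<close> is the starting point.\<close>

lemma singular_face_1:
  "singular_face 1 0 f = restrict (\<lambda>_. simplex_path f 1) (standard_simplex 0)"
  "singular_face 1 (Suc 0) f = restrict (\<lambda>_. simplex_path f 0) (standard_simplex 0)"
  by (auto simp: singular_face_def simplex_path_def simplical_face_def standard_simplex_0 fun_eq_iff
      restrict_def intro!: arg_cong[of _ _ f])

lemma field_boundary_1:
  "field_boundary 1 c = (\<Sum>f\<in>Poly_Mapping.keys c. chain_scale (Poly_Mapping.lookup c f)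
     (point_chain (simplex_path f 1) - point_chain (simplex_path f 0)))"
  unfolding One_nat_def field_boundary_Suc
  by (intro sum.cong refl)
    (simp add: singular_face_1[unfolded One_nat_def] point_chain_def chain_scale_single
      chain_scale_algebra single_uminus[symmetric] diff_conv_add_uminus del: add_uminus_conv_diff)

lemma field_boundary_path_chain:
  "field_boundary 1 (path_chain g :: ('a, 'k::field) field_chain) = point_chain (g 1) - point_chain (g 0)"
  unfolding field_boundary_1
  by (simp add: path_chain_def simplex_path_path_simplex chain_scale_algebra)

text \<open>Pair the vanishing boundary with the functional that \<open>h\<close> induces on
  0-simplices.\<close>

lemma cycle_sum_scalar:
  assumes "field_boundary 1 c = 0"
  shows "(\<Sum>f\<in>Poly_Mapping.keys c. Poly_Mapping.lookup c f * (h (simplex_path f 1) - h (simplex_path f 0))) = (0::'k::field)"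
proof -
  define W :: "((nat \<Rightarrow> real) \<Rightarrow> 'a) \<Rightarrow> 'k" where "W g = h (g (\<lambda>j. if j = 0 then 1 else 0))" for g
  have W: "chain_eval W (point_chain x) = h x" for x
    by (simp add: point_chain_def W_def standard_simplex_0)
  have "chain_eval W (field_boundary 1 c) = 0" using assms by simp
  then show ?thesis
    unfolding field_boundary_1 by (simp add: chain_eval_simps W)
qed

lemma cycle_sum_chain:
  fixes S :: "'a \<Rightarrow> ('b, 'k::field) field_chain"
  assumes "field_boundary 1 c = 0"
  shows "(\<Sum>f\<in>Poly_Mapping.keys c. chain_scale (Poly_Mapping.lookup c f)
     (S (simplex_path f 1) - S (simplex_path f 0))) = 0"
proof (rule poly_mapping_eqI)
  fix g
  show "Poly_Mapping.lookup (\<Sum>f\<in>Poly_Mapping.keys c. chain_scale (Poly_Mapping.lookup c f)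
     (S (simplex_path f 1) - S (simplex_path f 0))) g = Poly_Mapping.lookup 0 g"
    using cycle_sum_scalar[OF assms, of "\<lambda>x. Poly_Mapping.lookup (S x) g"]
    by (simp add: lookup_sum lookup_minus)
qed

subsection \<open>Homologies between paths\<close>

lemma standard_simplex_2_bary:
  "x \<in> standard_simplex 2 \<Longrightarrow> 0 \<le> x 0 \<and> 0 \<le> x 1 \<and> 0 \<le> x 2 \<and> x 0 + x 1 + x 2 = 1"
  by (auto simp: standard_simplex_def numeral_2_eq_2)

text \<open>The affine map from the standard simplex onto the triangle turns \<open>H\<close> into a
  singular 2-simplex with the three paths as faces. The triangle may be degenerate, which yields
  constant paths and subdivisions as special cases.\<close>

lemma triangle_boundary:
  fixes H :: "real \<times> real \<Rightarrow> 'a::topological_space"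
  assumes H: "continuous_on (convex hull {u, v, w}) H" "H ` (convex hull {u, v, w}) \<subseteq> V"
  shows "path_chain (\<lambda>t. H ((1 - t) *\<^sub>R u + t *\<^sub>R v)) + path_chain (\<lambda>t. H ((1 - t) *\<^sub>R v + t *\<^sub>R w)) -
    path_chain (\<lambda>t. H ((1 - t) *\<^sub>R u + t *\<^sub>R w)) \<in> (boundaries 1 (top_of_set V) :: ('a, 'k::field) field_chain set)"
proof -
  define \<phi> :: "(nat \<Rightarrow> real) \<Rightarrow> real \<times> real" where "\<phi> x = x 0 *\<^sub>R u + x 1 *\<^sub>R v + x 2 *\<^sub>R w" for x
  define \<sigma> where "\<sigma> = restrict (\<lambda>x. H (\<phi> x)) (standard_simplex 2)"
  have \<phi>: "\<phi> ` standard_simplex 2 \<subseteq> convex hull {u, v, w}"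
    using standard_simplex_2_bary unfolding convex_hull_3 \<phi>_def by blast
  have "continuous_on (standard_simplex 2) \<phi>"
    unfolding \<phi>_def
    by (intro continuous_intros continuous_on_subset[OF continuous_on_product_coordinates]) auto
  then have "continuous_on (standard_simplex 2) (\<lambda>x. H (\<phi> x))"
    using \<phi> by (intro continuous_on_compose2[OF H(1)])
  then have "continuous_on (standard_simplex 2) \<sigma>"
    by (rule continuous_on_eq) (simp add: \<sigma>_def)
  then have "singular_simplex 2 (top_of_set V) \<sigma>"
    using \<phi> H(2) unfolding singular_simplex_top_of_set by (auto simp: \<sigma>_def)
  then have chain: "(Poly_Mapping.single \<sigma> 1 :: ('a, 'k) field_chain) \<in> field_chains 2 (top_of_set V)"
    by (simp add: field_chains_def)
  have face: "singular_face 2 k \<sigma> = path_simplex g"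
    if k: "k \<le> 2" and eq: "\<And>x. x \<in> standard_simplex 1 \<Longrightarrow> H (\<phi> (simplical_face k x)) = g (x 1)" for k g
  proof
    fix x
    show "singular_face 2 k \<sigma> x = path_simplex g x"
      using simplical_face_in_standard_simplex[of 2 k x] k eq[of x]
      by (simp add: singular_face_def path_simplex_def \<sigma>_def restrict_def)
  qed
  have x01: "x 0 = 1 - x 1" if "x \<in> standard_simplex 1" for x
    using standard_simplex_1_eq(3)[OF that] .
  have "singular_face 2 0 \<sigma> = path_simplex (\<lambda>t. H ((1 - t) *\<^sub>R v + t *\<^sub>R w))"
    by (rule face) (simp_all add: \<phi>_def simplical_face_def x01)
  moreover have "singular_face 2 1 \<sigma> = path_simplex (\<lambda>t. H ((1 - t) *\<^sub>R u + t *\<^sub>R w))"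
    by (rule face) (simp_all add: \<phi>_def simplical_face_def x01)
  moreover have "singular_face 2 2 \<sigma> = path_simplex (\<lambda>t. H ((1 - t) *\<^sub>R u + t *\<^sub>R v))"
    by (rule face) (simp_all add: \<phi>_def simplical_face_def x01)
  ultimately have "field_boundary 2 (Poly_Mapping.single \<sigma> 1 :: ('a, 'k) field_chain) =
    path_chain (\<lambda>t. H ((1 - t) *\<^sub>R u + t *\<^sub>R v)) + path_chain (\<lambda>t. H ((1 - t) *\<^sub>R v + t *\<^sub>R w)) -
    path_chain (\<lambda>t. H ((1 - t) *\<^sub>R u + t *\<^sub>R w))"
    using field_boundary_single[of 1 \<sigma>]
    by (simp add: numeral_2_eq_2 path_chain_def single_uminus algebra_simps)
  then show ?thesis
    using imageI[OF chain, of "field_boundary 2"] by (simp add: boundaries_def numeral_2_eq_2)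
qed

lemma const_path_boundary:
  fixes x :: "'a::topological_space"
  assumes "x \<in> V"
  shows "path_chain (\<lambda>_. x) \<in> (boundaries 1 (top_of_set V) :: ('a, 'k::field) field_chain set)"
proof -
  have "path_chain (\<lambda>_. x) + path_chain (\<lambda>_. x) - path_chain (\<lambda>_. x) \<in>
    (boundaries 1 (top_of_set V) :: ('a, 'k) field_chain set)"
    by (rule triangle_boundary[of 0 0 0 "\<lambda>_. x" V]) (use assms in auto)
  then show ?thesis by simp
qed

text \<open>Apply \<open>triangle_boundary\<close> to a triangle with collinear vertices.\<close>

lemma subdivide_path_boundary:
  fixes g :: "real \<Rightarrow> 'a::topological_space"
  assumes g: "continuous_on {a..b} g" "g ` {a..b} \<subseteq> V" and m: "a \<le> m" "m \<le> b"
  shows "path_chain (\<lambda>t. g ((1 - t) * a + t * m)) + path_chain (\<lambda>t. g ((1 - t) * m + t * b)) -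
    path_chain (\<lambda>t. g ((1 - t) * a + t * b)) \<in> (boundaries 1 (top_of_set V) :: ('a, 'k::field) field_chain set)"
proof -
  have "convex hull {(a, 0), (m, 0), (b, 0)} \<subseteq> {a..b} \<times> {0::real}"
    by (rule hull_minimal) (use m in \<open>auto intro: convex_Times\<close>)
  then have sub: "fst ` (convex hull {(a, 0::real), (m, 0), (b, 0)}) \<subseteq> {a..b}" by force
  have "continuous_on (convex hull {(a, 0), (m, 0), (b, 0::real)}) (\<lambda>p. g (fst p))"
    by (rule continuous_on_compose2[OF g(1) _ sub]) (intro continuous_intros)
  from triangle_boundary[OF this, of V] show ?thesis
    using sub g(2) by force
qed

text \<open>Cut the square along its diagonal, which cancels between the two triangles.\<close>

lemma square_boundary:
  fixes H :: "real \<times> real \<Rightarrow> 'a::topological_space"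
  assumes H: "continuous_on ({0..1} \<times> {0..1}) H" "H ` ({0..1} \<times> {0..1}) \<subseteq> V"
  shows "path_chain (\<lambda>t. H (0, t)) + path_chain (\<lambda>s. H (s, 1)) - path_chain (\<lambda>s. H (s, 0)) -
    path_chain (\<lambda>t. H (1, t)) \<in> (boundaries 1 (top_of_set V) :: ('a, 'k::field) field_chain set)"
proof -
  have cv: "convex ({0..1} \<times> {0..1} :: (real \<times> real) set)" by (simp add: convex_Times)
  have sub: "convex hull {(0, 0), (0, 1), (1, 1)} \<subseteq> ({0..1} \<times> {0..1} :: (real \<times> real) set)"
    "convex hull {(0, 0), (1, 0), (1, 1)} \<subseteq> ({0..1} \<times> {0..1} :: (real \<times> real) set)"
    by (rule hull_minimal; simp add: cv)+
  have "path_chain (\<lambda>t. H (0, t)) + path_chain (\<lambda>s. H (s, 1)) - path_chain (\<lambda>s. H (s, s)) \<in>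
      (boundaries 1 (top_of_set V) :: ('a, 'k) field_chain set)"
    using triangle_boundary[OF continuous_on_subset[OF H(1) sub(1)], of V] sub(1) H(2) by force
  moreover have "path_chain (\<lambda>s. H (s, 0)) + path_chain (\<lambda>t. H (1, t)) - path_chain (\<lambda>s. H (s, s)) \<in>
      (boundaries 1 (top_of_set V) :: ('a, 'k) field_chain set)"
    using triangle_boundary[OF continuous_on_subset[OF H(1) sub(2)], of V] sub(2) H(2) by force
  ultimately show ?thesis
    using chain_subspaceD(5)[OF subspace_boundaries] by (force simp: algebra_simps)
qed

text \<open>The straight-line homotopy to the chord fixes the end points, so two sides of its square
  are constant paths and hence boundaries.\<close>

lemma convex_path_boundary:
  fixes g :: "real \<Rightarrow> 'a::real_normed_vector"
  assumes S: "convex S" "S \<subseteq> V" and g: "continuous_on {0..1} g" "g ` {0..1} \<subseteq> S"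
  shows "path_chain g - path_chain (linepath (g 0) (g 1)) \<in>
    (boundaries 1 (top_of_set V) :: ('a, 'k::field) field_chain set)"
proof -
  define H where "H p = (1 - fst p) *\<^sub>R g (snd p) + fst p *\<^sub>R linepath (g 0) (g 1) (snd p)" for p
  have gS: "g t \<in> S" if "t \<in> {0..1}" for t using g that by blast
  have lS: "linepath (g 0) (g 1) t \<in> S" if "t \<in> {0..1}" for t
    using that gS S(1) unfolding linepath_def convex_alt by auto
  have "continuous_on ({0..1} \<times> {0..1}) (\<lambda>p::real \<times> real. g (snd p))"
    by (rule continuous_on_compose2[OF g(1)]) (auto intro: continuous_intros)
  then have c: "continuous_on ({0..1} \<times> {0..1}) H"
    unfolding H_def linepath_def by (intro continuous_intros)
  have im: "H ` ({0..1} \<times> {0..1}) \<subseteq> V"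
  proof
    fix y assume "y \<in> H ` ({0..1} \<times> {0..1})"
    then obtain p where p: "fst p \<in> {0..1}" "snd p \<in> {0..1}" "y = H p" by auto
    have "y \<in> S" using p gS[OF p(2)] lS[OF p(2)] S(1) unfolding H_def convex_alt by auto
    then show "y \<in> V" using S(2) by blast
  qed
  have gV: "g 0 \<in> V" "g 1 \<in> V" using gS[of 0] gS[of 1] S(2) by auto
  have e: "H (0, t) = g t" "H (1, t) = linepath (g 0) (g 1) t" "H (s, 0) = g 0" "H (s, 1) = g 1" for s t
    by (simp_all add: H_def linepath_def algebra_simps)
  note B = chain_subspaceD[OF subspace_boundaries[where 'k = 'k]]
  have "path_chain g + path_chain (\<lambda>_. g 1) - path_chain (\<lambda>_. g 0) - path_chain (linepath (g 0) (g 1)) \<in>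
    (boundaries 1 (top_of_set V) :: ('a, 'k) field_chain set)"
    using square_boundary[OF c im, where 'k = 'k] by (simp add: e)
  from B(2)[OF B(5)[OF this const_path_boundary[OF gV(2)]] const_path_boundary[OF gV(1)]]
  show ?thesis by simp
qed

lemma convex_triangle_boundary:
  fixes x :: "'a::real_normed_vector"
  assumes S: "convex S" "S \<subseteq> V" and xyz: "x \<in> S" "y \<in> S" "z \<in> S"
  shows "path_chain (linepath x y) + path_chain (linepath y z) - path_chain (linepath x z) \<in>
    (boundaries 1 (top_of_set V) :: ('a, 'k::field) field_chain set)"
proof -
  define H where "H p = (1 - fst p - snd p) *\<^sub>R x + fst p *\<^sub>R y + snd p *\<^sub>R z" for p :: "real \<times> real"
  have "H p \<in> convex hull {x, y, z}" if "p \<in> convex hull {(0, 0), (1, 0), (0, 1)}" for p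
  proof -
    from that obtain a b c where "0 \<le> a" "0 \<le> b" "0 \<le> c" "a + b + c = 1"
      "p = a *\<^sub>R (0, 0) + b *\<^sub>R (1, 0) + c *\<^sub>R (0, 1)" unfolding convex_hull_3 by blast
    moreover from this have "H p = a *\<^sub>R x + b *\<^sub>R y + c *\<^sub>R z"
      by (simp add: H_def)
    ultimately show ?thesis unfolding convex_hull_3 by blast
  qed
  moreover have "convex hull {x, y, z} \<subseteq> S" using xyz S(1) by (intro hull_minimal) auto
  ultimately have im: "H ` (convex hull {(0, 0), (1, 0), (0, 1)}) \<subseteq> V" using S(2) by blast
  have c: "continuous_on (convex hull {(0, 0), (1, 0), (0, 1)}) H"
    unfolding H_def by (intro continuous_intros)
  have e: "(\<lambda>t. H ((1 - t) *\<^sub>R (0, 0) + t *\<^sub>R (1, 0))) = linepath x y"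
    "(\<lambda>t. H ((1 - t) *\<^sub>R (1, 0) + t *\<^sub>R (0, 1))) = linepath y z"
    "(\<lambda>t. H ((1 - t) *\<^sub>R (0, 0) + t *\<^sub>R (0, 1))) = linepath x z"
    by (auto simp: H_def linepath_def fun_eq_iff)
  show ?thesis using triangle_boundary[OF c im, where 'k = 'k] unfolding e .
qed

text \<open>On a cycle, corrections that depend only on the end points of the simplices cancel.\<close>

lemma cycle_approx:
  fixes c :: "('a, 'k::field) field_chain" and P :: "((nat \<Rightarrow> real) \<Rightarrow> 'a) \<Rightarrow> ('a, 'k) field_chain"
  assumes c: "field_boundary 1 c = 0" and B: "chain_subspace B"
    and P: "\<And>f. f \<in> Poly_Mapping.keys c \<Longrightarrow>
      Poly_Mapping.single f 1 - (P f + (S (simplex_path f 1) - S (simplex_path f 0))) \<in> B"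
  shows "c - (\<Sum>f\<in>Poly_Mapping.keys c. chain_scale (Poly_Mapping.lookup c f) (P f)) \<in> B"
proof -
  let ?K = "Poly_Mapping.keys c" and ?s = "\<lambda>f. chain_scale (Poly_Mapping.lookup c f)"
  let ?D = "\<lambda>f. S (simplex_path f 1) - S (simplex_path f 0)"
  have sd: "chain_scale a (x - y) = chain_scale a x - chain_scale a y" for a and x y :: "('a, 'k) field_chain"
    by (auto intro!: poly_mapping_eqI simp: lookup_minus right_diff_distrib)
  have "(\<Sum>f\<in>?K. ?s f (Poly_Mapping.single f 1 - (P f + ?D f))) \<in> B"
    using P by (intro chain_subspace_sum[OF B] chain_subspaceD(3)[OF B])
  also have "(\<Sum>f\<in>?K. ?s f (Poly_Mapping.single f 1 - (P f + ?D f))) =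
      (\<Sum>f\<in>?K. ?s f (Poly_Mapping.single f 1)) - (\<Sum>f\<in>?K. ?s f (P f)) - (\<Sum>f\<in>?K. ?s f (?D f))"
    unfolding sum_subtractf[symmetric]
    by (intro sum.cong refl) (simp add: sd chain_scale_algebra algebra_simps)
  also have "\<dots> = c - (\<Sum>f\<in>?K. ?s f (P f))"
    using cycle_sum_chain[OF c, of S] chain_eq_sum[of c] by simp
  finally show ?thesis .
qed

lemma simplex_in_chain_path:
  fixes c :: "('a::topological_space, 'k::field) field_chain"
  assumes "c \<in> field_chains 1 (top_of_set V)" "f \<in> Poly_Mapping.keys c"
  shows "Poly_Mapping.single f 1 = (path_chain (simplex_path f) :: ('a, 'k) field_chain)"
    "continuous_on {0..1} (simplex_path f)" "simplex_path f ` {0..1} \<subseteq> V"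
proof -
  have f: "singular_simplex 1 (top_of_set V) f" using assms by (auto simp: field_chains_def)
  show "Poly_Mapping.single f 1 = (path_chain (simplex_path f) :: ('a, 'k) field_chain)"
    unfolding path_chain_def path_simplex_simplex_path[OF f] ..
  show "continuous_on {0..1} (simplex_path f)" "simplex_path f ` {0..1} \<subseteq> V"
    using simplex_path_continuous[OF f] by blast+
qed

lemma reduced_cycles_1: "c \<in> reduced_cycles 1 X \<longleftrightarrow> c \<in> field_chains 1 X \<and> field_boundary 1 c = 0"
  by (simp add: reduced_cycles_def)

text \<open>Coning to a point \<open>a\<close>: up to boundaries each simplex is the difference of
  the segments from \<open>a\<close> to its end points, so that \<open>cycle_approx\<close> applies
  with zero as the remaining part.\<close>

lemma convex_cycle_boundary:
  fixes c :: "('a::real_normed_vector, 'k::field) field_chain"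
  assumes S: "convex S" "S \<subseteq> V" and c: "c \<in> reduced_cycles 1 (top_of_set S)"
  shows "c \<in> boundaries 1 (top_of_set V)"
proof (cases "S = {}")
  case True
  have "Poly_Mapping.keys c = {}"
    using c simplex_in_chain_path(3)[of c S] unfolding reduced_cycles_1 True by fastforce
  then show ?thesis using chain_subspaceD(1)[OF subspace_boundaries] by simp
next
  case False
  then obtain a where a: "a \<in> S" by blast
  note B = chain_subspaceD[OF subspace_boundaries[where 'k = 'k]]
  have c': "c \<in> field_chains 1 (top_of_set S)" "field_boundary 1 c = 0"
    using c unfolding reduced_cycles_1 by blast+
  have "c - (\<Sum>f\<in>Poly_Mapping.keys c. chain_scale (Poly_Mapping.lookup c f) 0) \<in> boundaries 1 (top_of_set V)"
  proof (rule cycle_approx[OF c'(2) subspace_boundaries])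
    fix f assume "f \<in> Poly_Mapping.keys c"
    note f = simplex_in_chain_path[OF c'(1) this]
    let ?g = "simplex_path f"
    have e: "Poly_Mapping.single f (1 :: 'k) = path_chain ?g" by (rule f(1))
    have S01: "?g 0 \<in> S" "?g 1 \<in> S" using f(3) by force+
    have "path_chain ?g - path_chain (linepath (?g 0) (?g 1)) +
        (path_chain (linepath a (?g 0)) + path_chain (linepath (?g 0) (?g 1)) - path_chain (linepath a (?g 1)))
        \<in> (boundaries 1 (top_of_set V) :: ('a, 'k) field_chain set)"
      by (intro B(2) convex_path_boundary[OF S f(2,3)] convex_triangle_boundary[OF S a S01])
    then show "Poly_Mapping.single f (1 :: 'k) - (0 + (path_chain (linepath a (?g 1)) - path_chain (linepath a (?g 0))))
        \<in> boundaries 1 (top_of_set V)"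
      unfolding e by (simp add: algebra_simps)
  qed
  then show ?thesis by (simp add: chain_scale_algebra)
qed

subsection \<open>Winding numbers of field chains\<close>

definition to_complex :: "real ^ 2 \<Rightarrow> complex" where
  "to_complex v = Complex (v $ 1) (v $ 2)"

text \<open>
  The part of the winding number around \<open>0\<close> that is not accounted for by the principal arguments of
  the end points. It is an integer, so it can be used with coefficients in any field.
\<close>

definition turn :: "(real \<Rightarrow> complex) \<Rightarrow> int" where
  "turn g = (THE n. winding_number g 0 = of_int n + (Ln (g 1) - Ln (g 0)) / (2 * pi * \<i>))"

definition wind :: "real ^ 2 \<Rightarrow> (real ^ 2, 'k::field) field_chain \<Rightarrow> 'k" where
  "wind q c = chain_eval (\<lambda>f. of_int (turn (\<lambda>t. to_complex (simplex_path f t - q)))) c"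

text \<open>The exponential of \<open>2 * pi * \<i>\<close> times the winding number is the quotient
  of the end points, so the winding number differs from the logarithmic term by an integer, and only
  by one.\<close>

lemma winding_number_turn:
  assumes "path g" "0 \<notin> path_image g"
  shows "winding_number g 0 = of_int (turn g) + (Ln (g 1) - Ln (g 0)) / (2 * pi * \<i>)"
proof -
  have nz: "g 0 \<noteq> 0" "g 1 \<noteq> 0" using assms(2) by (auto simp: path_image_def image_iff)
  have "g 1 = exp (2 * pi * \<i> * winding_number g 0) * g 0"
    using winding_number_exp_2pi[OF assms] by (simp add: pathstart_def pathfinish_def)
  then have "exp (Ln (g 1)) = exp (2 * pi * \<i> * winding_number g 0 + Ln (g 0))"
    using nz by (simp add: exp_add)
  then have "exp (2 * pi * \<i> * winding_number g 0 + Ln (g 0)) = exp (Ln (g 1))" by simp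
  then obtain n :: int where
    n: "2 * pi * \<i> * winding_number g 0 + Ln (g 0) = Ln (g 1) + (of_int (2 * n) * pi) * \<i>"
    unfolding exp_eq by blast
  define c where "c = 2 * pi * \<i>"
  have c: "c \<noteq> 0" by (simp add: c_def)
  have "c * winding_number g 0 = (Ln (g 1) - Ln (g 0)) + c * of_int n"
    using n unfolding c_def by (simp add: algebra_simps)
  then have "winding_number g 0 = ((Ln (g 1) - Ln (g 0)) + c * of_int n) / c"
    using c by (simp add: nonzero_eq_divide_eq mult.commute)
  then have "winding_number g 0 = of_int n + (Ln (g 1) - Ln (g 0)) / c"
    using c by (simp add: add_divide_distrib)
  then have "winding_number g 0 = of_int n + (Ln (g 1) - Ln (g 0)) / (2 * pi * \<i>)"
    by (simp only: c_def)
  then have "winding_number g 0 = of_int m + (Ln (g 1) - Ln (g 0)) / (2 * pi * \<i>) \<longleftrightarrow> m = n" for m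
    by auto
  then show ?thesis unfolding turn_def by simp
qed

lemma turn_cong:
  assumes "\<And>t. t \<in> {0..1} \<Longrightarrow> g t = h t"
  shows "turn g = turn h"
proof -
  have "winding_number g 0 = winding_number h 0" by (rule winding_number_cong) (use assms in auto)
  moreover have "g 0 = h 0" "g 1 = h 1" using assms by auto
  ultimately show ?thesis unfolding turn_def by simp
qed

text \<open>The logarithms of the end points telescope.\<close>

lemma turn_add:
  assumes "path f" "0 \<notin> path_image f" "path g" "0 \<notin> path_image g" "path h" "0 \<notin> path_image h"
    and "winding_number f 0 + winding_number g 0 = winding_number h 0"
    and "f 0 = h 0" "f 1 = g 0" "g 1 = h 1"
  shows "turn f + turn g = turn h"
proof -
  have "complex_of_int (turn f + turn g) = of_int (turn h)"
    using assms(7) unfolding winding_number_turn[OF assms(1,2)] winding_number_turn[OF assms(3,4)]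
      winding_number_turn[OF assms(5,6)] assms(8-10) by (simp add: diff_divide_distrib)
  then show ?thesis by (simp only: of_int_eq_iff)
qed

lemma to_complex_eq_0_iff: "to_complex v = 0 \<longleftrightarrow> v = 0"
  by (auto simp: to_complex_def complex_eq_iff Finite_Cartesian_Product.vec_eq_iff forall_2)

lemma continuous_on_to_complex [continuous_intros]:
  "continuous_on S f \<Longrightarrow> continuous_on S (\<lambda>x. to_complex (f x))"
  unfolding to_complex_def Complex_eq by (intro continuous_intros)

lemma wind_simps:
  "wind q (c + c') = wind q c + wind q c'" "wind q (c - c') = wind q c - wind q c'" "wind q (- c) = - wind q c"
  "wind q (chain_scale a c) = a * wind q c" "wind q 0 = 0" "wind q (sum g I) = (\<Sum>i\<in>I. wind q (g i))"
  by (simp_all add: wind_def chain_eval_simps)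

lemma wind_path_chain: "wind q (path_chain g) = of_int (turn (\<lambda>t. to_complex (g t - q)))"
proof -
  have "turn (\<lambda>t. to_complex (simplex_path (path_simplex g) t - q)) = turn (\<lambda>t. to_complex (g t - q))"
    by (rule turn_cong) (simp only: simplex_path_path_simplex)
  then show ?thesis by (simp add: wind_def path_chain_def)
qed

text \<open>Face \<open>1\<close> is homotopic to face \<open>2\<close> followed by face
  \<open>0\<close> inside the triangle, which is convex and thus simply connected; the simplex
  carries this homotopy to the complement of \<open>q\<close>.\<close>

lemma turn_triangle:
  assumes s: "singular_simplex 2 (top_of_set V) s" and q: "q \<notin> V"
  defines "e k \<equiv> (\<lambda>t. to_complex (simplex_path (singular_face 2 k s) t - q))"
  shows "turn (e 2) + turn (e 0) = turn (e 1)"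
proof -
  define \<beta> :: "real \<times> real \<Rightarrow> nat \<Rightarrow> real" where
    "\<beta> p i = (if i = 0 then 1 - fst p - snd p else if i = 1 then fst p else if i = 2 then snd p else 0)" for p i
  \<comment> \<open>\<open>T\<close> is the standard 2-simplex in two coordinates, and
    \<open>\<beta>\<close> recovers the barycentric ones.\<close>
  define T :: "(real \<times> real) set" where "T = {p. 0 \<le> fst p \<and> 0 \<le> snd p \<and> fst p + snd p \<le> 1}"
  define h where "h p = to_complex (s (\<beta> p) - q)" for p
  have s': "continuous_on (standard_simplex 2) s" "s ` standard_simplex 2 \<subseteq> V"
    using s unfolding singular_simplex_top_of_set by blast+
  have \<beta>T: "\<beta> p \<in> standard_simplex 2" if "p \<in> T" for p
    using that by (auto simp: \<beta>_def T_def standard_simplex_def numeral_2_eq_2)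
  have "continuous_on T \<beta>"
  proof (rule continuous_on_coordinatewise_then_product)
    fix i show "continuous_on T (\<lambda>p. \<beta> p i)"
      unfolding \<beta>_def by (cases "i = 0"; cases "i = 1"; cases "i = 2") (auto intro!: continuous_intros)
  qed
  then have "continuous_on T (\<lambda>p. s (\<beta> p))"
    by (rule continuous_on_compose2[OF s'(1)]) (use \<beta>T in auto)
  then have ch: "continuous_on T h" unfolding h_def by (intro continuous_intros)
  have h0: "h ` T \<subseteq> - {0}"
    using \<beta>T s'(2) q unfolding h_def by (force simp: to_complex_eq_0_iff)
  have "convex T"
  proof -
    have "T = {p. inner (-1, 0) p \<le> 0} \<inter> {p. inner (0, -1) p \<le> 0} \<inter> {p. inner (1, 1) p \<le> 1}"
      by (auto simp: T_def)
    then show ?thesis by (simp add: convex_Int convex_halfspace_le)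
  qed
  define l1 l2 l3 where "l1 = linepath (0::real, 0::real) (1, 0)" "l2 = linepath (1::real, 0::real) (0, 1)"
    "l3 = linepath (0::real, 0::real) (0, 1)"
  note l = this
  have lT: "path_image l1 \<subseteq> T" "path_image l2 \<subseteq> T" "path_image l3 \<subseteq> T"
    unfolding l path_image_linepath
    by (rule closed_segment_subset[OF _ _ \<open>convex T\<close>]; simp add: T_def)+
  have "homotopic_paths T (l1 +++ l2) l3"
  proof -
    have "path (l1 +++ l2)" "path l3" "pathstart l3 = pathstart (l1 +++ l2)"
      "pathfinish l3 = pathfinish (l1 +++ l2)" "path_image (l1 +++ l2) \<subseteq> T"
      using lT by (auto simp: l path_image_join)
    then show ?thesis
      using convex_imp_simply_connected[OF \<open>convex T\<close>] lT(3)
      unfolding simply_connected_eq_homotopic_paths by blast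
  qed
  then have "homotopic_paths (- {0}) (h \<circ> (l1 +++ l2)) (h \<circ> l3)"
    using ch h0 by (intro homotopic_paths_continuous_image) auto
  then have "winding_number (h \<circ> (l1 +++ l2)) 0 = winding_number (h \<circ> l3) 0"
    by (rule winding_number_homotopic_paths)
  moreover have p: "path (h \<circ> l1)" "path (h \<circ> l2)" "path (h \<circ> l3)"
    using lT by (auto intro!: path_continuous_image continuous_on_subset[OF ch] simp: l)
  moreover have i: "0 \<notin> path_image (h \<circ> l1)" "0 \<notin> path_image (h \<circ> l2)" "0 \<notin> path_image (h \<circ> l3)"
    using lT h0 unfolding path_image_compose by blast+
  ultimately have w: "winding_number (h \<circ> l1) 0 + winding_number (h \<circ> l2) 0 = winding_number (h \<circ> l3) 0"
    unfolding path_compose_join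
    by (subst (asm) winding_number_join) (auto simp: pathfinish_compose pathstart_compose l)
  have "turn (h \<circ> l1) + turn (h \<circ> l2) = turn (h \<circ> l3)"
    by (rule turn_add[OF p(1) i(1) p(2) i(2) p(3) i(3) w]) (simp_all add: l linepath_def)
  moreover have "turn (e 2) = turn (h \<circ> l1)" "turn (e 0) = turn (h \<circ> l2)" "turn (e 1) = turn (h \<circ> l3)"
  proof -
    have face: "simplex_path (singular_face 2 k s) t = s (simplical_face k (\<lambda>i. if i = 0 then 1 - t else if i = 1 then t else 0))"
      if "t \<in> {0..1}" for k t
      using edge_point_in_simplex[OF that] unfolding simplex_path_def singular_face_def by simp
    have "simplical_face 2 (\<lambda>i. if i = 0 then 1 - t else if i = 1 then t else 0) = \<beta> (l1 t)"
      "simplical_face 0 (\<lambda>i. if i = 0 then 1 - t else if i = 1 then t else 0) = \<beta> (l2 t)"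
      "simplical_face 1 (\<lambda>i. if i = 0 then 1 - t else if i = 1 then t else 0) = \<beta> (l3 t)" for t
      by (auto simp: fun_eq_iff simplical_face_def \<beta>_def l linepath_def)
    then show "turn (e 2) = turn (h \<circ> l1)" "turn (e 0) = turn (h \<circ> l2)" "turn (e 1) = turn (h \<circ> l3)"
      unfolding e_def by (intro turn_cong; simp add: face h_def)+
  qed
  ultimately show ?thesis by simp
qed

text \<open>By \<open>turn_triangle\<close> the alternating sum over the faces of each 2-simplex
  vanishes. Hence the winding number depends only on the homology class in a set that omits
  \<open>q\<close>.\<close>

lemma wind_boundary:
  fixes c :: "(real ^ 2, 'k::field) field_chain"
  assumes "c \<in> boundaries 1 (top_of_set V)" "q \<notin> V"
  shows "wind q c = 0"
proof -
  obtain d :: "(real ^ 2, 'k) field_chain" where d: "d \<in> field_chains 2 (top_of_set V)" "c = field_boundary 2 d"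
    using assms(1) by (auto simp: boundaries_def numeral_2_eq_2)
  let ?t = "\<lambda>k s. turn (\<lambda>t. to_complex (simplex_path (singular_face 2 k s) t - q))"
  have "(\<Sum>k\<le>2. (-1) ^ k * (of_int (?t k s) :: 'k)) = 0" if "s \<in> Poly_Mapping.keys d" for s
  proof -
    have "singular_simplex 2 (top_of_set V) s" using d that by (auto simp: field_chains_def)
    from turn_triangle[OF this assms(2)] have "?t 0 s - ?t 1 s + ?t 2 s = 0" by linarith
    then have "(of_int (?t 0 s) - of_int (?t 1 s) + of_int (?t 2 s) :: 'k) = 0"
      unfolding of_int_diff[symmetric] of_int_add[symmetric] by (simp only: of_int_0)
    then show ?thesis by (simp add: numeral_2_eq_2)
  qed
  then have "(\<Sum>s\<in>Poly_Mapping.keys d. Poly_Mapping.lookup d s * (\<Sum>k\<le>2. (-1) ^ k * (of_int (?t k s) :: 'k))) = 0"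
    by simp
  then show ?thesis
    unfolding d(2) wind_def numeral_2_eq_2 field_boundary_Suc chain_eval_simps chain_eval_single
    by (simp only: sum_distrib_left numeral_2_eq_2)
qed

lemma wind_as_sum:
  "wind q c = (\<Sum>f\<in>Poly_Mapping.keys c. Poly_Mapping.lookup c f * wind q (Poly_Mapping.single f 1))"
  by (simp add: wind_def chain_eval_def)

text \<open>
  Moving the base point along \<open>v\<close> amounts to moving the cycle along \<open>- v\<close>; the traces of the end
  points of the simplices cancel on a cycle.
\<close>

lemma wind_translate:
  fixes c :: "(real ^ 2, 'k::field) field_chain"
  assumes c: "c \<in> reduced_cycles 1 (top_of_set V)"
    and avoid: "\<And>f t s. f \<in> Poly_Mapping.keys c \<Longrightarrow> t \<in> {0..1} \<Longrightarrow> s \<in> {0..1} \<Longrightarrow>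
      simplex_path f t \<noteq> q + s *\<^sub>R v"
  shows "wind q c = wind (q + v) c"
proof -
  have c': "c \<in> field_chains 1 (top_of_set V)" "field_boundary 1 c = 0"
    using c unfolding reduced_cycles_1 by blast+
  define h :: "real ^ 2 \<Rightarrow> 'k" where "h x = wind q (path_chain (\<lambda>s. x - s *\<^sub>R v))" for x
  have step: "wind q (Poly_Mapping.single f 1) - wind (q + v) (Poly_Mapping.single f (1 :: 'k)) =
      - (h (simplex_path f 1) - h (simplex_path f 0))"
    if f: "f \<in> Poly_Mapping.keys c" for f
  proof -
    let ?g = "simplex_path f"
    note g = simplex_in_chain_path[OF c'(1) f]
    define H where "H p = ?g (snd p) - fst p *\<^sub>R v" for p
    have "continuous_on ({0..1} \<times> {0..1}) (\<lambda>p::real \<times> real. ?g (snd p))"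
      by (rule continuous_on_compose2[OF g(2)]) (auto intro: continuous_intros)
    then have H: "continuous_on ({0..1} \<times> {0..1}) H" unfolding H_def by (intro continuous_intros)
    have "H ` ({0..1} \<times> {0..1}) \<subseteq> - {q}"
    proof
      fix y assume "y \<in> H ` ({0..1} \<times> {0..1})"
      then obtain s t where st: "s \<in> {0..1}" "t \<in> {0..1}" "y = ?g t - s *\<^sub>R v" by (auto simp: H_def)
      have "y \<noteq> q" using avoid[OF f st(2,1)] st(3) by (auto simp: algebra_simps)
      then show "y \<in> - {q}" by simp
    qed
    from wind_boundary[OF square_boundary[OF H this, where 'k = 'k], of q]
    have "wind q (path_chain (\<lambda>t. H (0, t)) :: (real ^ 2, 'k) field_chain) + wind q (path_chain (\<lambda>s. H (s, 1))) -
        wind q (path_chain (\<lambda>s. H (s, 0))) - wind q (path_chain (\<lambda>t. H (1, t))) = 0"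
      by (simp add: wind_simps)
    then have "wind q (path_chain ?g) + h (?g 1) - h (?g 0) - wind q (path_chain (\<lambda>t. ?g t - v)) = 0"
      by (simp add: H_def h_def)
    moreover have "wind q (path_chain (\<lambda>t. ?g t - v)) = (wind (q + v) (path_chain ?g) :: 'k)"
      unfolding wind_path_chain by (simp add: algebra_simps)
    moreover have "Poly_Mapping.single f (1 :: 'k) = path_chain ?g" by (rule g(1))
    ultimately show ?thesis by (simp add: algebra_simps)
  qed
  have "wind q c - wind (q + v) c = (\<Sum>f\<in>Poly_Mapping.keys c. Poly_Mapping.lookup c f *
      (wind q (Poly_Mapping.single f 1) - wind (q + v) (Poly_Mapping.single f 1)))"
    unfolding wind_as_sum[of q c] wind_as_sum[of "q + v" c] sum_subtractf[symmetric]
    by (simp add: right_diff_distrib)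
  also have "\<dots> = - (\<Sum>f\<in>Poly_Mapping.keys c. Poly_Mapping.lookup c f *
      (h (simplex_path f 1) - h (simplex_path f 0)))"
    unfolding sum_negf[symmetric] by (intro sum.cong refl) (simp only: step mult_minus_right)
  also have "\<dots> = 0" using cycle_sum_scalar[OF c'(2), of h] by simp
  finally show ?thesis by simp
qed

lemma compact_chain_support:
  fixes c :: "('a::topological_space, 'k::field) field_chain"
  assumes "c \<in> field_chains 1 (top_of_set V)"
  shows "compact (\<Union>f\<in>Poly_Mapping.keys c. simplex_path f ` {0..1})"
    "(\<Union>f\<in>Poly_Mapping.keys c. simplex_path f ` {0..1}) \<subseteq> V"
  using simplex_in_chain_path(2,3)[OF assms] by (auto intro!: compact_UN compact_continuous_image)

text \<open>The support of \<open>c\<close> is compact, so a ball around a point of \<open>S\<close>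
  misses it, and inside that ball \<open>wind_translate\<close> moves the base point. Thus the
  winding number is locally constant on \<open>S\<close>.\<close>

lemma wind_connected:
  fixes c :: "(real ^ 2, 'k::field) field_chain"
  assumes c: "c \<in> reduced_cycles 1 (top_of_set (- S))" and S: "connected S" "q \<in> S" "q' \<in> S"
  shows "wind q c = wind q' c"
proof (rule connected_local_const[OF S], intro ballI)
  fix a assume a: "a \<in> S"
  have c': "c \<in> field_chains 1 (top_of_set (- S))" using c unfolding reduced_cycles_1 by blast
  define K where "K = (\<Union>f\<in>Poly_Mapping.keys c. simplex_path f ` {0..1})"
  have K: "compact K" "K \<subseteq> - S" using compact_chain_support[OF c'] by (simp_all add: K_def)
  then have "open (- K)" "a \<in> - K" using a compact_imp_closed by auto
  then obtain e where e: "e > 0" "ball a e \<subseteq> - K" by (rule openE) blast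
  have "wind a c = wind b c" if b: "b \<in> ball a e" for b
  proof -
    have "wind a c = wind (a + (b - a)) c"
    proof (rule wind_translate[OF c])
      fix f t s assume *: "f \<in> Poly_Mapping.keys c" "t \<in> {0..1::real}" "s \<in> {0..1::real}"
      have "a + s *\<^sub>R (b - a) = (1 - s) *\<^sub>R a + s *\<^sub>R b" by (simp add: algebra_simps)
      moreover have "(1 - s) *\<^sub>R a + s *\<^sub>R b \<in> ball a e"
        using convex_ball[of a e] b e(1) *(3) unfolding convex_alt by auto
      ultimately have "a + s *\<^sub>R (b - a) \<notin> K" using e(2) by auto
      moreover have "simplex_path f t \<in> K" using *(1,2) unfolding K_def by blast
      ultimately show "simplex_path f t \<noteq> a + s *\<^sub>R (b - a)" by metis
    qed
    then show ?thesis by simp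
  qed
  moreover have "\<forall>\<^sub>F b in at a within S. b \<in> ball a e"
    using e(1) by (intro eventually_at_in_open'[THEN filter_leD[OF at_le[OF subset_UNIV]]]) auto
  ultimately show "\<forall>\<^sub>F b in at a within S. wind a c = wind b c"
    by (auto elim: eventually_mono)
qed

text \<open>A cycle in a convex set bounds there. With a large ball as \<open>S\<close> this makes
  winding numbers vanish far away.\<close>

lemma wind_outside_convex:
  assumes "c \<in> reduced_cycles 1 (top_of_set V)" "V \<subseteq> S" "convex S" "q \<notin> S"
  shows "wind q c = 0"
proof (rule wind_boundary[OF _ assms(4)])
  have "c \<in> reduced_cycles 1 (top_of_set S)" using assms(1) reduced_cycles_mono[OF assms(2)] by blast
  then show "c \<in> boundaries 1 (top_of_set S)" by (rule convex_cycle_boundary[OF assms(3) order_refl])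
qed

subsection \<open>Rectangles\<close>

text \<open>A segment and its reverse add up to the turn of a constant path, which is zero because
  it equals its own double.\<close>

lemma turn_linepath_reverse:
  assumes "0 \<notin> closed_segment a b"
  shows "turn (linepath b a) = - turn (linepath a b)"
proof -
  have "turn (linepath a b) + turn (linepath b a) = turn (linepath a a)"
  proof (rule turn_add)
    have "winding_number (linepath b a) 0 = - winding_number (linepath a b) 0"
      using winding_number_reversepath[of "linepath a b" 0] assms by (simp add: reversepath_linepath)
    moreover have "a \<noteq> 0" using assms by auto
    ultimately show "winding_number (linepath a b) 0 + winding_number (linepath b a) 0 = winding_number (linepath a a) 0"
      by simp
  qed (use assms in \<open>auto simp: closed_segment_commute linepath_0' linepath_1'\<close>)
  moreover have "turn (linepath a a) = 0"
  proof -
    have "a \<noteq> 0" using assms by auto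
    then have "turn (linepath a a) + turn (linepath a a) = turn (linepath a a)"
      by (intro turn_add) (auto simp: linepath_0' linepath_1')
    then show ?thesis by simp
  qed
  ultimately show ?thesis by simp
qed

text \<open>The closed rectangle path winds once, and around it the logarithms cancel. The upper and
  the left side carry a minus sign because here they run east and north, as in
  \<open>square_chain\<close>.\<close>

lemma turn_rectangle:
  fixes a b c e :: real
  assumes "a < 0" "b < 0" "0 < c" "0 < e"
  shows "turn (linepath (Complex a b) (Complex c b)) + turn (linepath (Complex c b) (Complex c e)) -
    turn (linepath (Complex a e) (Complex c e)) - turn (linepath (Complex a b) (Complex a e)) = 1"
proof -
  define z1 z2 z3 z4 where "z1 = Complex a b" "z2 = Complex c b" "z3 = Complex c e" "z4 = Complex a e"
  note z = this
  have rp: "rectpath z1 z3 = linepath z1 z2 +++ linepath z2 z3 +++ linepath z3 z4 +++ linepath z4 z1"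
    by (simp add: rectpath_def Let_def z)
  have "0 \<in> box z1 z3" using assms by (auto simp: in_box_complex_iff z)
  then have w1: "winding_number (rectpath z1 z3) 0 = 1" by (rule winding_number_rectpath)
  have "0 \<notin> path_image (rectpath z1 z3)"
    using \<open>0 \<in> box z1 z3\<close> assms by (subst path_image_rectpath_cbox_minus_box) (auto simp: z)
  then have nz: "0 \<notin> closed_segment z1 z2" "0 \<notin> closed_segment z2 z3" "0 \<notin> closed_segment z3 z4"
    "0 \<notin> closed_segment z4 z1"
    unfolding rp by (auto simp: path_image_join)
  have "winding_number (linepath z1 z2) 0 + winding_number (linepath z2 z3) 0 +
      winding_number (linepath z3 z4) 0 + winding_number (linepath z4 z1) 0 = 1"
    using w1 nz unfolding rp by (simp add: winding_number_join path_image_join add.assoc)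
  moreover have "winding_number (linepath u v) 0 = of_int (turn (linepath u v)) + (Ln v - Ln u) / (2 * pi * \<i>)"
    if "0 \<notin> closed_segment u v" for u v
    using winding_number_turn[of "linepath u v"] that by (simp add: linepath_0' linepath_1')
  ultimately have "complex_of_int (turn (linepath z1 z2) + turn (linepath z2 z3) + turn (linepath z3 z4) +
      turn (linepath z4 z1)) = of_int 1"
    using nz by (simp add: diff_divide_distrib add.assoc)
  then have "turn (linepath z1 z2) + turn (linepath z2 z3) + turn (linepath z3 z4) + turn (linepath z4 z1) = 1"
    by (simp only: of_int_eq_iff)
  then show ?thesis
    using turn_linepath_reverse[OF nz(3)] turn_linepath_reverse[OF nz(4)] by (simp add: z)
qed

lemma wind_linepath:
  "wind q (path_chain (linepath x y)) = of_int (turn (linepath (to_complex (x - q)) (to_complex (y - q))))"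
proof -
  have "(\<lambda>t. to_complex (linepath x y t - q)) = linepath (to_complex (x - q)) (to_complex (y - q))"
    by (auto simp: fun_eq_iff linepath_def to_complex_def complex_eq_iff algebra_simps)
  then show ?thesis by (simp add: wind_path_chain)
qed

subsection \<open>The square grid\<close>

definition grid_point :: "real \<Rightarrow> int \<times> int \<Rightarrow> real ^ 2" where
  "grid_point d p = vector [d * of_int (fst p), d * of_int (snd p)]"

abbreviation east :: "int \<times> int \<Rightarrow> int \<times> int" where "east p \<equiv> (fst p + 1, snd p)"
abbreviation north :: "int \<times> int \<Rightarrow> int \<times> int" where "north p \<equiv> (fst p, snd p + 1)"
abbreviation west :: "int \<times> int \<Rightarrow> int \<times> int" where "west p \<equiv> (fst p - 1, snd p)"
abbreviation south :: "int \<times> int \<Rightarrow> int \<times> int" where "south p \<equiv> (fst p, snd p - 1)"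

definition east_edge :: "real \<Rightarrow> int \<times> int \<Rightarrow> (nat \<Rightarrow> real) \<Rightarrow> real ^ 2" where
  "east_edge d p = path_simplex (linepath (grid_point d p) (grid_point d (east p)))"

definition north_edge :: "real \<Rightarrow> int \<times> int \<Rightarrow> (nat \<Rightarrow> real) \<Rightarrow> real ^ 2" where
  "north_edge d p = path_simplex (linepath (grid_point d p) (grid_point d (north p)))"

definition grid_square :: "real \<Rightarrow> int \<times> int \<Rightarrow> (real ^ 2) set" where
  "grid_square d p = {x. d * of_int (fst p) \<le> x $ 1 \<and> x $ 1 \<le> d * (of_int (fst p) + 1) \<and>
     d * of_int (snd p) \<le> x $ 2 \<and> x $ 2 \<le> d * (of_int (snd p) + 1)}"

text \<open>The counterclockwise boundary, written with edges directed east or north only, so that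
  each grid edge is a single generator of the chains.\<close>

definition square_chain :: "real \<Rightarrow> int \<times> int \<Rightarrow> (real ^ 2, 'k::field) field_chain" where
  "square_chain d p = Poly_Mapping.single (east_edge d p) 1 + Poly_Mapping.single (north_edge d (east p)) 1 -
     Poly_Mapping.single (east_edge d (north p)) 1 - Poly_Mapping.single (north_edge d p) 1"

lemma grid_point_nth [simp]:
  "grid_point d p $ 1 = d * of_int (fst p)" "grid_point d p $ 2 = d * of_int (snd p)"
  by (simp_all add: grid_point_def)

lemma edge_chains:
  "Poly_Mapping.single (east_edge d p) 1 = path_chain (linepath (grid_point d p) (grid_point d (east p)))"
  "Poly_Mapping.single (north_edge d p) 1 = path_chain (linepath (grid_point d p) (grid_point d (north p)))"
  by (simp_all add: east_edge_def north_edge_def path_chain_def)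

lemma edge_paths:
  assumes "t \<in> {0..1}"
  shows "simplex_path (east_edge d p) t = linepath (grid_point d p) (grid_point d (east p)) t"
    "simplex_path (north_edge d p) t = linepath (grid_point d p) (grid_point d (north p)) t"
  using assms by (simp_all only: east_edge_def north_edge_def simplex_path_path_simplex)

lemma edge_ends:
  "simplex_path (east_edge d p) 0 = grid_point d p" "simplex_path (east_edge d p) 1 = grid_point d (east p)"
  "simplex_path (north_edge d p) 0 = grid_point d p" "simplex_path (north_edge d p) 1 = grid_point d (north p)"
  by (simp_all add: edge_paths linepath_def)

lemma grid_point_inject:
  assumes "d > 0"
  shows "grid_point d p = grid_point d p' \<longleftrightarrow> p = p'"
proof
  assume "grid_point d p = grid_point d p'"
  then have "d * of_int (fst p) = d * of_int (fst p')" "d * of_int (snd p) = d * of_int (snd p')"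
    by (metis grid_point_nth)+
  then show "p = p'" using assms by (simp add: prod_eq_iff)
qed simp

lemma convex_grid_square: "convex (grid_square d p)"
proof -
  have "grid_square d p = {x. inner (axis 1 (-1)) x \<le> - (d * of_int (fst p))} \<inter>
      {x. inner (axis 1 1) x \<le> d * (of_int (fst p) + 1)} \<inter>
      {x. inner (axis 2 (-1)) x \<le> - (d * of_int (snd p))} \<inter>
      {x. inner (axis 2 1) x \<le> d * (of_int (snd p) + 1)}"
    by (auto simp: grid_square_def inner_axis' )
  then show ?thesis by (simp add: convex_Int convex_halfspace_le)
qed

lemma grid_square_corners:
  assumes "d > 0"
  shows "grid_point d p \<in> grid_square d p" "grid_point d (east p) \<in> grid_square d p"
    "grid_point d (north p) \<in> grid_square d p" "grid_point d (east (north p)) \<in> grid_square d p"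
  using assms by (auto simp: grid_square_def algebra_simps)

lemma square_chain_cycle:
  assumes "d > 0"
  shows "square_chain d p \<in> reduced_cycles 1 (top_of_set (grid_square d p))"
proof -
  let ?F = "field_chains 1 (top_of_set (grid_square d p)) :: (real ^ 2, 'a) field_chain set"
  note F = chain_subspaceD[OF subspace_field_chains[of 1 "top_of_set (grid_square d p)", where 'k = 'a]]
  have seg: "path_chain (linepath x y) \<in> ?F" if "x \<in> grid_square d p" "y \<in> grid_square d p" for x y
    using that closed_segment_subset[OF that convex_grid_square]
    by (intro path_chain_in_chains continuous_on_linepath) (simp add: path_image_def[symmetric])
  note corners = grid_square_corners[OF assms, of p]
  have "square_chain d p \<in> ?F"
    unfolding square_chain_def edge_chains
    by (intro F(2) F(5) seg) (use corners in simp_all)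
  moreover have "field_boundary 1 (square_chain d p :: (real ^ 2, 'a) field_chain) = 0"
  proof -
    have m: "field_boundary 1 (x - y) = field_boundary 1 x - field_boundary 1 y" for x y :: "(real ^ 2, 'a) field_chain"
      using field_boundary_add[of 1 "x - y" y] by (simp add: algebra_simps)
    show ?thesis
      unfolding square_chain_def edge_chains m field_boundary_add field_boundary_path_chain
      by (simp add: linepath_def)
  qed
  ultimately show ?thesis unfolding reduced_cycles_1 by blast
qed

lemma square_chain_boundary:
  "d > 0 \<Longrightarrow> grid_square d p \<subseteq> V \<Longrightarrow> square_chain d p \<in> boundaries 1 (top_of_set V)"
  by (rule convex_cycle_boundary[OF convex_grid_square _ square_chain_cycle])

definition square_centre :: "real \<Rightarrow> int \<times> int \<Rightarrow> real ^ 2" where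
  "square_centre d p = vector [d * (of_int (fst p) + 1 / 2), d * (of_int (snd p) + 1 / 2)]"

lemma square_centre_in_square:
  assumes "d > 0"
  shows "square_centre d p \<in> grid_square d p' \<longleftrightarrow> p = p'"
proof
  assume "square_centre d p \<in> grid_square d p'"
  then have "real_of_int (fst p') \<le> of_int (fst p) + 1 / 2" "of_int (fst p) + 1 / 2 \<le> real_of_int (fst p') + 1"
    "real_of_int (snd p') \<le> of_int (snd p) + 1 / 2" "of_int (snd p) + 1 / 2 \<le> real_of_int (snd p') + 1"
    using assms by (auto simp: grid_square_def square_centre_def)
  then have "fst p = fst p'" "snd p = snd p'" by linarith+
  then show "p = p'" by (simp add: prod_eq_iff)
qed (use assms in \<open>auto simp: grid_square_def square_centre_def\<close>)

lemma wind_square_chain: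
  assumes "d > 0"
  shows "wind (square_centre d p) (square_chain d p') = (if p = p' then 1 else 0 :: 'k::field)"
proof (cases "p = p'")
  case False
  then have "square_centre d p \<notin> grid_square d p'" using square_centre_in_square[OF assms] by blast
  then show ?thesis
    using wind_outside_convex[OF square_chain_cycle[OF assms] order_refl convex_grid_square] False by simp
next
  case True
  define z where "z = d / 2"
  have z: "z > 0" using assms by (simp add: z_def)
  let ?q = "square_centre d p"
  have e: "to_complex (grid_point d p - ?q) = Complex (- z) (- z)"
    "to_complex (grid_point d (east p) - ?q) = Complex z (- z)"
    "to_complex (grid_point d (north p) - ?q) = Complex (- z) z"
    "to_complex (grid_point d (east (north p)) - ?q) = Complex z z"
    "to_complex (grid_point d (north (east p)) - ?q) = Complex z z"
    by (simp_all add: to_complex_def square_centre_def z_def algebra_simps)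
  have "wind ?q (square_chain d p) = (of_int (turn (linepath (Complex (- z) (- z)) (Complex z (- z))) +
    turn (linepath (Complex z (- z)) (Complex z z)) -
    turn (linepath (Complex (- z) z) (Complex z z)) - turn (linepath (Complex (- z) (- z)) (Complex (- z) z))) :: 'k)"
    unfolding square_chain_def edge_chains wind_simps wind_linepath e by simp
  then show ?thesis using True turn_rectangle[of "- z" "- z" z z] z by simp
qed

lemma edge_inject:
  assumes "d > 0"
  shows "east_edge d p = east_edge d p' \<longleftrightarrow> p = p'" "north_edge d p = north_edge d p' \<longleftrightarrow> p = p'"
    "east_edge d p \<noteq> north_edge d p'" "north_edge d p' \<noteq> east_edge d p"
proof -
  show "east_edge d p = east_edge d p' \<longleftrightarrow> p = p'" "north_edge d p = north_edge d p' \<longleftrightarrow> p = p'"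
    using edge_ends(1,3)[of d p] edge_ends(1,3)[of d p'] grid_point_inject[OF assms, of p p'] by metis+
  show ne: "east_edge d p \<noteq> north_edge d p'"
  proof
    assume eq: "east_edge d p = north_edge d p'"
    have "p = p'" "east p = north p'"
      using edge_ends[of d p] edge_ends[of d p'] grid_point_inject[OF assms] eq by metis+
    then show False by simp
  qed
  then show "north_edge d p' \<noteq> east_edge d p" by simp
qed

definition grid_chain :: "real \<Rightarrow> (int \<times> int) set \<Rightarrow> (int \<times> int \<Rightarrow> 'k) \<Rightarrow> (real ^ 2, 'k::field) field_chain" where
  "grid_chain d N n = (\<Sum>p\<in>N. chain_scale (n p) (square_chain d p))"

text \<open>An edge borders two squares, which traverse it in opposite directions.\<close>

lemma lookup_grid_chain:
  fixes n :: "int \<times> int \<Rightarrow> 'k::field"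
  assumes d: "d > 0" and N: "finite N" "\<And>p. p \<notin> N \<Longrightarrow> n p = 0"
  shows "Poly_Mapping.lookup (grid_chain d N n) (east_edge d p) = n p - n (south p)"
    "Poly_Mapping.lookup (grid_chain d N n) (north_edge d p) = n (west p) - n p"
    "f \<notin> range (east_edge d) \<Longrightarrow> f \<notin> range (north_edge d) \<Longrightarrow> Poly_Mapping.lookup (grid_chain d N n) f = 0"
proof -
  have sum1: "(\<Sum>p'\<in>N. n p' * (if p' = v then 1 else 0)) = n v" for v
    using N by (cases "v \<in> N") (auto simp: if_distrib sum.delta cong: if_cong)
  have "Poly_Mapping.lookup (grid_chain d N n) (east_edge d p) =
      (\<Sum>p'\<in>N. n p' * (if p' = p then 1 else 0)) - (\<Sum>p'\<in>N. n p' * (if p' = south p then 1 else 0))"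
    unfolding grid_chain_def lookup_sum sum_subtractf[symmetric]
    by (intro sum.cong refl) (auto simp: square_chain_def lookup_add lookup_minus lookup_single when_def
        edge_inject[OF d] prod_eq_iff)
  then show "Poly_Mapping.lookup (grid_chain d N n) (east_edge d p) = n p - n (south p)"
    unfolding sum1 .
  have "Poly_Mapping.lookup (grid_chain d N n) (north_edge d p) =
      (\<Sum>p'\<in>N. n p' * (if p' = west p then 1 else 0)) - (\<Sum>p'\<in>N. n p' * (if p' = p then 1 else 0))"
    unfolding grid_chain_def lookup_sum sum_subtractf[symmetric]
    by (intro sum.cong refl) (auto simp: square_chain_def lookup_add lookup_minus lookup_single when_def
        edge_inject[OF d] prod_eq_iff)
  then show "Poly_Mapping.lookup (grid_chain d N n) (north_edge d p) = n (west p) - n p"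
    unfolding sum1 .
  assume "f \<notin> range (east_edge d)" "f \<notin> range (north_edge d)"
  then have ne: "east_edge d v \<noteq> f" "north_edge d v \<noteq> f" for v by auto
  show "Poly_Mapping.lookup (grid_chain d N n) f = 0"
    unfolding grid_chain_def lookup_sum
    by (intro sum.neutral) (simp add: square_chain_def lookup_add lookup_minus lookup_single when_def ne)
qed

text \<open>Kirchhoff's law at the vertex \<open>v\<close>, obtained by testing the cycle with the
  indicator function of that vertex.\<close>

lemma grid_vertex_balance:
  fixes c :: "(real ^ 2, 'k::field) field_chain"
  assumes d: "d > 0" and keys: "Poly_Mapping.keys c \<subseteq> range (east_edge d) \<union> range (north_edge d)"
    and cycle: "field_boundary 1 c = 0"
  shows "Poly_Mapping.lookup c (east_edge d (west v)) - Poly_Mapping.lookup c (east_edge d v) +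
    (Poly_Mapping.lookup c (north_edge d (south v)) - Poly_Mapping.lookup c (north_edge d v)) = 0"
proof -
  let ?c = "Poly_Mapping.lookup c"
  define I where "I = {p. east_edge d p \<in> Poly_Mapping.keys c} \<union> {p. north_edge d p \<in> Poly_Mapping.keys c} \<union>
    {v, west v, south v}"
  have "finite {p. east_edge d p \<in> Poly_Mapping.keys c}" "finite {p. north_edge d p \<in> Poly_Mapping.keys c}"
    using edge_inject[OF d] by (auto intro!: finite_vimageI[unfolded vimage_def] injI)
  then have fI: "finite I" by (simp add: I_def)
  define h :: "real ^ 2 \<Rightarrow> 'k" where "h x = (if x = grid_point d v then 1 else 0)" for x
  define F where "F f = ?c f * (h (simplex_path f 1) - h (simplex_path f 0))" for f
  have "0 = (\<Sum>f\<in>Poly_Mapping.keys c. F f)" using cycle_sum_scalar[OF cycle, of h] by (simp add: F_def)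
  also have "\<dots> = (\<Sum>f\<in>east_edge d ` I \<union> north_edge d ` I. F f)"
  proof (rule sum.mono_neutral_left)
    show "Poly_Mapping.keys c \<subseteq> east_edge d ` I \<union> north_edge d ` I"
      using keys by (auto simp: I_def)
  qed (use fI in \<open>auto simp: F_def in_keys_iff\<close>)
  also have "\<dots> = (\<Sum>f\<in>east_edge d ` I. F f) + (\<Sum>f\<in>north_edge d ` I. F f)"
    using fI edge_inject[OF d] by (intro sum.union_disjoint) auto
  also have "\<dots> = (\<Sum>p\<in>I. F (east_edge d p)) + (\<Sum>p\<in>I. F (north_edge d p))"
    using edge_inject[OF d] by (simp add: sum.reindex inj_on_def)
  also have "(\<Sum>p\<in>I. F (east_edge d p)) =
      (\<Sum>p\<in>I. if p = west v then ?c (east_edge d p) else 0) - (\<Sum>p\<in>I. if p = v then ?c (east_edge d p) else 0)"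
    unfolding sum_subtractf[symmetric]
    by (intro sum.cong refl) (auto simp: F_def h_def edge_ends grid_point_inject[OF d] prod_eq_iff)
  also have "\<dots> = ?c (east_edge d (west v)) - ?c (east_edge d v)"
    using fI by (simp add: sum.delta I_def)
  also have "(\<Sum>p\<in>I. F (north_edge d p)) =
      (\<Sum>p\<in>I. if p = south v then ?c (north_edge d p) else 0) - (\<Sum>p\<in>I. if p = v then ?c (north_edge d p) else 0)"
    unfolding sum_subtractf[symmetric]
    by (intro sum.cong refl) (auto simp: F_def h_def edge_ends grid_point_inject[OF d] prod_eq_iff)
  also have "\<dots> = ?c (north_edge d (south v)) - ?c (north_edge d v)"
    using fI by (simp add: sum.delta I_def)
  finally show ?thesis by simp
qed

text \<open>
  A finitely supported flow on the edges of the planar grid is a sum of squares: the coefficient of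
  a square adds up the horizontal edges below it.
\<close>

lemma grid_cycle_decomposition:
  fixes c :: "(real ^ 2, 'k::field) field_chain"
  assumes d: "d > 0" and keys: "Poly_Mapping.keys c \<subseteq> range (east_edge d) \<union> range (north_edge d)"
    and cycle: "field_boundary 1 c = 0"
  obtains N and n :: "int \<times> int \<Rightarrow> 'k" where "finite N" "\<And>p. p \<notin> N \<Longrightarrow> n p = 0" "c = grid_chain d N n"
proof -
  define A where "A i j = Poly_Mapping.lookup c (east_edge d (i, j))" for i j
  define B where "B i j = Poly_Mapping.lookup c (north_edge d (i, j))" for i j
  have bal: "A (i - 1) j - A i j + (B i (j - 1) - B i j) = 0" for i j
    using grid_vertex_balance[OF d keys cycle, of "(i, j)"] by (simp add: A_def B_def)
  define I where "I = {p. east_edge d p \<in> Poly_Mapping.keys c} \<union> {p. north_edge d p \<in> Poly_Mapping.keys c}"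
  have "finite {p. east_edge d p \<in> Poly_Mapping.keys c}" "finite {p. north_edge d p \<in> Poly_Mapping.keys c}"
    using edge_inject[OF d] by (auto intro!: finite_vimageI[unfolded vimage_def] injI)
  then have fI: "finite I" by (simp add: I_def)
  define m where "m = (\<Sum>p\<in>I. \<bar>fst p\<bar> + \<bar>snd p\<bar>)"
  have bound: "\<bar>i\<bar> \<le> m \<and> \<bar>j\<bar> \<le> m" if "A i j \<noteq> 0 \<or> B i j \<noteq> 0" for i j
  proof -
    have "(i, j) \<in> I" using that by (auto simp: A_def B_def I_def in_keys_iff)
    then have "\<bar>i\<bar> + \<bar>j\<bar> \<le> m"
      unfolding m_def using fI member_le_sum[of "(i, j)" I "\<lambda>p. \<bar>fst p\<bar> + \<bar>snd p\<bar>"] by auto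
    then show ?thesis by linarith
  qed
  have "0 \<le> m" unfolding m_def by (rule sum_nonneg) simp
  have A0: "A i j = 0" and B0: "B i j = 0" if "\<bar>i\<bar> > m \<or> \<bar>j\<bar> > m" for i j
  proof -
    have "\<not> (A i j \<noteq> 0 \<or> B i j \<noteq> 0)" using bound[of i j] that by linarith
    then show "A i j = 0" "B i j = 0" by auto
  qed
  define n where "n p = (\<Sum>j\<in>{-m..snd p}. A (fst p) j)" for p
  have nA: "A i j = n (i, j) - n (i, j - 1)" for i j
  proof (cases "- m \<le> j")
    case True
    then have "{-m..j} = insert j {-m..j - 1}" by auto
    then show ?thesis by (simp add: n_def)
  next
    case False
    then have "A i j = 0" by (intro A0) linarith
    with False show ?thesis by (simp add: n_def)
  qed
  \<comment> \<open>Below the support both sides vanish; from one row to the next the vertex balance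
    carries the equation along.\<close>
  have nB: "B i j = n (i - 1, j) - n (i, j)" for i j
  proof (cases "- m - 1 \<le> j")
    case True
    then show ?thesis
    proof (induction j rule: int_ge_induct)
      case base
      have "B i (- m - 1) = 0" using \<open>0 \<le> m\<close> by (intro B0) linarith
      then show ?case by (simp add: n_def)
    next
      case (step j)
      have "B i (j + 1) = B i j + A (i - 1) (j + 1) - A i (j + 1)"
        using bal[of i "j + 1"] by (simp add: algebra_simps)
      then show ?case using step nA[of "i - 1" "j + 1"] nA[of i "j + 1"] by simp
    qed
  next
    case False
    then have "B i j = 0" by (intro B0) linarith
    with False show ?thesis by (simp add: n_def)
  qed
  have n0: "n (i, j) = 0" if "\<bar>i\<bar> > m \<or> \<bar>j\<bar> > m" for i j
  proof -
    from that consider "\<bar>i\<bar> > m" | "j < - m" | "j > m" by linarith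
    then show ?thesis
    proof cases
      case 1
      then show ?thesis by (simp add: n_def A0)
    next
      case 2
      then show ?thesis by (simp add: n_def)
    next
      case 3
      \<comment> \<open>Above the support no vertical edges are left, so \<open>n\<close> is
        constant along the row, and far to the left it vanishes.\<close>
      have far: "n (k, j) = 0" if "\<bar>k\<bar> > m" for k using that by (simp add: n_def A0)
      have "\<bar>j\<bar> > m" using 3 by linarith
      then have eq: "n (i - 1, j) = n (i, j)" for i using nB[of i j] B0[of i j] by simp
      have "n (k, j) = 0" if "- m - 1 \<le> k" for k
        using that
      proof (induction k rule: int_ge_induct)
        case base
        show ?case using \<open>0 \<le> m\<close> by (intro far) linarith
      next
        case (step k)
        then show ?case using eq[of "k + 1"] by simp
      qed
      then show ?thesis by (cases "- m - 1 \<le> i") (auto intro: far)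
    qed
  qed
  define N where "N = {-m..m} \<times> {-m..m}"
  have N: "finite N" "\<And>p. p \<notin> N \<Longrightarrow> n p = 0"
  proof -
    fix p assume "p \<notin> N"
    then have "\<bar>fst p\<bar> > m \<or> \<bar>snd p\<bar> > m" by (cases p) (auto simp: N_def)
    then show "n p = 0" using n0[of "fst p" "snd p"] by simp
  qed (simp add: N_def)
  have "c = grid_chain d N n"
  proof (rule poly_mapping_eqI)
    fix f
    consider p where "f = east_edge d p" | p where "f = north_edge d p" |
      "f \<notin> range (east_edge d)" "f \<notin> range (north_edge d)" by blast
    then show "Poly_Mapping.lookup c f = Poly_Mapping.lookup (grid_chain d N n) f"
    proof cases
      case (1 p)
      then show ?thesis using nA[of "fst p" "snd p"] by (simp add: lookup_grid_chain[OF d N] A_def)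
    next
      case (2 p)
      then show ?thesis using nB[of "fst p" "snd p"] by (simp add: lookup_grid_chain[OF d N] B_def)
    next
      case 3
      then have "f \<notin> Poly_Mapping.keys c" using keys by blast
      then show ?thesis using 3 by (simp add: lookup_grid_chain[OF d N] in_keys_iff)
    qed
  qed
  then show ?thesis using that N by blast
qed

lemma edge_image_coordinate:
  assumes "x \<in> simplex_path f ` {0..1}" "f \<in> range (east_edge d) \<union> range (north_edge d)"
  shows "(\<exists>k::int. x $ 1 = d * of_int k) \<or> (\<exists>k::int. x $ 2 = d * of_int k)"
  using assms by (auto simp: edge_paths linepath_def algebra_simps)

lemma keys_grid_chain:
  assumes "d > 0" "finite N" "\<And>p. p \<notin> N \<Longrightarrow> n p = 0"
  shows "Poly_Mapping.keys (grid_chain d N n) \<subseteq> range (east_edge d) \<union> range (north_edge d)"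
  using lookup_grid_chain(3)[of d N n, OF assms] by (auto simp: in_keys_iff)

lemma grid_chain_cycle:
  assumes "d > 0"
  shows "grid_chain d N n \<in> reduced_cycles 1 (top_of_set UNIV)"
proof -
  have "square_chain d p \<in> reduced_cycles 1 (top_of_set UNIV)" for p
    using square_chain_cycle[OF assms] reduced_cycles_mono[OF subset_UNIV] by blast
  then show ?thesis
    unfolding grid_chain_def
    by (intro chain_subspace_sum subspace_reduced_cycles chain_subspaceD(3)[OF subspace_reduced_cycles])
qed

lemma reduced_cycles_support:
  fixes c :: "('a::topological_space, 'k::field) field_chain"
  assumes "c \<in> reduced_cycles 1 (top_of_set V)" "\<And>f. f \<in> Poly_Mapping.keys c \<Longrightarrow> simplex_path f ` {0..1} \<subseteq> W"
  shows "c \<in> reduced_cycles 1 (top_of_set W)"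
proof -
  have c: "c \<in> field_chains 1 (top_of_set V)" "field_boundary 1 c = 0"
    using assms(1) unfolding reduced_cycles_1 by blast+
  have "singular_simplex 1 (top_of_set W) f" if f: "f \<in> Poly_Mapping.keys c" for f
  proof -
    have "singular_simplex 1 (top_of_set V) f" using c f by (auto simp: field_chains_def)
    then have "path_simplex (simplex_path f) = f" by (rule path_simplex_simplex_path)
    then show ?thesis
      using path_simplex_singular[OF simplex_in_chain_path(2)[OF c(1) f] assms(2)[OF f]] by simp
  qed
  then show ?thesis using c unfolding reduced_cycles_1 field_chains_def by blast
qed

text \<open>The base point is moved to the centre of its square. Apart from \<open>q\<close> itself
  the connecting segment runs through the open square, which no edge meets; around the centre only
  this one square winds.\<close>

lemma wind_grid_chain:
  fixes n :: "int \<times> int \<Rightarrow> 'k::field"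
  assumes d: "d > 0" and N: "finite N" "\<And>p. p \<notin> N \<Longrightarrow> n p = 0"
    and q: "q \<in> grid_square d p"
      "\<And>f. f \<in> Poly_Mapping.keys (grid_chain d N n) \<Longrightarrow> q \<notin> simplex_path f ` {0..1}"
  shows "wind q (grid_chain d N n) = n p"
proof -
  let ?c = "grid_chain d N n" and ?m = "square_centre d p"
  define S where "S = closed_segment q ?m"
  have interior: "x = q \<or> (d * of_int (fst p) < x $ 1 \<and> x $ 1 < d * (of_int (fst p) + 1) \<and>
      d * of_int (snd p) < x $ 2 \<and> x $ 2 < d * (of_int (snd p) + 1))" if xS: "x \<in> S" for x
  proof -
    obtain u where u: "0 \<le> u" "u \<le> 1" "x = (1 - u) *\<^sub>R q + u *\<^sub>R ?m"
      using xS unfolding S_def closed_segment_def by blast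
    have strict: "l < (1 - u) * a + u * (l + d / 2) \<and> (1 - u) * a + u * (l + d / 2) < l + d"
      if "l \<le> a" "a \<le> l + d" "0 < u" for a l
    proof -
      have gen: "P \<le> X \<Longrightarrow> X \<le> Q \<Longrightarrow> P + Y = l + R \<Longrightarrow> Q + Y = l + d - R \<Longrightarrow> 0 < R \<Longrightarrow>
          l < X + Y \<and> X + Y < l + d" for P Q R X Y :: real by linarith
      show ?thesis
      proof (rule gen)
        show "(1 - u) * l \<le> (1 - u) * a" "(1 - u) * a \<le> (1 - u) * (l + d)"
          using that u by (auto intro: mult_left_mono)
        show "0 < u * (d / 2)" using that d by simp
      qed (simp_all add: algebra_simps)
    qed
    show ?thesis
    proof (cases "u = 0")
      case False
      have "d * of_int (fst p) \<le> q $ 1" "q $ 1 \<le> d * of_int (fst p) + d"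
        "d * of_int (snd p) \<le> q $ 2" "q $ 2 \<le> d * of_int (snd p) + d"
        using q(1) by (auto simp: grid_square_def algebra_simps)
      moreover have "x $ 1 = (1 - u) * q $ 1 + u * (d * of_int (fst p) + d / 2)"
        "x $ 2 = (1 - u) * q $ 2 + u * (d * of_int (snd p) + d / 2)"
        by (simp_all add: u(3) square_centre_def algebra_simps)
      ultimately show ?thesis
        using strict[of "d * of_int (fst p)" "q $ 1"] strict[of "d * of_int (snd p)" "q $ 2"] False u(1)
        by (simp add: distrib_left)
    qed (simp add: u)
  qed
  have nint: "\<not> (d * of_int k < d * of_int l \<and> d * of_int l < d * (of_int k + 1))" for k l :: int
  proof
    assume "d * of_int k < d * of_int l \<and> d * of_int l < d * (of_int k + 1)"
    then have "real_of_int k < real_of_int l" "real_of_int l < real_of_int (k + 1)" using d by auto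
    then show False by (simp only: of_int_less_iff)
  qed
  have "?c \<in> reduced_cycles 1 (top_of_set (- S))"
  proof (rule reduced_cycles_support[OF grid_chain_cycle[OF d]])
    fix f assume f: "f \<in> Poly_Mapping.keys ?c"
    show "simplex_path f ` {0..1} \<subseteq> - S"
    proof
      fix x assume x: "x \<in> simplex_path f ` {0..1}"
      have ne: "x \<noteq> q" using q(2)[OF f] x by blast
      have "f \<in> range (east_edge d) \<union> range (north_edge d)" using keys_grid_chain[of d N n, OF d N] f by blast
      from edge_image_coordinate[OF x this] interior[of x] ne show "x \<in> - S"
        using nint by (metis ComplI)
    qed
  qed
  then have "wind q ?c = wind ?m ?c"
    by (rule wind_connected[of _ S]) (simp_all add: S_def)
  also have "\<dots> = (\<Sum>p'\<in>N. n p' * (if p = p' then 1 else 0))"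
    unfolding grid_chain_def wind_simps wind_square_chain[OF d] ..
  also have "\<dots> = n p" using N by (cases "p \<in> N") (auto simp: if_distrib sum.delta cong: if_cong)
  finally show ?thesis .
qed

lemma grid_square_cover:
  assumes "d > 0"
  shows "x \<in> grid_square d (\<lfloor>x $ 1 / d\<rfloor>, \<lfloor>x $ 2 / d\<rfloor>)"
proof -
  have "d * of_int \<lfloor>a / d\<rfloor> \<le> a \<and> a \<le> d * (of_int \<lfloor>a / d\<rfloor> + 1)" for a
  proof -
    have "of_int \<lfloor>a / d\<rfloor> \<le> a / d" "a / d \<le> of_int \<lfloor>a / d\<rfloor> + 1" by linarith+
    then show ?thesis using assms
      by (simp only: pos_le_divide_eq pos_divide_le_eq mult.commute[of d])
  qed
  then show ?thesis by (simp add: grid_square_def)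
qed

lemma norm_real2_le: "norm x \<le> \<bar>x $ 1\<bar> + \<bar>x $ 2\<bar>" for x :: "real ^ 2"
  using norm_le_l1_cart[of x] by (simp add: sum_2)

lemma grid_square_dist:
  assumes "x \<in> grid_square d p" "y \<in> grid_square d p"
  shows "dist x y \<le> 2 * d"
proof -
  have "\<bar>(x - y) $ 1\<bar> \<le> d" "\<bar>(x - y) $ 2\<bar> \<le> d"
    using assms by (auto simp: grid_square_def algebra_simps abs_le_iff)
  then show ?thesis using norm_real2_le[of "x - y"] by (simp add: dist_norm)
qed

subsection \<open>Approximation of cycles by grid cycles\<close>

definition grid_round :: "real \<Rightarrow> real ^ 2 \<Rightarrow> int \<times> int" where
  "grid_round d x = (\<lfloor>x $ 1 / d\<rfloor>, \<lfloor>x $ 2 / d\<rfloor>)"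

definition grid_chains_in :: "real \<Rightarrow> (real ^ 2) set \<Rightarrow> (real ^ 2, 'k::field) field_chain set" where
  "grid_chains_in d V = {c \<in> field_chains 1 (top_of_set V).
     Poly_Mapping.keys c \<subseteq> range (east_edge d) \<union> range (north_edge d)}"

lemma subspace_keys_subset: "chain_subspace {c :: ('a, 'k::field) field_chain. Poly_Mapping.keys c \<subseteq> S}"
  unfolding chain_subspace_def
proof (intro conjI ballI allI)
  fix c c' :: "('a, 'k) field_chain" and a
  assume c: "c \<in> {c. Poly_Mapping.keys c \<subseteq> S}"
  then show "chain_scale a c \<in> {c. Poly_Mapping.keys c \<subseteq> S}"
    by (auto simp: in_keys_iff)
  assume "c' \<in> {c. Poly_Mapping.keys c \<subseteq> S}"
  with c show "c + c' \<in> {c. Poly_Mapping.keys c \<subseteq> S}"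
    using keys_add[of c c'] unfolding mem_Collect_eq by blast
qed simp

lemma subspace_Int: "chain_subspace S \<Longrightarrow> chain_subspace T \<Longrightarrow> chain_subspace (S \<inter> T)"
  by (simp add: chain_subspace_def)

lemma subspace_grid_chains_in: "chain_subspace (grid_chains_in d V :: (real ^ 2, 'k::field) field_chain set)"
proof -
  have "grid_chains_in d V = field_chains 1 (top_of_set V) \<inter>
      {c :: (real ^ 2, 'k) field_chain. Poly_Mapping.keys c \<subseteq> range (east_edge d) \<union> range (north_edge d)}"
    by (simp only: grid_chains_in_def Int_def mem_Collect_eq)
  then show ?thesis by (simp only: subspace_Int subspace_field_chains subspace_keys_subset)
qed

lemma field_boundary_diff: "field_boundary p (c - c') = field_boundary p c - field_boundary p c'"
  using field_boundary_add[of p "c - c'" c'] by (simp add: algebra_simps)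

lemma segment_reverse_boundary:
  fixes x :: "'a::real_normed_vector"
  assumes S: "convex S" "S \<subseteq> V" and xy: "x \<in> S" "y \<in> S"
  shows "path_chain (linepath x y) + path_chain (linepath y x) \<in>
    (boundaries 1 (top_of_set V) :: ('a, 'k::field) field_chain set)"
proof -
  note B = chain_subspaceD[OF subspace_boundaries[where 'k = 'k]]
  have l: "linepath x x = (\<lambda>_. x)" by (simp add: linepath_def fun_eq_iff algebra_simps)
  have "x \<in> V" using S xy by blast
  from B(2)[OF convex_triangle_boundary[OF S xy(1,2,1)] const_path_boundary[OF this]]
  show ?thesis by (simp add: l)
qed

lemma edge_in_grid_chains:
  fixes V :: "(real ^ 2) set"
  assumes S: "convex S" "S \<subseteq> V" and p: "grid_point d p \<in> S"
  defines "G \<equiv> grid_chains_in d V :: (real ^ 2, 'k::field) field_chain set"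
  shows "grid_point d (east p) \<in> S \<Longrightarrow> path_chain (linepath (grid_point d p) (grid_point d (east p))) \<in> G"
    "grid_point d (north p) \<in> S \<Longrightarrow> path_chain (linepath (grid_point d p) (grid_point d (north p))) \<in> G"
proof -
  have seg: "path_chain (linepath (grid_point d p) y) \<in>
      (field_chains 1 (top_of_set V) :: (real ^ 2, 'k) field_chain set)" if "y \<in> S" for y
    using that closed_segment_subset[OF p that S(1)] S(2)
    by (intro path_chain_in_chains continuous_on_linepath) (auto simp: path_image_def[symmetric])
  show "grid_point d (east p) \<in> S \<Longrightarrow> path_chain (linepath (grid_point d p) (grid_point d (east p))) \<in> G"
    using seg[of "grid_point d (east p)"] unfolding G_def grid_chains_in_def edge_chains[symmetric] by simp
  show "grid_point d (north p) \<in> S \<Longrightarrow> path_chain (linepath (grid_point d p) (grid_point d (north p))) \<in> G"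
    using seg[of "grid_point d (north p)"] unfolding G_def grid_chains_in_def edge_chains[symmetric] by simp
qed

text \<open>A step to the west or south is homologous to minus the opposite step, which is a grid
  edge.\<close>

lemma grid_step:
  assumes S: "convex S" "S \<subseteq> V" and p: "grid_point d p \<in> S" "grid_point d p' \<in> S"
    and adj: "p' \<in> {p, east p, west p, north p, south p}"
  obtains P :: "(real ^ 2, 'k::field) field_chain" where "P \<in> grid_chains_in d V"
    "path_chain (linepath (grid_point d p) (grid_point d p')) - P \<in> boundaries 1 (top_of_set V)"
    "field_boundary 1 P = point_chain (grid_point d p') - point_chain (grid_point d p)"
proof -
  let ?seg = "\<lambda>p p'. path_chain (linepath (grid_point d p) (grid_point d p')) :: (real ^ 2, 'k) field_chain"
  note result = that
  note G = chain_subspaceD[OF subspace_grid_chains_in[where 'k = 'k]]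
  note B = chain_subspaceD[OF subspace_boundaries[where 'k = 'k]]
  have fb: "field_boundary 1 (?seg p p') = point_chain (grid_point d p') - point_chain (grid_point d p)" for p p'
    unfolding field_boundary_path_chain by (simp only: linepath_0' linepath_1')
  have fwd: ?thesis if "?seg p p' \<in> grid_chains_in d V"
    by (rule result[OF that]) (use fb B(1) in auto)
  have bwd: ?thesis if "?seg p' p \<in> grid_chains_in d V"
  proof (rule result[of "- ?seg p' p"])
    show "- ?seg p' p \<in> grid_chains_in d V" by (rule G(4)[OF that])
    show "?seg p p' - - ?seg p' p \<in> boundaries 1 (top_of_set V)"
      using segment_reverse_boundary[OF S p, where 'k = 'k] by simp
    show "field_boundary 1 (- ?seg p' p) = point_chain (grid_point d p') - point_chain (grid_point d p)"
      using field_boundary_diff[of 1 0 "?seg p' p"] fb by simp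
  qed
  consider "p' = p" | "p' = east p" | "p' = north p" | "p = east p'" | "p = north p'"
    using adj by (auto simp: prod_eq_iff)
  then show ?thesis
  proof cases
    case 1
    show ?thesis
    proof (rule result[of 0])
      have "linepath (grid_point d p) (grid_point d p) = (\<lambda>_. grid_point d p)"
        by (simp add: linepath_def fun_eq_iff algebra_simps)
      then show "?seg p p' - 0 \<in> boundaries 1 (top_of_set V)"
        using 1 const_path_boundary[of "grid_point d p" V, where 'k = 'k] p S(2) by auto
    qed (use 1 G(1) in auto)
  next
    case 2
    then show ?thesis using fwd edge_in_grid_chains(1)[OF S p(1)] p(2) by simp
  next
    case 3
    then show ?thesis using fwd edge_in_grid_chains(2)[OF S p(1)] p(2) by simp
  next
    case 4
    then show ?thesis using bwd edge_in_grid_chains(1)[OF S p(2)] p(1) by simp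
  next
    case 5
    then show ?thesis using bwd edge_in_grid_chains(2)[OF S p(2)] p(1) by simp
  qed
qed

text \<open>The roundings of the end points differ by at most one step in each direction and are
  joined through the corner \<open>k\<close>. All points involved lie in the ball of radius
  \<open>4 * d\<close>, where triangles are boundaries.\<close>

lemma short_path_grid_approx:
  fixes g :: "real \<Rightarrow> real ^ 2"
  assumes d: "d > 0" and V: "ball x (4 * d) \<subseteq> V"
    and g: "continuous_on {0..1} g" "g ` {0..1} \<subseteq> ball x (d / 2)"
  defines "\<rho> \<equiv> \<lambda>y. grid_point d (grid_round d y)"
  obtains P :: "(real ^ 2, 'k::field) field_chain" where "P \<in> grid_chains_in d V"
    "path_chain g - (P + (path_chain (linepath (\<rho> (g 1)) (g 1)) - path_chain (linepath (\<rho> (g 0)) (g 0))))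
       \<in> boundaries 1 (top_of_set V)"
    "field_boundary 1 P = point_chain (\<rho> (g 1)) - point_chain (\<rho> (g 0))"
proof -
  define S where "S = ball x (4 * d)"
  note B = chain_subspaceD[OF subspace_boundaries[where 'k = 'k]]
  have S: "convex S" "S \<subseteq> V" using V by (simp_all add: S_def)
  define a b where "a = g 0" "b = g 1"
  have "g 0 \<in> ball x (d / 2)" "g 1 \<in> ball x (d / 2)" by (rule subsetD[OF g(2)]; simp)+
  then have ab: "dist x a < d / 2" "dist x b < d / 2" by (simp_all add: a_b_def)
  define p p' where "p = grid_round d a" "p' = grid_round d b"
  define k where "k = (fst p', snd p)"
  have comp: "\<bar>(x - y) $ i\<bar> < d / 2" if "dist x y < d / 2" for y and i :: 2
    using component_le_norm_cart[of "x - y" i] that by (simp add: dist_norm)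
  have fl: "\<bar>d * of_int \<lfloor>u / d\<rfloor> - u\<bar> \<le> d" for u
  proof -
    have "of_int \<lfloor>u / d\<rfloor> \<le> u / d" "u / d \<le> of_int \<lfloor>u / d\<rfloor> + 1" by linarith+
    then have "of_int \<lfloor>u / d\<rfloor> * d \<le> u" "u \<le> (of_int \<lfloor>u / d\<rfloor> + 1) * d"
      using d by (simp_all only: pos_le_divide_eq pos_divide_le_eq)
    then show ?thesis by (simp add: algebra_simps abs_le_iff)
  qed
  have inS: "grid_point d (\<lfloor>u / d\<rfloor>, \<lfloor>v / d\<rfloor>) \<in> S" if "\<bar>x $ 1 - u\<bar> < d / 2" "\<bar>x $ 2 - v\<bar> < d / 2" for u v
  proof -
    have "\<bar>x $ 1 - d * of_int \<lfloor>u / d\<rfloor>\<bar> < 2 * d" using that(1) fl[of u] d by linarith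
    moreover have "\<bar>x $ 2 - d * of_int \<lfloor>v / d\<rfloor>\<bar> < 2 * d" using that(2) fl[of v] d by linarith
    ultimately have "\<bar>(x - grid_point d (\<lfloor>u / d\<rfloor>, \<lfloor>v / d\<rfloor>)) $ 1\<bar> < 2 * d"
      "\<bar>(x - grid_point d (\<lfloor>u / d\<rfloor>, \<lfloor>v / d\<rfloor>)) $ 2\<bar> < 2 * d" by simp_all
    then show ?thesis
      using norm_real2_le[of "x - grid_point d (\<lfloor>u / d\<rfloor>, \<lfloor>v / d\<rfloor>)"] by (simp add: S_def dist_norm)
  qed
  have ca: "\<bar>x $ 1 - a $ 1\<bar> < d / 2" "\<bar>x $ 2 - a $ 2\<bar> < d / 2"
    and cb: "\<bar>x $ 1 - b $ 1\<bar> < d / 2" "\<bar>x $ 2 - b $ 2\<bar> < d / 2"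
    using comp[OF ab(1), of 1] comp[OF ab(1), of 2] comp[OF ab(2), of 1] comp[OF ab(2), of 2] by simp_all
  have gp: "grid_point d p \<in> S" "grid_point d p' \<in> S" "grid_point d k \<in> S"
    using inS[OF ca] inS[OF cb] inS[OF cb(1) ca(2)] by (simp_all add: p_p'_def k_def grid_round_def)
  have adj: "\<bar>\<lfloor>u / d\<rfloor> - \<lfloor>v / d\<rfloor>\<bar> \<le> 1" if "\<bar>u - v\<bar> < d" for u v
  proof -
    have "\<bar>u / d - v / d\<bar> < 1" using that d by (simp add: diff_divide_distrib[symmetric] abs_divide)
    then show ?thesis by linarith
  qed
  have "\<bar>a $ 1 - b $ 1\<bar> < d" "\<bar>a $ 2 - b $ 2\<bar> < d" using ca cb by linarith+
  then have "\<bar>fst p - fst p'\<bar> \<le> 1" "\<bar>snd p - snd p'\<bar> \<le> 1"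
    using adj by (simp_all add: p_p'_def grid_round_def)
  then have k: "k \<in> {p, east p, west p, north p, south p}" "p' \<in> {k, east k, west k, north k, south k}"
    by (auto simp: k_def prod_eq_iff)
  obtain P1 :: "(real ^ 2, 'k) field_chain" where P1: "P1 \<in> grid_chains_in d V"
    "path_chain (linepath (grid_point d p) (grid_point d k)) - P1 \<in> boundaries 1 (top_of_set V)"
    "field_boundary 1 P1 = point_chain (grid_point d k) - point_chain (grid_point d p)"
    by (rule grid_step[OF S gp(1,3) k(1)])
  obtain P2 :: "(real ^ 2, 'k) field_chain" where P2: "P2 \<in> grid_chains_in d V"
    "path_chain (linepath (grid_point d k) (grid_point d p')) - P2 \<in> boundaries 1 (top_of_set V)"
    "field_boundary 1 P2 = point_chain (grid_point d p') - point_chain (grid_point d k)"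
    by (rule grid_step[OF S gp(3,2) k(2)])
  let ?s = "\<lambda>x y. path_chain (linepath x y) :: (real ^ 2, 'k) field_chain"
  let ?p = "grid_point d p" and ?k = "grid_point d k" and ?q = "grid_point d p'"
  have abS: "a \<in> S" "b \<in> S" using ab d by (auto simp: S_def)
  have gS: "g ` {0..1} \<subseteq> S" using g(2) d by (force simp: S_def)
  have h: "path_chain g - ?s a b \<in> boundaries 1 (top_of_set V)"
    using convex_path_boundary[OF S g(1) gS, where 'k = 'k] by (simp add: a_b_def)
  note tri = convex_triangle_boundary[OF S, where 'k = 'k]
  \<comment> \<open>Replace \<open>g\<close> by its chord, shift the chord to the segment between
    the rounded end points, and bend this segment into the two grid steps.\<close>
  have "(path_chain g - ?s a b) + (?s ?p a + ?s a b - ?s ?p b) - (?s ?p ?q + ?s ?q b - ?s ?p b) -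
      (?s ?p ?k + ?s ?k ?q - ?s ?p ?q) + (?s ?p ?k - P1) + (?s ?k ?q - P2) =
      path_chain g - ((P1 + P2) + (?s ?q b - ?s ?p a))" by (simp add: algebra_simps)
  with B(2)[OF B(2)[OF B(5)[OF B(5)[OF B(2)[OF h tri[OF gp(1) abS]] tri[OF gp(1,2) abS(2)]]
        tri[OF gp(1,3,2)]] P1(2)] P2(2)]
  have "path_chain g - ((P1 + P2) + (?s ?q b - ?s ?p a)) \<in> boundaries 1 (top_of_set V)"
    by (simp only:)
  moreover have "P1 + P2 \<in> grid_chains_in d V"
    using chain_subspaceD(2)[OF subspace_grid_chains_in P1(1) P2(1)] .
  moreover have "field_boundary 1 (P1 + P2) = point_chain ?q - point_chain ?p"
    by (simp add: field_boundary_add P1(3) P2(3) del: One_nat_def)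
  ultimately show ?thesis using that[of "P1 + P2"] unfolding \<rho>_def a_b_def p_p'_def by blast
qed

text \<open>Bisection: the claim holds on short intervals, and it is additive, since the corrections
  at a common end point cancel and \<open>subdivide_path_boundary\<close> joins the pieces.\<close>

lemma path_grid_approx:
  fixes g :: "real \<Rightarrow> real ^ 2"
  assumes d: "d > 0" and g: "continuous_on {0..1} g" "\<And>t. t \<in> {0..1} \<Longrightarrow> ball (g t) (4 * d) \<subseteq> V"
  defines "\<rho> \<equiv> \<lambda>y. grid_point d (grid_round d y)"
  obtains P :: "(real ^ 2, 'k::field) field_chain" where "P \<in> grid_chains_in d V"
    "path_chain g - (P + (path_chain (linepath (\<rho> (g 1)) (g 1)) - path_chain (linepath (\<rho> (g 0)) (g 0))))
       \<in> boundaries 1 (top_of_set V)"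
    "field_boundary 1 P = point_chain (\<rho> (g 1)) - point_chain (\<rho> (g 0))"
proof -
  note B = chain_subspaceD[OF subspace_boundaries[where 'k = 'k]]
  define S :: "real ^ 2 \<Rightarrow> (real ^ 2, 'k) field_chain" where "S y = path_chain (linepath (\<rho> y) y)" for y
  define Q where "Q a b \<longleftrightarrow> (0 \<le> a \<and> a \<le> b \<and> b \<le> 1 \<longrightarrow> (\<exists>P :: (real ^ 2, 'k) field_chain. P \<in> grid_chains_in d V \<and>
    path_chain (\<lambda>t. g ((1 - t) * a + t * b)) - (P + (S (g b) - S (g a))) \<in> boundaries 1 (top_of_set V) \<and>
    field_boundary 1 P = point_chain (\<rho> (g b)) - point_chain (\<rho> (g a))))" for a b
  have gV: "g ` {0..1} \<subseteq> V" using g(2) d by force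
  have "Q 0 1"
  proof (rule Bolzano[of 0 1 Q])
    fix a b c assume abc: "Q a b" "Q b c" "a \<le> b" "b \<le> c"
    show "Q a c"
      unfolding Q_def
    proof (intro impI)
      assume ac: "0 \<le> a \<and> a \<le> c \<and> c \<le> 1"
      obtain P1 :: "(real ^ 2, 'k) field_chain" where P1: "P1 \<in> grid_chains_in d V"
        "path_chain (\<lambda>t. g ((1 - t) * a + t * b)) - (P1 + (S (g b) - S (g a))) \<in> boundaries 1 (top_of_set V)"
        "field_boundary 1 P1 = point_chain (\<rho> (g b)) - point_chain (\<rho> (g a))"
        using abc ac unfolding Q_def by auto
      obtain P2 :: "(real ^ 2, 'k) field_chain" where P2: "P2 \<in> grid_chains_in d V"
        "path_chain (\<lambda>t. g ((1 - t) * b + t * c)) - (P2 + (S (g c) - S (g b))) \<in> boundaries 1 (top_of_set V)"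
        "field_boundary 1 P2 = point_chain (\<rho> (g c)) - point_chain (\<rho> (g b))"
        using abc ac unfolding Q_def by auto
      have sub: "{a..c} \<subseteq> {0..1}" using ac by auto
      have "g ` {a..c} \<subseteq> V" using gV sub by blast
      from B(5)[OF B(2)[OF P1(2) P2(2)]
          subdivide_path_boundary[OF continuous_on_subset[OF g(1) sub] this abc(3,4), where 'k = 'k]]
      have "path_chain (\<lambda>t. g ((1 - t) * a + t * c)) - ((P1 + P2) + (S (g c) - S (g a)))
          \<in> boundaries 1 (top_of_set V)"
        by (simp add: algebra_simps)
      moreover have "P1 + P2 \<in> grid_chains_in d V"
        using chain_subspaceD(2)[OF subspace_grid_chains_in P1(1) P2(1)] .
      moreover have "field_boundary 1 (P1 + P2) = point_chain (\<rho> (g c)) - point_chain (\<rho> (g a))"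
        by (simp add: field_boundary_add P1(3) P2(3) del: One_nat_def)
      ultimately show "\<exists>P :: (real ^ 2, 'k) field_chain. P \<in> grid_chains_in d V \<and>
        path_chain (\<lambda>t. g ((1 - t) * a + t * c)) - (P + (S (g c) - S (g a))) \<in> boundaries 1 (top_of_set V) \<and>
        field_boundary 1 P = point_chain (\<rho> (g c)) - point_chain (\<rho> (g a))" by blast
    qed
  next
    fix x :: real assume x: "0 \<le> x" "x \<le> 1"
    then obtain e where e: "e > 0" "\<And>y. y \<in> {0..1} \<Longrightarrow> dist y x < e \<Longrightarrow> dist (g y) (g x) < d / 2"
      using g(1) d unfolding continuous_on_iff by (metis atLeastAtMost_iff half_gt_zero)
    show "\<exists>e>0. \<forall>a b. a \<le> x \<and> x \<le> b \<and> b - a < e \<longrightarrow> Q a b"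
    proof (intro exI[of _ e] conjI allI impI e(1))
      fix a b assume ab: "a \<le> x \<and> x \<le> b \<and> b - a < e"
      show "Q a b"
        unfolding Q_def
      proof (intro impI)
        assume r: "0 \<le> a \<and> a \<le> b \<and> b \<le> 1"
        define h where "h t = g ((1 - t) * a + t * b)" for t
        have seg: "(1 - t) * a + t * b \<in> {a..b}" if "t \<in> {0..1}" for t
        proof -
          have "(1 - t) * a + t * b = a + t * (b - a)" by (simp add: algebra_simps)
          moreover have "t * (b - a) \<le> 1 * (b - a)" using that r by (intro mult_right_mono) auto
          moreover have "0 \<le> t * (b - a)" using that r by (intro mult_nonneg_nonneg) auto
          ultimately show ?thesis by simp
        qed
        have c: "continuous_on {0..1} h"
          unfolding h_def
        proof (rule continuous_on_compose2[OF g(1)])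
          show "(\<lambda>t. (1 - t) * a + t * b) ` {0..1} \<subseteq> {0..1}" using seg r by fastforce
        qed (intro continuous_intros)
        have im: "h ` {0..1} \<subseteq> ball (g x) (d / 2)"
        proof
          fix y assume "y \<in> h ` {0..1}"
          then obtain t where t: "t \<in> {0..1}" "y = h t" by blast
          have m: "(1 - t) * a + t * b \<in> {a..b}" using seg[OF t(1)] .
          have "dist (g ((1 - t) * a + t * b)) (g x) < d / 2"
            using m r ab by (intro e(2)) (auto simp: dist_real_def abs_less_iff)
          then show "y \<in> ball (g x) (d / 2)" using t by (simp add: h_def dist_commute)
        qed
        have "ball (g x) (4 * d) \<subseteq> V" using g(2)[of x] x by simp
        from short_path_grid_approx[OF d this c im, where 'k = 'k]
        obtain P :: "(real ^ 2, 'k) field_chain" where "P \<in> grid_chains_in d V"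
          "path_chain h - (P + (path_chain (linepath (\<rho> (h 1)) (h 1)) - path_chain (linepath (\<rho> (h 0)) (h 0))))
             \<in> boundaries 1 (top_of_set V)"
          "field_boundary 1 P = point_chain (\<rho> (h 1)) - point_chain (\<rho> (h 0))"
          unfolding \<rho>_def by metis
        then show "\<exists>P :: (real ^ 2, 'k) field_chain. P \<in> grid_chains_in d V \<and>
          path_chain (\<lambda>t. g ((1 - t) * a + t * b)) - (P + (S (g b) - S (g a))) \<in> boundaries 1 (top_of_set V) \<and>
          field_boundary 1 P = point_chain (\<rho> (g b)) - point_chain (\<rho> (g a))"
          unfolding h_def S_def by auto
      qed
    qed
  qed simp
  then show ?thesis using that unfolding Q_def S_def by auto
qed

lemma cycle_grid_approx:
  fixes c :: "(real ^ 2, 'k::field) field_chain"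
  assumes c: "c \<in> reduced_cycles 1 (top_of_set V)" and V: "open V"
  obtains d c1 where "d > 0" "c1 \<in> grid_chains_in d V" "field_boundary 1 c1 = 0"
    "c - c1 \<in> boundaries 1 (top_of_set V)"
proof -
  have c': "c \<in> field_chains 1 (top_of_set V)" "field_boundary 1 c = 0"
    using c unfolding reduced_cycles_1 by blast+
  define K where "K = (\<Union>f\<in>Poly_Mapping.keys c. simplex_path f ` {0..1})"
  have K: "compact K" "K \<subseteq> V" using compact_chain_support[OF c'(1)] by (simp_all add: K_def)
  have "K \<inter> - V = {}" using K(2) by blast
  then obtain r where r: "r > 0" "\<And>x y. x \<in> K \<Longrightarrow> y \<in> - V \<Longrightarrow> r \<le> dist x y"
    using separate_compact_closed[OF K(1) closed_Compl[OF V]] by blast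
  \<comment> \<open>The support keeps distance \<open>r\<close> from the complement of
    \<open>V\<close>, so balls of radius \<open>4 * d\<close> around its points stay in
    \<open>V\<close>.\<close>
  define d where "d = r / 4"
  have d: "d > 0" using r by (simp add: d_def)
  have ball: "ball x (4 * d) \<subseteq> V" if "x \<in> K" for x
  proof
    fix y assume "y \<in> ball x (4 * d)"
    then have "dist x y < r" by (simp add: d_def)
    then show "y \<in> V" using r(2)[OF that, of y] by force
  qed
  let ?\<rho> = "\<lambda>y. grid_point d (grid_round d y)"
  define S where "S y = (path_chain (linepath (?\<rho> y) y) :: (real ^ 2, 'k) field_chain)" for y
  define good where "good f P \<longleftrightarrow> P \<in> grid_chains_in d V \<and>
      Poly_Mapping.single f 1 - (P + (S (simplex_path f 1) - S (simplex_path f 0))) \<in> boundaries 1 (top_of_set V) \<and>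
      field_boundary 1 P = point_chain (?\<rho> (simplex_path f 1)) - point_chain (?\<rho> (simplex_path f 0))"
    for f and P :: "(real ^ 2, 'k) field_chain"
  have "\<exists>P. good f P" if f: "f \<in> Poly_Mapping.keys c" for f
  proof -
    note g = simplex_in_chain_path[OF c'(1) f]
    have gb: "ball (simplex_path f t) (4 * d) \<subseteq> V" if "t \<in> {0..1}" for t
      by (rule ball) (use f that in \<open>unfold K_def, blast\<close>)
    have e: "Poly_Mapping.single f (1 :: 'k) = path_chain (simplex_path f)" by (rule g(1))
    show ?thesis
      unfolding good_def S_def e by (rule path_grid_approx[OF d g(2) gb, where 'k = 'k]) blast+
  qed
  then obtain P where P: "\<And>f. f \<in> Poly_Mapping.keys c \<Longrightarrow> good f (P f)" by metis
  define c1 where "c1 = (\<Sum>f\<in>Poly_Mapping.keys c. chain_scale (Poly_Mapping.lookup c f) (P f))"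
  have "c1 \<in> grid_chains_in d V"
    unfolding c1_def using P unfolding good_def
    by (intro chain_subspace_sum subspace_grid_chains_in chain_subspaceD(3)[OF subspace_grid_chains_in]) blast
  \<comment> \<open>The boundary of a piece depends only on the end points of its simplex, and such
    terms cancel along the cycle \<open>c\<close>.\<close>
  moreover have "field_boundary 1 c1 = 0"
  proof -
    have "field_boundary 1 c1 = (\<Sum>f\<in>Poly_Mapping.keys c. chain_scale (Poly_Mapping.lookup c f)
        (point_chain (?\<rho> (simplex_path f 1)) - point_chain (?\<rho> (simplex_path f 0))))"
      unfolding c1_def field_boundary_sum field_boundary_scale
      using P unfolding good_def by (intro sum.cong refl arg_cong[of _ _ "chain_scale _"]) blast
    also have "\<dots> = 0" by (rule cycle_sum_chain[OF c'(2)])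
    finally show ?thesis .
  qed
  moreover have "c - c1 \<in> boundaries 1 (top_of_set V)"
    unfolding c1_def using P unfolding good_def
    by (intro cycle_approx[OF c'(2) subspace_boundaries, of _ S]) blast
  ultimately show ?thesis using that d by blast
qed

text \<open>The injective half of the duality. For a homologous grid cycle, the coefficient of a
  square that contains a point outside \<open>V\<close> is the winding number around that point,
  hence zero; all other squares lie in \<open>V\<close> and are boundaries there.\<close>

lemma cycle_boundary_if_wind_zero:
  fixes c :: "(real ^ 2, 'k::field) field_chain"
  assumes c: "c \<in> reduced_cycles 1 (top_of_set V)" and V: "open V" and w: "\<And>q. q \<notin> V \<Longrightarrow> wind q c = 0"
  shows "c \<in> boundaries 1 (top_of_set V)"
proof -
  obtain d and c1 :: "(real ^ 2, 'k) field_chain" where d: "d > 0" and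
    c1: "c1 \<in> grid_chains_in d V" "field_boundary 1 c1 = 0" and cc: "c - c1 \<in> boundaries 1 (top_of_set V)"
    using cycle_grid_approx[OF c V] by blast
  have c1': "c1 \<in> field_chains 1 (top_of_set V)" "Poly_Mapping.keys c1 \<subseteq> range (east_edge d) \<union> range (north_edge d)"
    using c1(1) by (simp_all add: grid_chains_in_def)
  obtain N and n :: "int \<times> int \<Rightarrow> 'k" where N: "finite N" "\<And>p. p \<notin> N \<Longrightarrow> n p = 0" "c1 = grid_chain d N n"
    using grid_cycle_decomposition[OF d c1'(2) c1(2)] by blast
  have "n p = 0 \<or> grid_square d p \<subseteq> V" for p
  proof (rule disjCI)
    assume "\<not> grid_square d p \<subseteq> V"
    then obtain q where q: "q \<in> grid_square d p" "q \<notin> V" by blast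
    have "wind q (c - c1) = 0" by (rule wind_boundary[OF cc q(2)])
    then have "wind q c1 = 0" using w[OF q(2)] by (simp add: wind_simps)
    moreover have "q \<notin> simplex_path f ` {0..1}" if "f \<in> Poly_Mapping.keys c1" for f
      using simplex_in_chain_path(3)[OF c1'(1) that] q(2) by blast
    then have "wind q c1 = n p" unfolding N(3) by (intro wind_grid_chain[OF d N(1,2) q(1)]) auto
    ultimately show "n p = 0" by simp
  qed
  then have "chain_scale (n p) (square_chain d p) \<in> boundaries 1 (top_of_set V)" for p
    using square_chain_boundary[OF d] chain_subspaceD(1,3)[OF subspace_boundaries]
    by (metis chain_scale_algebra(5))
  then have "c1 \<in> boundaries 1 (top_of_set V)"
    unfolding N(3) grid_chain_def by (intro chain_subspace_sum subspace_boundaries)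
  from chain_subspaceD(2)[OF subspace_boundaries cc this] show ?thesis by simp
qed

text \<open>The boundary of the union of the grid squares that meet \<open>S\<close> separates \<open>S\<close> from \<open>T\<close>.\<close>

lemma separating_cycle:
  assumes S: "compact S" and T: "closed T" and disj: "S \<inter> T = {}"
  obtains c :: "(real ^ 2, 'k::field) field_chain" where
    "c \<in> reduced_cycles 1 (top_of_set (- (S \<union> T)))" "\<And>q. q \<in> S \<Longrightarrow> wind q c = 1" "\<And>q. q \<in> T \<Longrightarrow> wind q c = 0"
proof -
  obtain r where r: "r > 0" "\<And>x y. x \<in> S \<Longrightarrow> y \<in> T \<Longrightarrow> r \<le> dist x y"
    using separate_compact_closed[OF S T disj] by blast
  \<comment> \<open>Two points of a grid square are at most \<open>2 * d < r\<close> apart, so no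
    square meets both \<open>S\<close> and \<open>T\<close>.\<close>
  define d where "d = r / 3"
  have d: "d > 0" "2 * d < r" using r by (auto simp: d_def)
  define N where "N = {p. grid_square d p \<inter> S \<noteq> {}}"
  define n :: "int \<times> int \<Rightarrow> 'k" where "n p = (if p \<in> N then 1 else 0)" for p
  have n0: "\<And>p. p \<notin> N \<Longrightarrow> n p = 0" by (simp add: n_def)
  have "finite N"
  proof -
    obtain R where R: "\<And>x. x \<in> S \<Longrightarrow> norm x \<le> R"
      using compact_imp_bounded[OF S] unfolding bounded_iff by blast
    define k where "k = \<lceil>R / d\<rceil>"
    have "fst p \<in> {- k - 1..k} \<and> snd p \<in> {- k - 1..k}" if pN: "p \<in> N" for p
    proof -
      obtain x where x: "x \<in> grid_square d p" "x \<in> S" using pN by (auto simp: N_def)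
      have bnd: "i \<in> {- k - 1..k}" if "d * of_int i \<le> u" "u \<le> d * (of_int i + 1)" "\<bar>u\<bar> \<le> R" for i u
      proof -
        have "of_int i \<le> u / d" "u / d \<le> of_int i + 1"
          using that d by (simp_all only: pos_le_divide_eq pos_divide_le_eq mult.commute[of d])
        moreover have "\<bar>u / d\<bar> \<le> R / d" using that d by (simp add: abs_divide divide_right_mono)
        ultimately have "of_int i \<le> R / d" "- (R / d) \<le> of_int i + 1" by linarith+
        then show ?thesis unfolding k_def by (simp only: atLeastAtMost_iff) linarith
      qed
      have "\<bar>x $ i\<bar> \<le> R" for i using component_le_norm_cart[of x i] R[OF x(2)] by linarith
      then show ?thesis using x(1) bnd[of "fst p" "x $ 1"] bnd[of "snd p" "x $ 2"] by (simp add: grid_square_def)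
    qed
    then have "N \<subseteq> {- k - 1..k} \<times> {- k - 1..k}" by force
    then show ?thesis by (rule finite_subset) simp
  qed
  note N = this n0
  let ?c = "grid_chain d N n"
  \<comment> \<open>An edge survives in the chain only between a square of \<open>N\<close> and one
    outside \<open>N\<close>: the latter keeps it off \<open>S\<close>, the former off
    \<open>T\<close>.\<close>
  have avoid: "x \<notin> S \<union> T" if x: "x \<in> grid_square d p" "x \<in> grid_square d p'" "p \<in> N" "p' \<notin> N" for x p p'
  proof -
    have "x \<notin> S" using x by (auto simp: N_def)
    moreover obtain y where y: "y \<in> grid_square d p" "y \<in> S" using x(3) by (auto simp: N_def)
    then have "dist y x \<le> 2 * d" using grid_square_dist x(1) by blast
    then have "x \<notin> T" using r(2)[OF y(2), of x] d by force
    ultimately show ?thesis by blast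
  qed
  have av: "x \<notin> S \<union> T" if "x \<in> grid_square d p" "x \<in> grid_square d p'" "(p \<in> N) \<noteq> (p' \<in> N)" for x p p'
    using that avoid[of x p p'] avoid[of x p' p] by blast
  have on_edge: "linepath (grid_point d p) (grid_point d (east p)) t \<in> grid_square d p \<inter> grid_square d (south p)"
    "linepath (grid_point d p) (grid_point d (north p)) t \<in> grid_square d p \<inter> grid_square d (west p)"
    if "t \<in> {0..1}" for p t
  proof -
    have td: "0 \<le> d * t" "d * t \<le> d" using that d by auto
    have c: "linepath (grid_point d p) (grid_point d (east p)) t $ 1 = d * of_int (fst p) + d * t"
      "linepath (grid_point d p) (grid_point d (east p)) t $ 2 = d * of_int (snd p)"
      "linepath (grid_point d p) (grid_point d (north p)) t $ 1 = d * of_int (fst p)"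
      "linepath (grid_point d p) (grid_point d (north p)) t $ 2 = d * of_int (snd p) + d * t"
      by (simp_all add: linepath_def algebra_simps)
    show "linepath (grid_point d p) (grid_point d (east p)) t \<in> grid_square d p \<inter> grid_square d (south p)"
      "linepath (grid_point d p) (grid_point d (north p)) t \<in> grid_square d p \<inter> grid_square d (west p)"
      unfolding grid_square_def Int_iff mem_Collect_eq c using td d by (simp_all add: right_diff_distrib distrib_left)
  qed
  have key: "simplex_path f ` {0..1} \<subseteq> - (S \<union> T)" if f: "f \<in> Poly_Mapping.keys ?c" for f
  proof -
    have nz: "Poly_Mapping.lookup ?c f \<noteq> 0" using f by (simp add: in_keys_iff)
    have "f \<in> range (east_edge d) \<union> range (north_edge d)" using keys_grid_chain[of d N n, OF d(1) N] f by blast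
    then consider p where "f = east_edge d p" | p where "f = north_edge d p" by blast
    then show ?thesis
    proof cases
      case (1 p)
      then have ne: "(p \<in> N) \<noteq> (south p \<in> N)"
        using nz lookup_grid_chain(1)[of d N n p, OF d(1) N] by (auto simp: n_def split: if_splits)
      have "simplex_path f t \<notin> S \<union> T" if "t \<in> {0..1}" for t
        unfolding 1 edge_paths[OF that] using on_edge(1)[OF that] by (intro av[OF _ _ ne]) blast+
      then show ?thesis by blast
    next
      case (2 p)
      then have ne: "(p \<in> N) \<noteq> (west p \<in> N)"
        using nz lookup_grid_chain(2)[of d N n p, OF d(1) N] by (auto simp: n_def split: if_splits)
      have "simplex_path f t \<notin> S \<union> T" if "t \<in> {0..1}" for t
        unfolding 2 edge_paths[OF that] using on_edge(2)[OF that] by (intro av[OF _ _ ne]) blast+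
      then show ?thesis by blast
    qed
  qed
  have wind: "wind q ?c = n (grid_round d q)" if "q \<in> S \<union> T" for q
    unfolding grid_round_def
  proof (rule wind_grid_chain[OF d(1) N grid_square_cover[OF d(1)]])
    fix f assume "f \<in> Poly_Mapping.keys ?c"
    from key[OF this] that show "q \<notin> simplex_path f ` {0..1}" by blast
  qed
  show ?thesis
  proof (rule that)
    show "?c \<in> reduced_cycles 1 (top_of_set (- (S \<union> T)))"
      by (rule reduced_cycles_support[OF grid_chain_cycle[OF d(1)] key])
    have sq: "q \<in> grid_square d (grid_round d q)" for q
      using grid_square_cover[OF d(1), of q] by (simp add: grid_round_def)
    show "wind q ?c = 1" if "q \<in> S" for q
      using wind[of q] that sq[of q] by (auto simp: n_def N_def)
    show "wind q ?c = 0" if "q \<in> T" for q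
    proof -
      have "grid_round d q \<notin> N"
      proof
        assume "grid_round d q \<in> N"
        then obtain y where y: "y \<in> grid_square d (grid_round d q)" "y \<in> S" by (auto simp: N_def)
        then have "dist y q \<le> 2 * d" using grid_square_dist sq by blast
        then show False using r(2)[OF y(2) that] d by linarith
      qed
      then show ?thesis using wind[of q] that by (simp add: n_def)
    qed
  qed
qed

subsection \<open>The rank of an inclusion of neighbourhoods\<close>

text \<open>The bridge from the module definitions to \<open>dim_quotient_eq\<close>:
  \<open>inclusion_induced\<close> enlarges a coset of the boundaries of \<open>U\<close> to a coset
  of those of \<open>V\<close>.\<close>

lemma inclusion_rank_eq:
  fixes U V :: "(real ^ 2) set" and K :: "'k::field itself"
  assumes UV: "U \<subseteq> V" and finI: "finite I"
    and ker: "\<And>z :: (real ^ 2, 'k) field_chain. z \<in> reduced_cycles 1 (top_of_set U) \<Longrightarrow>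
      z \<in> boundaries 1 (top_of_set V) \<longleftrightarrow> (\<forall>i\<in>I. wind (q i) z = 0)"
    and dual: "\<And>i. i \<in> I \<Longrightarrow> e i \<in> (reduced_cycles 1 (top_of_set U) :: (real ^ 2, 'k) field_chain set)"
      "\<And>i j. i \<in> I \<Longrightarrow> j \<in> I \<Longrightarrow> wind (q j) (e i) = (if i = j then 1 else 0)"
  shows "inclusion_rank K 1 (top_of_set U) (top_of_set V) = card I"
proof -
  let ?Z = "reduced_cycles 1 (top_of_set U) :: (real ^ 2, 'k) field_chain set"
  let ?BU = "boundaries 1 (top_of_set U) :: (real ^ 2, 'k) field_chain set"
  let ?B = "boundaries 1 (top_of_set V) :: (real ^ 2, 'k) field_chain set"
  let ?H = "reduced_homology 1 (top_of_set V) :: ('k, (real ^ 2, 'k) field_chain set) module"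
  have rc: "W +>\<^bsub>cycle_module 1 Y\<^esub> z = coset W z" for W Y and z :: "(real ^ 2, 'k) field_chain"
    by (auto simp: a_r_coset_def r_coset_def cycle_module_def coset_def)
  have carr: "carrier (reduced_homology 1 (top_of_set U) :: ('k, (real ^ 2, 'k) field_chain set) module) = coset ?BU ` ?Z"
  proof -
    have "carrier (reduced_homology 1 (top_of_set U) :: ('k, (real ^ 2, 'k) field_chain set) module) =
        a_rcosets\<^bsub>cycle_module 1 (top_of_set U)\<^esub> ?BU"
      by (simp add: reduced_homology_def quotient_module_def)
    moreover have "carrier (cycle_module 1 (top_of_set U)) = ?Z" by (simp add: cycle_module_def)
    ultimately show ?thesis unfolding A_RCOSETS_def' rc by blast
  qed
  have ind: "inclusion_induced 1 (top_of_set V) (coset ?BU z) = coset ?B z" for z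
  proof -
    have "coset ?B (b + z) = coset ?B z" if "b \<in> ?BU" for b
      using that boundaries_mono[OF UV, of 1] by (subst coset_eq_iff[OF subspace_boundaries]) auto
    moreover have "coset ?BU z \<noteq> {}"
      using chain_subspaceD(1)[OF subspace_boundaries] by (auto simp: coset_def)
    ultimately show ?thesis
      unfolding inclusion_induced_def rc by (auto simp: coset_def)
  qed
  define M where "M = ?H\<lparr>carrier := inclusion_induced 1 (top_of_set V) `
      carrier (reduced_homology 1 (top_of_set U) :: ('k, (real ^ 2, 'k) field_chain set) module)\<rparr>"
  have "vectorspace.dim (class_ring :: 'k ring) M = card I"
  proof (rule dim_quotient_eq[of ?Z ?B M I "\<lambda>i. wind (q i)" e])
    have "carrier M = inclusion_induced 1 (top_of_set V) `
        carrier (reduced_homology 1 (top_of_set U) :: ('k, (real ^ 2, 'k) field_chain set) module)"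
      by (simp add: M_def)
    then show "carrier M = coset ?B ` ?Z" unfolding carr image_image ind .
    show "zero M = ?B" by (simp add: M_def reduced_homology_def quotient_module_def)
    show "add M (coset ?B z) (coset ?B z') = coset ?B (z + z')" for z z'
    proof -
      have "add M = set_add (cycle_module 1 (top_of_set V))"
        by (simp add: M_def reduced_homology_def quotient_module_def)
      moreover have "set_add (cycle_module 1 (top_of_set V)) S T = {x + y |x y. x \<in> S \<and> y \<in> T}"
        for S T :: "(real ^ 2, 'k) field_chain set"
        by (auto simp: set_add_def set_mult_def cycle_module_def)
      ultimately show ?thesis using coset_add[OF subspace_boundaries] by simp
    qed
    show "smult M a (coset ?B z) = coset ?B (chain_scale a z)" for a z
    proof -
      have "smult M a S = (\<Union>s\<in>S. ?B +>\<^bsub>cycle_module 1 (top_of_set V)\<^esub>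
          (a \<odot>\<^bsub>cycle_module 1 (top_of_set V)\<^esub> s))" for S
        by (simp add: M_def reduced_homology_def quotient_module_def)
      moreover have "a \<odot>\<^bsub>cycle_module 1 (top_of_set V)\<^esub> s = chain_scale a s" for s :: "(real ^ 2, 'k) field_chain"
        by (simp add: cycle_module_def)
      ultimately have "smult M a S = (\<Union>s\<in>S. coset ?B (chain_scale a s))" for S
        by (simp only: rc)
      then show ?thesis using coset_scale[OF subspace_boundaries] by simp
    qed
  qed (use subspace_reduced_cycles subspace_boundaries finI ker dual in \<open>auto simp: wind_simps\<close>)
  then show ?thesis unfolding inclusion_rank_def M_def .
qed

text \<open>Alexander duality. Each persistent component gets a marked point of height at least
  \<open>t\<close>. Winding numbers around these points are the functionals, and cycles that enclose
  a single marked point are the dual vectors.\<close>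

lemma inclusion_rank_neighbourhood:
  fixes X :: "(real ^ 2) set" and K :: "'k::field itself"
  assumes X: "finite X" "X \<noteq> {}" and st: "0 < s" "s \<le> t"
  shows "inclusion_rank K 1 (top_of_set (neighbourhood s X)) (top_of_set (neighbourhood t X)) =
    card (persistent_components X s t)"
proof -
  define Ks Kt where "Ks = superlevel X s" "Kt = superlevel X t"
  note Kd = this
  define I where "I = persistent_components X s t"
  have fin: "finite I" unfolding I_def by (rule finite_persistent_components[OF X st])
  have I: "C \<in> components Ks" "bounded C" "C \<inter> Kt \<noteq> {}" if "C \<in> I" for C
    using that by (auto simp: I_def persistent_components_def Kd)
  have clK: "closed Ks" "closed Kt" by (simp_all add: Kd closed_superlevel)
  define q where "q C = (SOME x. x \<in> C \<inter> Kt)" for C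
  have q: "q C \<in> C" "q C \<in> Kt" if "C \<in> I" for C
    using someI_ex[of "\<lambda>x. x \<in> C \<inter> Kt"] I(3)[OF that] by (auto simp: q_def)
  have U: "neighbourhood s X = - Ks" "neighbourhood t X = - Kt"
    using neighbourhood_eq_superlevel[OF X(2)] by (simp_all add: Kd)
  have sub: "Kt \<subseteq> Ks" using superlevel_mono[OF st(2)] by (simp add: Kd)
  have disj: "q C' \<notin> C" if "C \<in> I" "C' \<in> I" "C \<noteq> C'" for C C'
    using components_nonoverlap[OF I(1)[OF that(1)] I(1)[OF that(2)]] q(1)[OF that(2)] that(3) by blast
  have "\<exists>c :: (real ^ 2, 'k) field_chain. c \<in> reduced_cycles 1 (top_of_set (- Ks)) \<and>
      (\<forall>C'\<in>I. wind (q C') c = (if C = C' then 1 else 0))" if C: "C \<in> I" for C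
  proof -
    have "closed C" using closed_components[OF clK(1) I(1)[OF C]] .
    then have cC: "compact C" using I(2)[OF C] compact_eq_bounded_closed by blast
    have "open (- (q ` (I - {C})))" using fin by (intro open_Compl finite_imp_closed) simp
    moreover have "C \<subseteq> - (q ` (I - {C}))" using disj C by blast
    \<comment> \<open>\<open>C\<close> is enclosed together with a relatively clopen piece
      \<open>A\<close>, which may contain more than \<open>C\<close> but no other marked
      point.\<close>
    ultimately obtain A where A: "openin (top_of_set Ks) A" "compact A" "C \<subseteq> A" "A \<subseteq> - (q ` (I - {C}))"
      using Sura_Bura_clopen_subset[OF closed_imp_locally_compact[OF clK(1)] I(1)[OF C] cC] by metis
    have "closedin (top_of_set Ks) (Ks - A)" using A(1) by auto
    then have "closed (Ks - A)" using clK(1) closedin_closed_trans by blast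
    moreover have "A \<inter> (Ks - A) = {}" by blast
    ultimately obtain c :: "(real ^ 2, 'k) field_chain" where c:
      "c \<in> reduced_cycles 1 (top_of_set (- (A \<union> (Ks - A))))" "\<And>x. x \<in> A \<Longrightarrow> wind x c = 1"
      "\<And>x. x \<in> Ks - A \<Longrightarrow> wind x c = 0"
      using separating_cycle[OF A(2)] by blast
    have "A \<subseteq> Ks" using openin_imp_subset[OF A(1)] .
    then have "A \<union> (Ks - A) = Ks" by blast
    then have cz: "c \<in> reduced_cycles 1 (top_of_set (- Ks))" using c(1) by (simp only:)
    have "wind (q C') c = (if C = C' then 1 else 0)" if C': "C' \<in> I" for C'
    proof (cases "C = C'")
      case True
      then show ?thesis using c(2) A(3) q(1)[OF C] by auto
    next
      case False
      then have "q C' \<notin> A" using A(4) C' by blast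
      then show ?thesis using c(3) False q(2)[OF C'] sub by auto
    qed
    then show ?thesis using cz by blast
  qed
  then obtain e where e: "\<And>C. C \<in> I \<Longrightarrow> e C \<in> (reduced_cycles 1 (top_of_set (- Ks)) :: (real ^ 2, 'k) field_chain set) \<and>
      (\<forall>C'\<in>I. wind (q C') (e C) = (if C = C' then 1 else 0))" by metis
  obtain R where R: "\<And>x. x \<in> X \<Longrightarrow> norm x \<le> R"
    using finite_imp_bounded[OF X(1)] unfolding bounded_iff by blast
  have out: "- Ks \<subseteq> cball 0 (R + s)"
  proof
    fix y assume "y \<in> - Ks"
    then have "infdist y X < s" by (simp add: Kd superlevel_def)
    moreover obtain x where x: "x \<in> X" "infdist y X = dist y x" using infdist_finite_attained[OF X] by blast
    moreover have "norm y \<le> norm x + dist y x" by (metis dist_norm norm_triangle_sub)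
    ultimately show "y \<in> cball 0 (R + s)" using R[OF x(1)] by simp
  qed
  have "inclusion_rank K 1 (top_of_set (- Ks)) (top_of_set (- Kt)) = card I"
  proof (rule inclusion_rank_eq[OF _ fin, of _ _ q e])
    show "- Ks \<subseteq> - Kt" using sub by blast
    fix z :: "(real ^ 2, 'k) field_chain"
    assume z: "z \<in> reduced_cycles 1 (top_of_set (- Ks))"
    show "z \<in> boundaries 1 (top_of_set (- Kt)) \<longleftrightarrow> (\<forall>C\<in>I. wind (q C) z = 0)"
    proof
      assume "z \<in> boundaries 1 (top_of_set (- Kt))"
      then show "\<forall>C\<in>I. wind (q C) z = 0" using wind_boundary q(2) by blast
    next
      assume w: "\<forall>C\<in>I. wind (q C) z = 0"
      show "z \<in> boundaries 1 (top_of_set (- Kt))"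
      proof (rule cycle_boundary_if_wind_zero)
        show "z \<in> reduced_cycles 1 (top_of_set (- Kt))"
          using z reduced_cycles_mono[of "- Ks" "- Kt" 1] sub by blast
        show "open (- Kt)" by (rule open_Compl[OF clK(2)])
        fix x assume "x \<notin> - Kt"
        then have x: "x \<in> Kt" "x \<in> Ks" using sub by auto
        define C where "C = connected_component_set Ks x"
        have C: "C \<in> components Ks" "x \<in> C" using x(2) by (auto simp: C_def components_def)
        have "z \<in> reduced_cycles 1 (top_of_set (- C))"
          using z reduced_cycles_mono[of "- Ks" "- C" 1] in_components_subset[OF C(1)] by blast
        note const = wind_connected[OF this in_components_connected[OF C(1)] C(2)]
        \<comment> \<open>The winding number is constant on the component of \<open>x\<close>. A
          bounded component has a marked point, and an unbounded one leaves the disc that contains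
          \<open>z\<close>.\<close>
        show "wind x z = 0"
        proof (cases "bounded C")
          case True
          then have "C \<in> I" using C x by (auto simp: I_def persistent_components_def Kd)
          then show ?thesis using const[OF q(1)] w by simp
        next
          case False
          then obtain y where "y \<in> C" "y \<notin> cball 0 (R + s)" using bounded_subset[OF bounded_cball] by blast
          then show ?thesis
            using const[of y] wind_outside_convex[OF z out convex_cball] by simp
        qed
      qed
    qed
  qed (use e in auto)
  then show ?thesis by (simp add: U I_def)
qed

subsection \<open>The persistence multiset\<close>

lemma size_filter_mset_sum:
  "real (size (filter_mset P D)) = (\<Sum>x\<in>#D. if P x then 1 else 0)"
  by (induction D) auto

lemma sum_mset_diff_real: "(\<Sum>x\<in>#D. f x - g x) = (\<Sum>x\<in>#D. f x) - (\<Sum>x\<in>#D. g x :: real)"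
  by (induction D) auto

lemma real_count_sum: "real (count D y) = (\<Sum>x\<in>#D. if x = y then 1 else 0)"
  by (induction D) auto

lemma finite_gap_above:
  assumes "finite (A :: real set)"
  obtains e where "e > 0" "\<And>x. x \<in> A \<Longrightarrow> a < x \<Longrightarrow> a + e \<le> x"
proof (cases "{x \<in> A. a < x} = {}")
  case False
  define m where "m = Min {x \<in> A. a < x}"
  have "m \<in> {x \<in> A. a < x}" unfolding m_def using assms False by (intro Min_in) auto
  moreover have "m \<le> x" if "x \<in> A" "a < x" for x
    unfolding m_def using assms that by (intro Min_le) auto
  ultimately show ?thesis by (intro that[of "m - a"]) auto
qed (use that[of 1] in auto)

text \<open>The multiplicity of \<open>(b, d)\<close> is recovered by inclusion and exclusion over
  the rectangle \<open>{b..<b + e} \<times> {d..<d + e}\<close>, with \<open>e\<close> so small that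
  no other end points interfere.\<close>

lemma persistence_multiset_unique:
  fixes D D' :: "(real \<times> real) multiset"
  assumes D: "\<And>b d. (b, d) \<in># D \<Longrightarrow> 0 \<le> b \<and> b < d" and D': "\<And>b d. (b, d) \<in># D' \<Longrightarrow> 0 \<le> b \<and> b < d"
    and eq: "\<And>s t. 0 < s \<Longrightarrow> s < t \<Longrightarrow>
      size {#(b, d) \<in># D. b < s \<and> t \<le> d#} = size {#(b, d) \<in># D'. b < s \<and> t \<le> d#}"
  shows "D = D'"
proof (rule multiset_eqI)
  fix y :: "real \<times> real"
  obtain b d where y: "y = (b, d)" by (cases y)
  show "count D y = count D' y"
  proof (cases "0 \<le> b \<and> b < d")
    case False
    then have "y \<notin># D" "y \<notin># D'" using D D' y by blast+
    then show ?thesis by (simp add: not_in_iff)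
  next
    case True
    obtain e1 where e1: "e1 > 0" "\<And>x. x \<in> fst ` (set_mset D \<union> set_mset D') \<Longrightarrow> b < x \<Longrightarrow> b + e1 \<le> x"
      by (rule finite_gap_above[of "fst ` (set_mset D \<union> set_mset D')" b]) auto
    obtain e2 where e2: "e2 > 0" "\<And>x. x \<in> snd ` (set_mset D \<union> set_mset D') \<Longrightarrow> d < x \<Longrightarrow> d + e2 \<le> x"
      by (rule finite_gap_above[of "snd ` (set_mset D \<union> set_mset D')" d]) auto
    \<comment> \<open>The last bound keeps \<open>b + e < d\<close>, so that every rank in use has
      \<open>s < t\<close>.\<close>
    define e where "e = min (min e1 e2) ((d - b) / 2)"
    have e: "e > 0" "e \<le> e1" "e \<le> e2" using e1(1) e2(1) True by (auto simp: e_def)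
    have "e \<le> (d - b) / 2" unfolding e_def by (rule min.cobounded2)
    then have bed: "b + e < d" using True by (simp add: field_simps)
    define c where "c M s t = (\<Sum>x\<in>#M. if fst x < s \<and> t \<le> snd x then 1 else 0 :: real)"
      for M :: "(real \<times> real) multiset" and s t
    have c: "c D s t = c D' s t" if "0 < s" "s < t" for s t
      using eq[OF that] size_filter_mset_sum[of "\<lambda>x. fst x < s \<and> t \<le> snd x" D]
        size_filter_mset_sum[of "\<lambda>x. fst x < s \<and> t \<le> snd x" D']
      by (simp add: c_def case_prod_unfold)
    \<comment> \<open>Ranks are only given for positive \<open>s\<close>. At \<open>b = 0\<close>
      the count is zero, since no interval starts below \<open>0\<close>.\<close>
    have cb: "c D b t = c D' b t" if "b < t" for t
    proof (cases "b = 0")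
      case True
      have "c M 0 t = 0" if "\<And>b d. (b, d) \<in># M \<Longrightarrow> 0 \<le> b" for M
        unfolding c_def using that by (intro sum_mset.neutral) force
      then show ?thesis using True D D' by metis
    qed (use c[of b t] True that in auto)
    have "real (count M y) = c M (b + e) d - c M b d - (c M (b + e) (d + e) - c M b (d + e))"
      if M: "set_mset M \<subseteq> set_mset D \<union> set_mset D'" for M
      unfolding c_def sum_mset_diff_real[symmetric] real_count_sum
    proof (intro arg_cong[of _ _ sum_mset] image_mset_cong)
      fix x assume "x \<in># M"
      then have "x \<in> set_mset D \<union> set_mset D'" using M by blast
      then have "b < fst x \<longrightarrow> b + e \<le> fst x" "d < snd x \<longrightarrow> d + e \<le> snd x"
        using e1(2)[of "fst x"] e2(2)[of "snd x"] e by force+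
      then show "(if x = y then 1 else 0 :: real) =
        (if fst x < b + e \<and> d \<le> snd x then 1 else 0) - (if fst x < b \<and> d \<le> snd x then 1 else 0) -
        ((if fst x < b + e \<and> d + e \<le> snd x then 1 else 0) - (if fst x < b \<and> d + e \<le> snd x then 1 else 0))"
        using e(1) by (cases x) (auto simp: y)
    qed
    from this[of D] this[of D'] have "real (count D y) = real (count D' y)"
      using c[of "b + e" d] c[of "b + e" "d + e"] cb[of d] cb[of "d + e"] e(1) bed True by simp
    then show ?thesis by simp
  qed
qed

lemma is_persistence_multiset_bars:
  fixes K :: "'k::field itself"
  assumes "finite X" "X \<noteq> {}"
  shows "is_persistence_multiset K 1 X (bars X)"
  unfolding is_persistence_multiset_def
  using in_bars_bounds[OF assms(1)] inclusion_rank_neighbourhood[OF assms, of _ _ K]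
    card_persistent_components[OF assms] by auto

lemma PH_eq_bars:
  fixes K :: "'k::field itself" and X :: "(real ^ 2) set"
  assumes "finite X" "X \<noteq> {}"
  shows "PH K 1 X = bars X"
  unfolding PH_def
proof (rule the_equality)
  show *: "is_persistence_multiset K 1 X (bars X)" by (rule is_persistence_multiset_bars[OF assms])
  fix D assume D: "is_persistence_multiset K 1 X D"
  show "D = bars X"
  proof (rule persistence_multiset_unique)
    show "0 \<le> b \<and> b < d" if "(b, d) \<in># D" for b d
      using D that unfolding is_persistence_multiset_def by blast
    show "0 \<le> b \<and> b < d" if "(b, d) \<in># bars X" for b d
      by (rule in_bars_bounds[OF assms(1) that])
    show "size {#(b, d) \<in># D. b < s \<and> t \<le> d#} = size {#(b, d) \<in># bars X. b < s \<and> t \<le> d#}"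
      if "0 < s" "s < t" for s t
    proof -
      let ?r = "inclusion_rank K 1 (top_of_set (neighbourhood s X)) (top_of_set (neighbourhood t X))"
      have "?r = size {#(b, d) \<in># D. b < s \<and> t \<le> d#}"
        using D that unfolding is_persistence_multiset_def by blast
      moreover have "?r = size {#(b, d) \<in># bars X. b < s \<and> t \<le> d#}"
        using * that unfolding is_persistence_multiset_def by blast
      ultimately show ?thesis by (rule trans[OF sym])
    qed
  qed
qed

definition active_peaks :: "(real ^ 2) set \<Rightarrow> (real ^ 2) set" where
  "active_peaks X = {p \<in> peaks X. merge_level X p < infdist p X}"

lemma finite_active_peaks: "finite X \<Longrightarrow> finite (active_peaks X)"
  using finite_peaks[of X] by (simp add: active_peaks_def)

lemma E_sum_eq_bars:
  fixes K :: "'k::field itself" and X :: "(real ^ 2) set"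
  assumes "finite X" "X \<noteq> {}"
  shows "E_sum K 1 \<alpha> X = (\<Sum>(b, d)\<in>#bars X. (d - b) powr \<alpha>)"
  unfolding E_sum_def PH_eq_bars[OF assms] ..

lemma E_sum_eq_peaks:
  fixes K :: "'k::field itself" and X :: "(real ^ 2) set"
  assumes "finite X" "X \<noteq> {}"
  shows "E_sum K 1 \<alpha> X = (\<Sum>p\<in>active_peaks X. (infdist p X - merge_level X p) powr \<alpha>)"
proof -
  have "(\<Sum>(b, d)\<in>#bars X. (d - b) powr \<alpha>) = (\<Sum>p\<in>active_peaks X. (infdist p X - merge_level X p) powr \<alpha>)"
    by (simp add: bars_def active_peaks_def[symmetric] image_mset.compositionality o_def sum_unfold_sum_mset)
  then show ?thesis using E_sum_eq_bars[OF assms, of K \<alpha>] by simp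
qed

lemma card_persistent_components_eq_peaks:
  assumes "finite X" "X \<noteq> {}" "0 < s" "s \<le> t"
  shows "card (persistent_components X s t) =
    card {p \<in> active_peaks X. merge_level X p < s \<and> t \<le> infdist p X}"
proof -
  have "{p \<in> active_peaks X. merge_level X p < s \<and> t \<le> infdist p X} =
      {p \<in> peaks X. merge_level X p < s \<and> t \<le> infdist p X}"
    using assms(4) by (auto simp: active_peaks_def)
  then show ?thesis using bij_betw_same_card[OF persistent_components_bij[OF assms]] by simp
qed

text \<open>Each persistent component is represented by a peak whose interval reaches from below
  \<open>s\<close> up to at least \<open>t\<close>.\<close>

lemma E_sum_ge:
  fixes K :: "'k::field itself" and X :: "(real ^ 2) set"
  assumes X: "finite X" "X \<noteq> {}" and st: "0 < s" "s \<le> t" and \<alpha>: "0 < \<alpha>"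
  shows "real (card (persistent_components X s t)) * (t - s) powr \<alpha> \<le> E_sum K 1 \<alpha> X"
proof -
  let ?S = "{p \<in> active_peaks X. merge_level X p < s \<and> t \<le> infdist p X}"
  have "real (card (persistent_components X s t)) * (t - s) powr \<alpha> = (\<Sum>p\<in>?S. (t - s) powr \<alpha>)"
    using card_persistent_components_eq_peaks[OF X st] by simp
  also have "\<dots> \<le> (\<Sum>p\<in>?S. (infdist p X - merge_level X p) powr \<alpha>)"
    using st \<alpha> by (intro sum_mono powr_mono2) auto
  also have "\<dots> \<le> (\<Sum>p\<in>active_peaks X. (infdist p X - merge_level X p) powr \<alpha>)"
    using finite_active_peaks[OF X(1)] by (intro sum_mono2) auto
  finally show ?thesis using E_sum_eq_peaks[OF X, of K \<alpha>] by simp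
qed

subsection \<open>Deterministic upper bounds\<close>

lemma E_sum_upper:
  fixes K :: "'k::field itself" and X :: "(real ^ 2) set"
  assumes X: "finite X" "X \<noteq> {}" "X \<subseteq> cball 0 R" and \<alpha>: "0 < \<alpha>" "\<alpha> < 2" and n: "card X \<le> n" "0 < n"
  shows "real n powr (- ((2 - \<alpha>) / 2)) * E_sum K 1 \<alpha> X \<le>
    (100 * R\<^sup>2) powr (\<alpha> / 2) * (2 powr (1 - \<alpha> / 2) / (1 - \<alpha> / 2))"
proof -
  let ?C = "(100 * R\<^sup>2) powr (\<alpha> / 2)"
  have "E_sum K 1 \<alpha> X \<le> ?C * (\<Sum>k=1..2 * n. (1 / real k) powr (\<alpha> / 2))"
    using sum_bars_le[OF X \<alpha>(1) n(1)] E_sum_eq_bars[OF X(1,2), of K \<alpha>] by simp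
  also have "\<dots> \<le> ?C * (real (2 * n) powr (1 - \<alpha> / 2) / (1 - \<alpha> / 2))"
    using \<alpha> by (intro mult_left_mono sum_inverse_powr_le) auto
  also have "real (2 * n) powr (1 - \<alpha> / 2) = 2 powr (1 - \<alpha> / 2) * real n powr (1 - \<alpha> / 2)"
    by (simp add: powr_mult)
  finally have "real n powr (- ((2 - \<alpha>) / 2)) * E_sum K 1 \<alpha> X \<le>
      real n powr (- ((2 - \<alpha>) / 2)) * (?C * (2 powr (1 - \<alpha> / 2) * real n powr (1 - \<alpha> / 2) / (1 - \<alpha> / 2)))"
    by (intro mult_left_mono) auto
  also have "\<dots> = ?C * (2 powr (1 - \<alpha> / 2) / (1 - \<alpha> / 2)) *
      (real n powr (- ((2 - \<alpha>) / 2)) * real n powr (1 - \<alpha> / 2))" by (simp add: field_simps)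
  also have "real n powr (- ((2 - \<alpha>) / 2)) * real n powr (1 - \<alpha> / 2) = 1"
    using n(2) by (simp add: powr_add[symmetric] diff_divide_distrib)
  finally show ?thesis by simp
qed

lemma sum_inverse_le_ln:
  assumes "0 < m"
  shows "(\<Sum>k=1..m. 1 / real k) \<le> 1 + ln (real m)"
  using assms
proof (induction m rule: nat_induct_non_zero)
  case (Suc m)
  have "1 - real m / real (Suc m) \<le> - ln (real m / real (Suc m))"
    using Suc(1) ln_le_minus_one[of "real m / real (Suc m)"] by simp
  also have "- ln (real m / real (Suc m)) = ln (real (Suc m)) - ln (real m)"
    using Suc(1) by (simp add: ln_div)
  also have "1 - real m / real (Suc m) = 1 / real (Suc m)" by (simp add: field_simps)
  finally show ?case using Suc(2) by simp
qed simp

lemma E_sum_2_upper: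
  fixes K :: "'k::field itself" and X :: "(real ^ 2) set"
  assumes X: "finite X" "X \<noteq> {}" "X \<subseteq> cball 0 R" and n: "card X \<le> n" "3 \<le> n"
  shows "1 / ln (real n) * E_sum K 1 2 X \<le> 300 * R\<^sup>2"
proof -
  have e: "(100 * R\<^sup>2) powr (2 / 2) = 100 * R\<^sup>2" by simp
  have e2: "(\<Sum>k=1..2 * n. (1 / real k) powr (2 / 2)) = (\<Sum>k=1..2 * n. 1 / real k)" by simp
  have "E_sum K 1 2 X \<le> 100 * R\<^sup>2 * (\<Sum>k=1..2 * n. 1 / real k)"
    using sum_bars_le[OF X _ n(1), of 2] E_sum_eq_bars[OF X(1,2), of K 2] unfolding e e2 by simp
  also have "\<dots> \<le> 100 * R\<^sup>2 * (1 + ln (real (2 * n)))"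
    by (rule mult_left_mono[OF sum_inverse_le_ln]) (use n in auto)
  also have "\<dots> \<le> 100 * R\<^sup>2 * (3 * ln (real n))"
  proof (rule mult_left_mono)
    \<comment> \<open>\<open>3 \<le> n\<close> gives \<open>1 \<le> ln n\<close> and thus
      \<open>1 + ln (2 * n) \<le> 3 * ln n\<close>; this is the factor in
      \<open>300 = 3 * 100\<close>.\<close>
    have "exp 1 \<le> real n" using exp_le n(2) by linarith
    then have "1 \<le> ln (real n)" using n(2) ln_ge_iff[of "real n" 1] by simp
    moreover have "ln (real (2 * n)) = ln 2 + ln (real n)" using n by (simp add: ln_mult)
    moreover have "ln 2 \<le> (1 :: real)" using ln_2_less_1 by simp
    ultimately show "1 + ln (real (2 * n)) \<le> 3 * ln (real n)" by linarith
  qed simp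
  finally have "E_sum K 1 2 X \<le> 300 * R\<^sup>2 * ln (real n)" by simp
  moreover have "ln (real n) > 0" using n(2) by simp
  ultimately show ?thesis by (simp add: pos_divide_le_eq)
qed

subsection \<open>Measurability\<close>

text \<open>
  The interval counts \<open>alive\<close> are lower semicontinuous in the points, because the rank function is
  stable, and \<open>E_sum\<close> is a limit of linear combinations of them.
\<close>

definition alive :: "(real ^ 2) set \<Rightarrow> real \<Rightarrow> real \<Rightarrow> nat" where
  "alive X s t = card {p \<in> active_peaks X. merge_level X p < s \<and> t < infdist p X}"

text \<open>The strict inequalities leave a common margin \<open>m = 4 * \<eta>\<close>. Of the
  slack \<open>2 * \<eta>\<close> that is used, one \<open>\<eta>\<close> pays for stability and the
  other restores the strict inequality for \<open>Y\<close>.\<close>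

lemma alive_lower_semicontinuous:
  assumes X: "finite X" "X \<noteq> {}" and st: "0 < s" "s \<le> t"
  obtains \<eta> where "\<eta> > 0" "\<And>Y. finite Y \<Longrightarrow> Y \<noteq> {} \<Longrightarrow> (\<And>x. \<bar>infdist x X - infdist x Y\<bar> \<le> \<eta>) \<Longrightarrow>
    alive X s t \<le> alive Y s t"
proof -
  define S where "S = {p \<in> active_peaks X. merge_level X p < s \<and> t < infdist p X}"
  have fS: "finite S" using finite_active_peaks[OF X(1)] by (simp add: S_def)
  define m where "m = Min (insert s ((\<lambda>p. min (s - merge_level X p) (infdist p X - t)) ` S))"
  have "m > 0" unfolding m_def using fS st by (subst Min_gr_iff) (auto simp: S_def)
  have m: "m \<le> s" "\<And>p. p \<in> S \<Longrightarrow> m \<le> min (s - merge_level X p) (infdist p X - t)"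
    unfolding m_def using fS by (auto intro!: Min_le simp del: min_less_iff_conj min.bounded_iff)
  define \<eta> where "\<eta> = m / 4"
  have \<eta>: "\<eta> > 0" "2 * \<eta> < s" "\<And>p. p \<in> S \<Longrightarrow> merge_level X p < s - 2 * \<eta> \<and> t + 2 * \<eta> \<le> infdist p X"
    using \<open>m > 0\<close> m by (force simp: \<eta>_def)+
  show ?thesis
  proof (rule that[OF \<eta>(1)])
    fix Y assume Y: "finite Y" "Y \<noteq> {}" and close: "\<And>x. \<bar>infdist x X - infdist x Y\<bar> \<le> \<eta>"
    have "alive X s t \<le> card {p \<in> active_peaks X. merge_level X p < s - 2 * \<eta> \<and> t + 2 * \<eta> \<le> infdist p X}"
      unfolding alive_def S_def[symmetric] using \<eta>(3) finite_active_peaks[OF X(1)]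
      by (intro card_mono) (auto simp: S_def)
    also have "\<dots> = card (persistent_components X (s - 2 * \<eta>) (t + 2 * \<eta>))"
      using \<eta> st by (intro card_persistent_components_eq_peaks[OF X, symmetric]) auto
    also have "\<dots> \<le> card (persistent_components Y (s - \<eta>) (t + \<eta>))"
    proof -
      have e: "s - \<eta> - \<eta> = s - 2 * \<eta>" "t + \<eta> + \<eta> = t + 2 * \<eta>" by simp_all
      have "0 < s - \<eta>" "s - \<eta> \<le> t + \<eta>" using \<eta>(1,2) st by linarith+
      from card_persistent_components_le[OF Y close this] show ?thesis unfolding e .
    qed
    also have "\<dots> = card {p \<in> active_peaks Y. merge_level Y p < s - \<eta> \<and> t + \<eta> \<le> infdist p Y}"
      using \<eta> st by (intro card_persistent_components_eq_peaks[OF Y]) auto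
    also have "\<dots> \<le> alive Y s t"
      unfolding alive_def using finite_active_peaks[OF Y(1)] \<eta>(1) by (intro card_mono) auto
    finally show "alive X s t \<le> alive Y s t" .
  qed
qed

lemma open_alive_greater:
  assumes J: "finite J" "J \<noteq> {}" and st: "0 < s" "s \<le> t"
  shows "open {y :: nat \<Rightarrow> real ^ 2. a < real (alive (y ` J) s t)}"
proof (subst open_subopen, intro ballI)
  fix y :: "nat \<Rightarrow> real ^ 2" assume y: "y \<in> {y. a < real (alive (y ` J) s t)}"
  have X: "finite (y ` J)" "y ` J \<noteq> {}" using J by auto
  obtain \<eta> where \<eta>: "\<eta> > 0" "\<And>Y. finite Y \<Longrightarrow> Y \<noteq> {} \<Longrightarrow>
      (\<And>x. \<bar>infdist x (y ` J) - infdist x Y\<bar> \<le> \<eta>) \<Longrightarrow> alive (y ` J) s t \<le> alive Y s t"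
    by (rule alive_lower_semicontinuous[OF X st]) blast
  \<comment> \<open>Only the finitely many coordinates in \<open>J\<close> are constrained, so
    \<open>T\<close> is open in the product topology.\<close>
  define T where "T = (\<Inter>j\<in>J. (\<lambda>z :: nat \<Rightarrow> real ^ 2. z j) -` ball (y j) \<eta>)"
  have "open T"
    unfolding T_def using J(1) by (intro open_INT ballI open_vimage open_ball) auto
  moreover have "y \<in> T" using \<eta>(1) by (simp add: T_def)
  moreover have "T \<subseteq> {y. a < real (alive (y ` J) s t)}"
  proof
    fix z assume z: "z \<in> T"
    have "\<bar>infdist x (y ` J) - infdist x (z ` J)\<bar> \<le> \<eta>" for x
      by (rule infdist_image_close[OF J]) (use z in \<open>auto simp: T_def intro: less_imp_le\<close>)
    then have "alive (y ` J) s t \<le> alive (z ` J) s t" using J by (intro \<eta>(2)) auto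
    then show "z \<in> {y. a < real (alive (y ` J) s t)}" using y by simp
  qed
  ultimately show "\<exists>T. open T \<and> y \<in> T \<and> T \<subseteq> {y. a < real (alive (y ` J) s t)}" by blast
qed

lemma measurable_alive:
  fixes x :: "nat \<Rightarrow> 'w \<Rightarrow> real ^ 2"
  assumes J: "finite J" "J \<noteq> {}" and st: "s \<le> t" and x: "\<And>j. x j \<in> borel_measurable P"
  shows "(\<lambda>\<omega>. real (alive ((\<lambda>j. x j \<omega>) ` J) s t)) \<in> borel_measurable P"
proof (cases "0 < s")
  case True
  have "(\<lambda>y :: nat \<Rightarrow> real ^ 2. real (alive (y ` J) s t)) \<in> borel_measurable borel"
    unfolding borel_measurable_iff_greater using open_alive_greater[OF J True st] by simp
  moreover have "(\<lambda>\<omega> j. x j \<omega>) \<in> measurable P borel"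
    by (rule measurable_coordinatewise_then_product) (rule x)
  ultimately show ?thesis by (rule measurable_compose[rotated])
next
  case False
  \<comment> \<open>The first column of the grid asks for \<open>s = 0\<close>, where nothing is
    alive.\<close>
  then have "\<not> merge_level X p < s" for X p using merge_level_nonneg[of X p] by linarith
  then show ?thesis by (simp add: alive_def)
qed

text \<open>The value at the lower corner of a cell in the birth-death plane. Cells with
  \<open>i \<ge> j\<close> get weight zero, so that \<open>alive\<close> is only needed for
  \<open>s \<le> t\<close>.\<close>

definition cell_weight :: "real \<Rightarrow> nat \<Rightarrow> nat \<Rightarrow> nat \<Rightarrow> real" where
  "cell_weight \<alpha> N i j = (if i < j then ((real j - real i) / real N) powr \<alpha> else 0)"

text \<open>The half-open conditions on \<open>b\<close> and \<open>d\<close> are those that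
  differences of the counts \<open>b < s \<and> t < d\<close> produce. With \<open>N * N\<close>
  intervals of width \<open>1 / N\<close> on each axis the grid exhausts the quadrant as
  \<open>N\<close> grows.\<close>

definition grid_weight :: "real \<Rightarrow> nat \<Rightarrow> real \<Rightarrow> real \<Rightarrow> real" where
  "grid_weight \<alpha> N b d = (\<Sum>i<N * N. \<Sum>j<N * N. cell_weight \<alpha> N i j *
     (if real i / real N \<le> b \<and> b < (real i + 1) / real N \<and> real j / real N < d \<and> d \<le> (real j + 1) / real N
      then 1 else 0))"

lemma grid_weight_eq:
  assumes N: "0 < N" and bd: "0 \<le> b" "0 < d"
  defines "i0 \<equiv> nat \<lfloor>b * real N\<rfloor>" and "j0 \<equiv> nat (\<lceil>d * real N\<rceil> - 1)"
  shows "grid_weight \<alpha> N b d = (if i0 < N * N \<and> j0 < N * N then cell_weight \<alpha> N i0 j0 else 0)"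
proof -
  have i: "real i / real N \<le> b \<and> b < (real i + 1) / real N \<longleftrightarrow> i = i0" for i
  proof -
    have "real i / real N \<le> b \<and> b < (real i + 1) / real N \<longleftrightarrow> real i \<le> b * real N \<and> b * real N < real i + 1"
      using N by (simp add: pos_divide_le_eq pos_less_divide_eq)
    also have "\<dots> \<longleftrightarrow> \<lfloor>b * real N\<rfloor> = int i" by (simp add: floor_eq_iff)
    also have "\<dots> \<longleftrightarrow> i = i0" unfolding i0_def using bd by (auto simp: nat_eq_iff)
    finally show ?thesis .
  qed
  have j: "real j / real N < d \<and> d \<le> (real j + 1) / real N \<longleftrightarrow> j = j0" for j
  proof -
    have "real j / real N < d \<and> d \<le> (real j + 1) / real N \<longleftrightarrow> real j < d * real N \<and> d * real N \<le> real j + 1"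
      using N by (simp add: pos_le_divide_eq pos_divide_less_eq)
    also have "\<dots> \<longleftrightarrow> \<lceil>d * real N\<rceil> = int j + 1" by (simp add: ceiling_eq_iff)
    also have "\<dots> \<longleftrightarrow> j = j0"
    proof -
      have "0 < d * real N" using N bd by simp
      then have "\<lceil>d * real N\<rceil> \<ge> 1" by linarith
      then show ?thesis unfolding j0_def by linarith
    qed
    finally show ?thesis .
  qed
  have "grid_weight \<alpha> N b d = (\<Sum>i<N * N. \<Sum>j<N * N. if j = j0 then (if i = i0 then cell_weight \<alpha> N i j else 0) else 0)"
    unfolding grid_weight_def using i j by (intro sum.cong refl) auto
  also have "\<dots> = (\<Sum>i<N * N. if i = i0 then (if j0 < N * N then cell_weight \<alpha> N i j0 else 0) else 0)"
    by (intro sum.cong refl) (simp add: sum.delta)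
  also have "\<dots> = (if i0 < N * N \<and> j0 < N * N then cell_weight \<alpha> N i0 j0 else 0)"
    by (simp add: sum.delta)
  finally show ?thesis .
qed

lemma grid_weight_tendsto:
  assumes bd: "0 \<le> b" "b < d"
  shows "(\<lambda>N. grid_weight \<alpha> N b d) \<longlonglongrightarrow> (d - b) powr \<alpha>"
proof -
  define i0 where "i0 N = nat \<lfloor>b * real N\<rfloor>" for N :: nat
  define j0 where "j0 N = nat (\<lceil>d * real N\<rceil> - 1)" for N :: nat
  define u where "u N = (real (j0 N) - real (i0 N)) / real N" for N :: nat
  have d0: "d > 0" using bd by simp
  have ri: "real (i0 N) \<le> b * real N" "b * real N \<le> real (i0 N) + 1" for N
  proof -
    have "0 \<le> \<lfloor>b * real N\<rfloor>" using bd by simp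
    then show "real (i0 N) \<le> b * real N" "b * real N \<le> real (i0 N) + 1"
      unfolding i0_def by (simp_all add: of_nat_nat)
  qed
  have rj: "real (j0 N) \<le> d * real N" "d * real N \<le> real (j0 N) + 1" if "0 < N" for N
  proof -
    have "0 < d * real N" using that d0 by simp
    then have "0 \<le> \<lceil>d * real N\<rceil> - 1" by linarith
    then have "real (j0 N) = of_int \<lceil>d * real N\<rceil> - 1" unfolding j0_def by (simp add: of_nat_nat)
    then show "real (j0 N) \<le> d * real N" "d * real N \<le> real (j0 N) + 1" by linarith+
  qed
  have close: "\<bar>u N - (d - b)\<bar> \<le> 1 / real N" if N: "0 < N" for N
  proof -
    have "\<bar>(real (j0 N) - real (i0 N)) - (d - b) * real N\<bar> \<le> 1"
      using ri[of N] rj[OF N] by (simp add: left_diff_distrib abs_le_iff)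
    moreover have "u N - (d - b) = ((real (j0 N) - real (i0 N)) - (d - b) * real N) / real N"
      using N by (simp add: u_def diff_divide_distrib)
    ultimately show ?thesis using N by (simp add: abs_divide divide_right_mono)
  qed
  have "u \<longlonglongrightarrow> d - b"
  proof (rule LIM_zero_cancel, rule Lim_null_comparison)
    show "\<forall>\<^sub>F N in sequentially. norm (u N - (d - b)) \<le> 1 / real N"
      using eventually_gt_at_top[of 0] by eventually_elim (use close in simp)
    show "(\<lambda>N. 1 / real N) \<longlonglongrightarrow> 0" by (rule lim_1_over_n)
  qed
  then have "(\<lambda>N. u N powr \<alpha>) \<longlonglongrightarrow> (d - b) powr \<alpha>"
    using bd by (intro tendsto_powr tendsto_const) auto
  moreover have "\<forall>\<^sub>F N in sequentially. u N powr \<alpha> = grid_weight \<alpha> N b d"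
  proof -
    \<comment> \<open>From there on \<open>d < N\<close> puts the point inside the grid, and
      \<open>1 / N < d - b\<close> gives its cell \<open>i < j\<close>.\<close>
    obtain N1 :: nat where N1: "d + 1 / (d - b) + 1 < real N1" using reals_Archimedean2 by blast
    show ?thesis
      using eventually_ge_at_top[of N1]
    proof eventually_elim
      case (elim N)
      have p: "0 < 1 / (d - b)" using bd by simp
      have N: "d + 1 / (d - b) + 1 < real N" using N1 elim by linarith
      then have N0: "0 < N" using p d0 by (cases N) auto
      have "d < real N" "1 / (d - b) < real N" using N p d0 by linarith+
      then have "1 < (d - b) * real N" using bd by (simp add: pos_divide_less_eq mult.commute)
      then have "real (i0 N) < real (j0 N)" using ri[of N] rj[OF N0] by (simp add: left_diff_distrib)
      then have lt: "i0 N < j0 N" by simp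
      have "real (j0 N) \<le> d * real N" using rj[OF N0] by simp
      also have "\<dots> < real N * real N" using \<open>d < real N\<close> N0 by simp
      finally have "j0 N < N * N" by (simp flip: of_nat_mult)
      then show ?case
        using lt grid_weight_eq[OF N0 bd(1) d0, of \<alpha>, folded i0_def j0_def]
        by (simp add: cell_weight_def u_def)
    qed
  qed
  ultimately show ?thesis by (rule Lim_transform_eventually)
qed

text \<open>The indicator of a cell is an alternating sum of the indicators of four quadrants, and
  summing a quadrant over the peaks gives \<open>alive\<close>.\<close>

lemma sum_grid_weight_alive:
  assumes X: "finite X"
  shows "(\<Sum>p\<in>active_peaks X. grid_weight \<alpha> N (merge_level X p) (infdist p X)) =
    (\<Sum>i<N * N. \<Sum>j<N * N. cell_weight \<alpha> N i j *
      (real (alive X ((real i + 1) / real N) (real j / real N)) - real (alive X (real i / real N) (real j / real N)) -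
       (real (alive X ((real i + 1) / real N) ((real j + 1) / real N)) -
        real (alive X (real i / real N) ((real j + 1) / real N)))))"
proof -
  let ?A = "active_peaks X" and ?b = "merge_level X" and ?d = "\<lambda>p. infdist p X"
  have a: "real (alive X s t) = (\<Sum>p\<in>?A. if ?b p < s \<and> t < ?d p then 1 else 0)" for s t
    using finite_active_peaks[OF X] by (simp add: alive_def sum.If_cases Int_def)
  have "(\<Sum>p\<in>?A. grid_weight \<alpha> N (?b p) (?d p)) = (\<Sum>i<N * N. \<Sum>j<N * N. \<Sum>p\<in>?A. cell_weight \<alpha> N i j *
     (if real i / real N \<le> ?b p \<and> ?b p < (real i + 1) / real N \<and> real j / real N < ?d p \<and> ?d p \<le> (real j + 1) / real N
      then 1 else 0))"
    unfolding grid_weight_def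
    by (subst sum.swap) (intro sum.cong refl sum.swap)
  also have "\<dots> = (\<Sum>i<N * N. \<Sum>j<N * N. cell_weight \<alpha> N i j *
      (real (alive X ((real i + 1) / real N) (real j / real N)) - real (alive X (real i / real N) (real j / real N)) -
       (real (alive X ((real i + 1) / real N) ((real j + 1) / real N)) -
        real (alive X (real i / real N) ((real j + 1) / real N)))))"
  proof (intro sum.cong refl)
    fix i j
    have m: "real i / real N \<le> (real i + 1) / real N" "real j / real N \<le> (real j + 1) / real N"
      by (simp_all add: divide_right_mono)
    have pt: "(if A \<le> b \<and> b < B \<and> C < d \<and> d \<le> E then 1 else 0 :: real) =
        (if b < B \<and> C < d then 1 else 0) - (if b < A \<and> C < d then 1 else 0) -
        ((if b < B \<and> E < d then 1 else 0) - (if b < A \<and> E < d then 1 else 0))"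
      if "A \<le> B" "C \<le> E" for A B C E b d :: real using that by auto
    show "(\<Sum>p\<in>?A. cell_weight \<alpha> N i j * (if real i / real N \<le> ?b p \<and> ?b p < (real i + 1) / real N \<and>
        real j / real N < ?d p \<and> ?d p \<le> (real j + 1) / real N then 1 else 0)) = cell_weight \<alpha> N i j *
      (real (alive X ((real i + 1) / real N) (real j / real N)) - real (alive X (real i / real N) (real j / real N)) -
       (real (alive X ((real i + 1) / real N) ((real j + 1) / real N)) -
        real (alive X (real i / real N) ((real j + 1) / real N))))"
      unfolding a sum_subtractf[symmetric] sum_distrib_left[symmetric] pt[OF m] ..
  qed
  finally show ?thesis .
qed

lemma measurable_E_sum:
  fixes K :: "'k::field itself" and x :: "nat \<Rightarrow> 'w \<Rightarrow> real ^ 2"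
  assumes J: "finite J" "J \<noteq> {}" and x: "\<And>j. x j \<in> borel_measurable P"
  shows "(\<lambda>\<omega>. E_sum K 1 \<alpha> ((\<lambda>j. x j \<omega>) ` J)) \<in> borel_measurable P"
proof (rule borel_measurable_LIMSEQ_real)
  let ?X = "\<lambda>\<omega>. (\<lambda>j. x j \<omega>) ` J"
  let ?G = "\<lambda>N \<omega>. \<Sum>p\<in>active_peaks (?X \<omega>). grid_weight \<alpha> N (merge_level (?X \<omega>) p) (infdist p (?X \<omega>))"
  have X: "finite (?X \<omega>)" "?X \<omega> \<noteq> {}" for \<omega> using J by auto
  show "(\<lambda>N. ?G N \<omega>) \<longlonglongrightarrow> E_sum K 1 \<alpha> (?X \<omega>)" for \<omega>
    unfolding E_sum_eq_peaks[OF X]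
    by (intro tendsto_sum grid_weight_tendsto merge_level_nonneg) (simp add: active_peaks_def)
  fix N
  have m: "(\<lambda>\<omega>. cell_weight \<alpha> N i j *
      (real (alive (?X \<omega>) ((real i + 1) / real N) (real j / real N)) - real (alive (?X \<omega>) (real i / real N) (real j / real N)) -
       (real (alive (?X \<omega>) ((real i + 1) / real N) ((real j + 1) / real N)) -
        real (alive (?X \<omega>) (real i / real N) ((real j + 1) / real N))))) \<in> borel_measurable P" for i j
  proof (cases "i < j")
    case True
    have le: "(real i + 1) / real N \<le> real j / real N" using True by (intro divide_right_mono) auto
    have le': "real i / real N \<le> real j / real N" "real j / real N \<le> (real j + 1) / real N"
      using True by (auto intro: divide_right_mono)
    show ?thesis
      by (intro borel_measurable_times borel_measurable_const borel_measurable_diff measurable_alive[OF J _ x])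
        (use le le' in linarith)+
  qed (simp add: cell_weight_def)
  show "?G N \<in> borel_measurable P"
    unfolding sum_grid_weight_alive[OF X(1)] by (intro borel_measurable_sum m)
qed

subsection \<open>Squares that a set of positive measure almost fills\<close>

text \<open>Half-open squares, which partition the plane; \<open>grid_square\<close> is the closed
  version.\<close>

definition cell :: "real \<Rightarrow> int \<times> int \<Rightarrow> (real ^ 2) set" where
  "cell h k = {x. grid_round h x = k}"

lemma cell_eq:
  assumes "h > 0"
  shows "cell h k = {x. h * of_int (fst k) \<le> x $ 1 \<and> x $ 1 < h * (of_int (fst k) + 1) \<and>
    h * of_int (snd k) \<le> x $ 2 \<and> x $ 2 < h * (of_int (snd k) + 1)}"
proof -
  have "\<lfloor>u / h\<rfloor> = i \<longleftrightarrow> h * of_int i \<le> u \<and> u < h * (of_int i + 1)" for u i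
    using assms by (simp add: floor_eq_iff pos_le_divide_eq pos_divide_less_eq mult.commute)
  then show ?thesis by (auto simp: cell_def grid_round_def prod_eq_iff)
qed

lemma cell_subset_grid_square: "h > 0 \<Longrightarrow> cell h k \<subseteq> grid_square h k"
  by (auto simp: cell_eq grid_square_def)

lemma cell_borel [measurable]:
  assumes "h > 0"
  shows "cell h k \<in> sets borel"
proof -
  have [measurable]: "(\<lambda>x :: real ^ 2. x $ i) \<in> borel_measurable borel" for i
    by (intro borel_measurable_continuous_onI continuous_intros)
  show ?thesis unfolding cell_eq[OF assms] by measurable
qed

lemma measure_cell:
  assumes h: "h > 0"
  shows "emeasure lborel (cell h k) = ennreal (h\<^sup>2)" "measure lborel (cell h k) = h\<^sup>2"
proof -
  let ?a = "grid_point h k" and ?b = "grid_point h (fst k + 1, snd k + 1)"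
  have sub: "box ?a ?b \<subseteq> cell h k" "cell h k \<subseteq> cbox ?a ?b"
    unfolding cell_eq[OF h] by (auto simp: mem_box_cart forall_2)
  have "?a \<in> cbox ?a ?b" using h by (auto simp: mem_box_cart forall_2)
  then have ne: "cbox ?a ?b \<noteq> {}" by blast
  have "measure lborel (cbox ?a ?b) = h\<^sup>2"
    unfolding content_cbox_cart[OF ne] by (simp add: UNIV_2 power2_eq_square algebra_simps)
  then have c: "emeasure lborel (cbox ?a ?b) = ennreal (h\<^sup>2)"
    using emeasure_eq_ennreal_measure[of lborel "cbox ?a ?b"] emeasure_lborel_cbox_finite[of ?a ?b] by simp
  have "emeasure lborel (box ?a ?b) = emeasure lborel (cbox ?a ?b)"
    unfolding emeasure_lborel_box_eq emeasure_lborel_cbox_eq ..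
  then have "ennreal (h\<^sup>2) \<le> emeasure lborel (cell h k)" "emeasure lborel (cell h k) \<le> ennreal (h\<^sup>2)"
    using emeasure_mono[OF sub(1), of lborel] emeasure_mono[OF sub(2), of lborel] c cell_borel[OF h] by simp_all
  then show "emeasure lborel (cell h k) = ennreal (h\<^sup>2)" by simp
  then show "measure lborel (cell h k) = h\<^sup>2" by (simp add: measure_def)
qed

lemma fmeasurable_cell: "h > 0 \<Longrightarrow> cell h k \<in> fmeasurable lborel"
  by (rule fmeasurableI) (simp_all add: cell_borel measure_cell)

lemma disjoint_cells: "disjoint_family_on (cell h) N"
  by (auto simp: disjoint_family_on_def cell_def)

lemma finite_grid_round_image:
  assumes "d > 0" "bounded S"
  shows "finite (grid_round d ` S)"
proof -
  obtain R where R: "\<And>x. x \<in> S \<Longrightarrow> norm x \<le> R" using assms(2) unfolding bounded_iff by blast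
  define k where "k = \<lceil>R / d\<rceil>"
  have "\<lfloor>u / d\<rfloor> \<in> {- k - 1..k}" if "\<bar>u\<bar> \<le> R" for u
  proof -
    have "u / d \<le> R / d" by (rule divide_right_mono) (use that assms(1) in auto)
    moreover have "(- R) / d \<le> u / d" by (rule divide_right_mono) (use that assms(1) in auto)
    ultimately have "u / d \<le> R / d" "- (R / d) \<le> u / d" by simp_all
    then show ?thesis unfolding k_def atLeastAtMost_iff by linarith
  qed
  moreover have "\<bar>x $ i\<bar> \<le> R" if "x \<in> S" for x :: "real ^ 2" and i
    using component_le_norm_cart[of x i] R[OF that] by linarith
  ultimately have "grid_round d ` S \<subseteq> {- k - 1..k} \<times> {- k - 1..k}" by (auto simp: grid_round_def)
  then show ?thesis by (rule finite_subset) simp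
qed

text \<open>\<open>A\<close> is only Lebesgue measurable, while the density bounds concern Borel
  subsets of it; a compact subset serves instead. Intersecting with a large ball first makes the
  measure finite, so that the inner approximation can lose less than all of it.\<close>

lemma compact_subset_of_positive_measure:
  fixes A :: "(real ^ 2) set"
  assumes A: "A \<in> sets lebesgue" "emeasure lebesgue A > 0"
  obtains T where "compact T" "T \<subseteq> A" "measure lborel T > 0"
proof -
  have "\<exists>n. emeasure lebesgue (A \<inter> cball 0 (real n)) > 0"
  proof (rule ccontr)
    assume "\<not> ?thesis"
    then have z: "emeasure lebesgue (A \<inter> cball 0 (real n)) = 0" for n by simp
    have "emeasure lebesgue (\<Union>n. A \<inter> cball 0 (real n)) = 0"
      by (rule emeasure_UN_eq_0[OF z]) (use A in auto)
    moreover have "(\<Union>n. A \<inter> cball 0 (real n)) = A"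
      using real_arch_simple by (auto simp: dist_norm)
    ultimately show False using A by simp
  qed
  then obtain n where n: "emeasure lebesgue (A \<inter> cball 0 (real n)) > 0" by blast
  let ?A = "A \<inter> cball 0 (real n)"
  have m: "?A \<in> sets lebesgue" using A by auto
  have "?A \<in> lmeasurable" by (rule bounded_set_imp_lmeasurable) (use m in \<open>auto intro: bounded_subset\<close>)
  then have e: "emeasure lebesgue ?A = ennreal (measure lebesgue ?A)" by (rule emeasure_eq_measure2)
  then have pos: "measure lebesgue ?A > 0" using n by simp
  obtain T where T: "closed T" "T \<subseteq> ?A" "?A - T \<in> lmeasurable"
    "emeasure lebesgue (?A - T) < ennreal (measure lebesgue ?A)"
    by (rule sets_lebesgue_inner_closed[OF m pos])
  have "bounded T" using T(2) bounded_subset[OF bounded_cball] by blast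
  then have cT: "compact T" using T(1) compact_eq_bounded_closed by blast
  have "measure lborel T > 0"
  proof (rule ccontr)
    assume "\<not> measure lborel T > 0"
    then have "measure lborel T = 0" using measure_nonneg[of lborel T] by linarith
    then have "emeasure lborel T = 0"
      using emeasure_compact_finite[OF cT] by (auto simp: measure_def enn2real_eq_0_iff)
    then have t0: "emeasure lebesgue T = 0" using T(1) by simp
    have "emeasure lebesgue ?A \<le> emeasure lebesgue (T \<union> (?A - T))"
      using T m by (intro emeasure_mono) auto
    also have "\<dots> \<le> emeasure lebesgue T + emeasure lebesgue (?A - T)"
      using T m by (intro emeasure_subadditive) auto
    also have "\<dots> < emeasure lebesgue ?A" using T(4) t0 e by simp
    finally show False by simp
  qed
  then show ?thesis using that cT T(2) by blast
qed

text \<open>An elementary form of Lebesgue density. Choose an open \<open>U\<close> around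
  \<open>T\<close> with excess below \<open>e * m\<close>, and cells so small that those meeting
  \<open>T\<close> lie in \<open>U\<close>. If each of them lacked more than
  \<open>e * L\<^sup>2\<close>, the total deficit would be at least \<open>e * m\<close>.\<close>

lemma nearly_full_cell:
  fixes A :: "(real ^ 2) set"
  assumes A: "A \<in> sets lebesgue" "emeasure lebesgue A > 0" and e: "e > 0"
  obtains L p T where "L > 0" "compact T" "T \<subseteq> A" "measure lborel (cell L p - T) \<le> e * L\<^sup>2"
proof -
  obtain T where T: "compact T" "T \<subseteq> A" "measure lborel T > 0"
    by (rule compact_subset_of_positive_measure[OF A])
  define m where "m = measure lborel T"
  have em: "e * m > 0" using e T(3) by (simp add: m_def)
  have Tb: "T \<in> sets borel" using T(1) by (simp add: borel_compact)
  have Tl: "T \<in> sets lebesgue" using Tb by simp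
  obtain U where U: "open U" "T \<subseteq> U" "U - T \<in> lmeasurable" "emeasure lebesgue (U - T) < ennreal (e * m)"
    by (rule sets_lebesgue_outer_open[OF Tl em])
  have UTb: "U - T \<in> sets borel" using U(1) Tb by auto
  have UT: "U - T \<in> fmeasurable lborel" "measure lborel (U - T) < e * m"
  proof -
    have *: "emeasure lborel (U - T) < ennreal (e * m)" using U(4) UTb by simp
    then show "U - T \<in> fmeasurable lborel" using UTb by (intro fmeasurableI) (auto intro: less_trans)
    then have "emeasure lborel (U - T) = ennreal (measure lborel (U - T))" by (rule emeasure_eq_measure2)
    then show "measure lborel (U - T) < e * m" using * by (simp add: ennreal_less_iff)
  qed
  have "T \<inter> - U = {}" using U(2) by blast
  then obtain r where r: "r > 0" "\<And>x y. x \<in> T \<Longrightarrow> y \<in> - U \<Longrightarrow> r \<le> dist x y"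
    using separate_compact_closed[OF T(1) closed_Compl[OF U(1)]] by blast
  define L where "L = r / 3"
  have L: "L > 0" "2 * L < r" using r by (simp_all add: L_def)
  define N where "N = grid_round L ` T"
  have fN: "finite N" unfolding N_def by (rule finite_grid_round_image[OF L(1) compact_imp_bounded[OF T(1)]])
  have sub: "cell L p \<subseteq> U" if "p \<in> N" for p
  proof
    fix y assume y: "y \<in> cell L p"
    from that obtain x where x: "x \<in> T" "x \<in> cell L p" by (auto simp: N_def cell_def)
    have "dist x y \<le> 2 * L"
      using grid_square_dist cell_subset_grid_square[OF L(1)] x(2) y by blast
    then show "y \<in> U" using r(2)[OF x(1), of y] L(2) by force
  qed
  note fm = fmeasurable_cell[OF L(1)]
  have cT: "cell L p - T \<in> fmeasurable lborel" for p
    using fm Tb by (intro fmeasurable_Diff) auto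
  have cTb: "cell L p - T \<in> sets borel" for p using cell_borel[OF L(1), of p] Tb by auto
  have "\<exists>p\<in>N. measure lborel (cell L p - T) \<le> e * L\<^sup>2"
  proof (rule ccontr)
    assume "\<not> ?thesis"
    then have big: "e * L\<^sup>2 \<le> measure lborel (cell L p - T)" if "p \<in> N" for p using that by force
    have "m \<le> measure lborel (\<Union>p\<in>N. cell L p)"
      unfolding m_def using fN fm Tb
      by (intro measure_mono_fmeasurable fmeasurable.finite_UN) (auto simp: N_def cell_def)
    also have "\<dots> = (\<Sum>p\<in>N. measure lborel (cell L p))"
      using fN fm disjoint_cells by (intro measure_finite_Union) (auto simp: measure_cell[OF L(1)] cell_borel[OF L(1)])
    also have "\<dots> = real (card N) * L\<^sup>2" by (simp add: measure_cell[OF L(1)])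
    finally have "e * m \<le> real (card N) * (e * L\<^sup>2)" using e by (simp add: mult.left_commute)
    also have "\<dots> \<le> (\<Sum>p\<in>N. measure lborel (cell L p - T))"
      using sum_mono[of N "\<lambda>_. e * L\<^sup>2", OF big] by simp
    also have "\<dots> = measure lborel (\<Union>p\<in>N. cell L p - T)"
    proof (rule measure_finite_Union[symmetric, OF fN])
      show "disjoint_family_on (\<lambda>p. cell L p - T) N" by (auto simp: disjoint_family_on_def cell_def)
      show "emeasure lborel (cell L p - T) \<noteq> \<infinity>" for p using fmeasurableD2[OF cT[of p]] by simp
    qed (use cTb in auto)
    also have "\<dots> \<le> measure lborel (U - T)"
    proof (rule measure_mono_fmeasurable[OF _ _ UT(1)])
      show "(\<Union>p\<in>N. cell L p - T) \<subseteq> U - T" using sub by blast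
      show "(\<Union>p\<in>N. cell L p - T) \<in> sets lborel" using fN cTb by (intro sets.finite_UN) auto
    qed
    finally show False using UT(2) by simp
  qed
  then show ?thesis using that[OF L(1) T(1,2)] by blast
qed

subsection \<open>Occupancy probabilities\<close>

text \<open>On the unit interval
  \<open>\<bar>x ^ n - y ^ n\<bar> \<le> n * \<bar>x - y\<bar>\<close>, and \<open>1 - a\<close>
  agrees with \<open>exp (- a)\<close> up to \<open>a\<^sup>2\<close>. For \<open>v\<close> of order
  \<open>1 / n\<close> the error has order \<open>1 / n\<close>.\<close>

lemma power_minus_exp_bound:
  fixes a v :: real
  assumes "0 \<le> a" "a \<le> 1" "a \<le> v"
  shows "\<bar>(1 - a) ^ n - exp (- (real n * a))\<bar> \<le> real n * v\<^sup>2"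
proof -
  have e: "exp (- a) \<le> 1" "0 \<le> exp (- a)" using assms by simp_all
  have "\<bar>(1 - a) - exp (- a)\<bar> \<le> a\<^sup>2"
  proof -
    have "1 - a \<le> exp (- a)" using exp_ge_add_one_self[of "- a"] by simp
    moreover have "exp (- a) \<le> 1 - a + a\<^sup>2"
    proof -
      have "0 \<le> a * a\<^sup>2" using assms(1) by simp
      \<comment> \<open>The product equals \<open>1 + a ^ 3\<close>.\<close>
      then have "1 \<le> (1 - a + a\<^sup>2) * (1 + a)" by (simp add: algebra_simps power2_eq_square)
      also have "\<dots> \<le> (1 - a + a\<^sup>2) * exp a"
        using exp_ge_add_one_self[of a] assms by (intro mult_left_mono) auto
      finally show ?thesis by (simp add: exp_minus pos_le_divide_eq divide_inverse[symmetric] inverse_eq_divide pos_divide_le_eq)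
    qed
    ultimately show ?thesis by linarith
  qed
  have "exp (- (real n * a)) = exp (- a) ^ n" by (simp add: exp_of_nat_mult[symmetric])
  then have "\<bar>(1 - a) ^ n - exp (- (real n * a))\<bar> \<le> real n * \<bar>(1 - a) - exp (- a)\<bar>"
    using norm_power_diff[of "1 - a" "exp (- a)" n] assms e by simp
  also have "\<dots> \<le> real n * v\<^sup>2"
    using \<open>\<bar>(1 - a) - exp (- a)\<bar> \<le> a\<^sup>2\<close> power_mono[OF assms(3,1), of 2] by (intro mult_left_mono) auto
  finally show ?thesis .
qed

definition occupancy :: "'w measure \<Rightarrow> (nat \<Rightarrow> 'w \<Rightarrow> 'a) \<Rightarrow> nat \<Rightarrow> 'a set \<Rightarrow> ('i \<Rightarrow> 'a set) \<Rightarrow> 'i set \<Rightarrow> 'w set" where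
  "occupancy P x n E R I = {\<omega> \<in> space P. (\<forall>j\<in>{1..n}. x j \<omega> \<notin> E) \<and> (\<forall>i\<in>I. \<exists>j\<in>{1..n}. x j \<omega> \<in> R i)}"

lemma occupancy_sets:
  fixes x :: "nat \<Rightarrow> 'w \<Rightarrow> 'a::topological_space"
  assumes x: "\<And>j. x j \<in> borel_measurable P" and "E \<in> sets borel" "finite I" "\<And>i. i \<in> I \<Longrightarrow> R i \<in> sets borel"
  shows "occupancy P x n E R I \<in> sets P"
proof -
  have pre: "{\<omega> \<in> space P. x j \<omega> \<in> B} \<in> sets P" if "B \<in> sets borel" for j B
    using measurable_sets[OF x that, of j] by (simp add: vimage_def Int_def conj_commute)
  have "occupancy P x n E R I = {\<omega> \<in> space P. (\<forall>j\<in>{1..n}. x j \<omega> \<in> - E)} \<inter>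
      {\<omega> \<in> space P. \<forall>i\<in>I. \<exists>j\<in>{1..n}. x j \<omega> \<in> R i}"
    by (auto simp: occupancy_def)
  moreover have "{\<omega> \<in> space P. (\<forall>j\<in>{1..n}. x j \<omega> \<in> - E)} \<in> sets P"
    using assms(2) by (intro sets.sets_Collect_finite_All pre) auto
  moreover have "{\<omega> \<in> space P. \<forall>i\<in>I. \<exists>j\<in>{1..n}. x j \<omega> \<in> R i} \<in> sets P"
    using assms(3,4) by (intro sets.sets_Collect_finite_All sets.sets_Collect_finite_Ex pre) auto
  ultimately show ?thesis by (simp add: sets.Int)
qed

lemma prob_avoid:
  fixes x :: "nat \<Rightarrow> 'w \<Rightarrow> 'a::euclidean_space"
  assumes iid: "iid_samples \<mu> P x" and E: "E \<in> sets borel"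
  shows "measure P {\<omega> \<in> space P. \<forall>j\<in>{1..n}. x j \<omega> \<notin> E} = (1 - measure \<mu> E) ^ n"
proof -
  interpret prob_space P using iid by (simp add: iid_samples_def)
  have x: "x j \<in> borel_measurable P" "distr P borel (x j) = \<mu>" for j
    using iid by (simp_all add: iid_samples_def)
  have ind: "indep_vars (\<lambda>_. borel) x UNIV" using iid by (simp add: iid_samples_def)
  interpret \<mu>: prob_space \<mu> using prob_space_distr[OF x(1)[of 0]] x(2)[of 0] by simp
  have s\<mu>: "sets \<mu> = sets borel" "space \<mu> = UNIV" using x(2)[of 0] by (auto simp flip: x(2)[of 0])
  have one: "prob (x j -` (- E) \<inter> space P) = 1 - measure \<mu> E" for j
  proof -
    have "prob (x j -` (- E) \<inter> space P) = measure (distr P borel (x j)) (- E)"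
      using E x(1) by (subst measure_distr) auto
    also have "\<dots> = measure \<mu> (space \<mu> - E)" by (simp add: x(2) s\<mu> Compl_eq_Diff_UNIV)
    also have "\<dots> = 1 - measure \<mu> E" using E s\<mu> by (intro \<mu>.prob_compl) auto
    finally show ?thesis .
  qed
  show ?thesis
  proof (cases "n = 0")
    case False
    have "{\<omega> \<in> space P. \<forall>j\<in>{1..n}. x j \<omega> \<notin> E} = (\<Inter>j\<in>{1..n}. x j -` (- E) \<inter> space P)"
      using False by force
    moreover have "prob (\<Inter>j\<in>{1..n}. x j -` (- E) \<inter> space P) = (\<Prod>j\<in>{1..n}. prob (x j -` (- E) \<inter> space P))"
      using False E by (intro indep_varsD[OF ind]) auto
    ultimately show ?thesis by (simp add: one)
  qed (simp add: prob_space)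
qed

text \<open>
  Inclusion and exclusion over \<open>I\<close>: excluding a hit of \<open>R i\<close> adds \<open>R i\<close> to the forbidden set \<open>E\<close>,
  so that each step doubles the error.
\<close>

lemma prob_occupancy:
  fixes x :: "nat \<Rightarrow> 'w \<Rightarrow> 'a::euclidean_space"
  assumes iid: "iid_samples \<mu> P x" and I: "finite I"
    and "E \<in> sets borel" "\<And>i. i \<in> I \<Longrightarrow> R i \<in> sets borel"
    and "\<And>i. i \<in> I \<Longrightarrow> E \<inter> R i = {}" "disjoint_family_on R I"
    and "measure \<mu> E + (\<Sum>i\<in>I. measure \<mu> (R i)) \<le> v"
  shows "\<bar>measure P (occupancy P x n E R I) -
    exp (- (real n * measure \<mu> E)) * (\<Prod>i\<in>I. 1 - exp (- (real n * measure \<mu> (R i))))\<bar> \<le> 2 ^ card I * (real n * v\<^sup>2)"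
  using I assms(3-7)
proof (induction I arbitrary: E rule: finite_induct)
  case empty
  interpret prob_space P using iid by (simp add: iid_samples_def)
  have x: "x 0 \<in> borel_measurable P" "distr P borel (x 0) = \<mu>"
    using iid by (simp_all add: iid_samples_def)
  interpret \<mu>: prob_space \<mu> using prob_space_distr[OF x(1)] x(2) by simp
  have "measure P (occupancy P x n E R {}) = (1 - measure \<mu> E) ^ n"
    using prob_avoid[OF iid empty(1)] by (simp add: occupancy_def)
  then show ?case using power_minus_exp_bound[of "measure \<mu> E" v n] empty by simp
next
  case (insert i I)
  interpret prob_space P using iid by (simp add: iid_samples_def)
  have x: "x j \<in> borel_measurable P" "distr P borel (x j) = \<mu>" for j
    using iid by (simp_all add: iid_samples_def)
  interpret \<mu>: prob_space \<mu> using prob_space_distr[OF x(1)[of 0]] x(2)[of 0] by simp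
  have s\<mu>: "sets \<mu> = sets borel" by (simp flip: x(2)[of 0])
  let ?m = "\<lambda>B. measure \<mu> B" and ?e = "\<lambda>B. exp (- (real n * measure \<mu> B))"
  let ?p = "\<Prod>i\<in>I. 1 - ?e (R i)" and ?o = "\<lambda>E. occupancy P x n E R I"
  have Rm: "R i \<in> sets borel" "\<And>k. k \<in> I \<Longrightarrow> R k \<in> sets borel" using insert.prems by auto
  have dI: "R i \<inter> R k = {}" if "k \<in> I" for k
    using insert.prems(4) insert.hyps(2) that by (auto simp: disjoint_family_on_def)
  have dj: "disjoint_family_on R I" using insert.prems(4) by (rule disjoint_family_on_mono[rotated]) auto
  have add: "?m (E \<union> R i) = ?m E + ?m (R i)"
    using insert.prems Rm s\<mu> by (intro \<mu>.finite_measure_Union) auto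
  have tot: "?m E + ?m (R i) + (\<Sum>k\<in>I. ?m (R k)) \<le> v" using insert.prems(5) insert.hyps by simp
  have IH1: "\<bar>measure P (?o E) - ?e E * ?p\<bar> \<le> 2 ^ card I * (real n * v\<^sup>2)"
    using tot insert.prems Rm dj by (intro insert.IH) (auto intro: order_trans[rotated])
  have IH2: "\<bar>measure P (?o (E \<union> R i)) - ?e (E \<union> R i) * ?p\<bar> \<le> 2 ^ card I * (real n * v\<^sup>2)"
  proof (rule insert.IH)
    show "(E \<union> R i) \<inter> R k = {}" if "k \<in> I" for k
      using insert.prems(3)[of k] dI[OF that] that by blast
  qed (use tot insert.prems(1) Rm dj add in auto)
  have ee: "?e (E \<union> R i) = ?e E * ?e (R i)" by (simp add: add distrib_left exp_add[symmetric])
  have "occupancy P x n E R (insert i I) = ?o E - ?o (E \<union> R i)" by (auto simp: occupancy_def)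
  moreover have "measure P (?o E - ?o (E \<union> R i)) = measure P (?o E) - measure P (?o (E \<union> R i))"
    using insert.prems(1) insert.hyps(1) Rm x(1)
    by (intro finite_measure_Diff occupancy_sets) (auto simp: occupancy_def)
  moreover have "?e E * (\<Prod>i\<in>insert i I. 1 - ?e (R i)) = ?e E * ?p - ?e (E \<union> R i) * ?p"
    using insert.hyps unfolding ee by (simp add: algebra_simps)
  ultimately have "\<bar>measure P (occupancy P x n E R (insert i I)) - ?e E * (\<Prod>i\<in>insert i I. 1 - ?e (R i))\<bar> =
    \<bar>(measure P (?o E) - ?e E * ?p) - (measure P (?o (E \<union> R i)) - ?e (E \<union> R i) * ?p)\<bar>" by simp
  also have "\<dots> \<le> 2 ^ card I * (real n * v\<^sup>2) + 2 ^ card I * (real n * v\<^sup>2)" using IH1 IH2 by linarith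
  also have "\<dots> = 2 ^ card (insert i I) * (real n * v\<^sup>2)" using insert.hyps by simp
  finally show ?case .
qed

text \<open>The second moment method, with deviations from model values \<open>g\<close> instead of
  the exact means. A diagonal term is at most \<open>1\<close>; an off-diagonal one is at most
  \<open>3 * \<kappa>\<close>, one \<open>\<kappa>\<close> from the joint probability and one from
  each single one. Markov's inequality is applied to the squared deviation.\<close>

lemma (in prob_space) sum_indicator_deviation:
  fixes A :: "'i \<Rightarrow> 'a set" and g :: "'i \<Rightarrow> real"
  assumes G: "finite G" and A: "\<And>s. s \<in> G \<Longrightarrow> A s \<in> events" and g: "\<And>s. s \<in> G \<Longrightarrow> 0 \<le> g s \<and> g s \<le> 1"
    and near: "\<And>s. s \<in> G \<Longrightarrow> \<bar>prob (A s) - g s\<bar> \<le> \<kappa>"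
    and near2: "\<And>s s'. s \<in> G \<Longrightarrow> s' \<in> G \<Longrightarrow> s \<noteq> s' \<Longrightarrow> \<bar>prob (A s \<inter> A s') - g s * g s'\<bar> \<le> \<kappa>"
    and m: "0 < m" "m \<le> sum g G"
  shows "prob {\<omega> \<in> space M. real (card {s \<in> G. \<omega> \<in> A s}) \<le> m / 2} \<le> 4 * (real (card G) + 3 * \<kappa> * (real (card G))\<^sup>2) / m\<^sup>2"
proof -
  let ?f = "\<lambda>s \<omega>. indicator (A s) \<omega> - g s"
  let ?u = "\<lambda>\<omega>. (\<Sum>s\<in>G. ?f s \<omega>)\<^sup>2"
  have int1: "integrable M (\<lambda>\<omega>. indicator (A s) \<omega> :: real)" if "s \<in> G" for s
    using A[OF that] by (simp add: integrable_real_indicator emeasure_eq_measure)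
  have int2: "integrable M (\<lambda>\<omega>. indicator (A s) \<omega> * indicator (A s') \<omega> :: real)" if "s \<in> G" "s' \<in> G" for s s'
    unfolding indicator_inter_arith[symmetric]
    using A[OF that(1)] A[OF that(2)] by (simp add: integrable_real_indicator emeasure_eq_measure sets.Int)
  have expand: "?f s \<omega> * ?f s' \<omega> = indicator (A s) \<omega> * indicator (A s') \<omega> - g s' * indicator (A s) \<omega> -
      g s * indicator (A s') \<omega> + g s * g s'" for s s' \<omega> by (simp add: algebra_simps)
  have int: "integrable M (\<lambda>\<omega>. ?f s \<omega> * ?f s' \<omega>)" if "s \<in> G" "s' \<in> G" for s s'
    unfolding expand using int1 int2 that by auto
  have ex: "expectation (\<lambda>\<omega>. ?f s \<omega> * ?f s' \<omega>) =
      prob (A s \<inter> A s') - g s' * prob (A s) - g s * prob (A s') + g s * g s'" if "s \<in> G" "s' \<in> G" for s s'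
  proof -
    have "expectation (\<lambda>\<omega>. indicator (A s) \<omega> * indicator (A s') \<omega> :: real) = prob (A s \<inter> A s')"
      unfolding indicator_inter_arith[symmetric] using A that by (simp add: sets.Int)
    then show ?thesis
      unfolding expand using int1 int2 A that by (simp add: prob_space)
  qed
  have k0: "0 \<le> \<kappa>" if "s \<in> G" for s using near[OF that] by linarith
  have off: "expectation (\<lambda>\<omega>. ?f s \<omega> * ?f s' \<omega>) \<le> 3 * \<kappa>" if s: "s \<in> G" "s' \<in> G" "s \<noteq> s'" for s s'
  proof -
    have "\<bar>g s' * (prob (A s) - g s)\<bar> \<le> 1 * \<kappa>" "\<bar>g s * (prob (A s') - g s')\<bar> \<le> 1 * \<kappa>"
      using mult_mono[of "\<bar>g s'\<bar>" 1 "\<bar>prob (A s) - g s\<bar>" \<kappa>] g[OF s(2)] near[OF s(1)] k0[OF s(1)]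
        mult_mono[of "\<bar>g s\<bar>" 1 "\<bar>prob (A s') - g s'\<bar>" \<kappa>] g[OF s(1)] near[OF s(2)]
      by (simp_all add: abs_mult)
    moreover have "expectation (\<lambda>\<omega>. ?f s \<omega> * ?f s' \<omega>) = (prob (A s \<inter> A s') - g s * g s') -
        g s' * (prob (A s) - g s) - g s * (prob (A s') - g s')"
      unfolding ex[OF s(1,2)] by (simp add: algebra_simps)
    ultimately show ?thesis using near2[OF s] by linarith
  qed
  have diag: "expectation (\<lambda>\<omega>. ?f s \<omega> * ?f s \<omega>) \<le> 1" if s: "s \<in> G" for s
  proof -
    have "expectation (\<lambda>\<omega>. ?f s \<omega> * ?f s \<omega>) \<le> expectation (\<lambda>\<omega>. 1)"
    proof (rule integral_mono[OF int[OF s s]])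
      fix \<omega>
      have "\<bar>?f s \<omega>\<bar> \<le> 1" using g[OF s] by (auto simp: indicator_def)
      then have "\<bar>?f s \<omega>\<bar> * \<bar>?f s \<omega>\<bar> \<le> 1 * 1" by (intro mult_mono) auto
      then show "?f s \<omega> * ?f s \<omega> \<le> 1" by (simp add: abs_mult_self_eq)
    qed simp
    then show ?thesis by (simp add: prob_space)
  qed
  have sq: "?u \<omega> = (\<Sum>s\<in>G. \<Sum>s'\<in>G. ?f s \<omega> * ?f s' \<omega>)" for \<omega>
    by (simp only: power2_eq_square sum_product)
  have iu: "integrable M ?u" unfolding sq using int by auto
  have "expectation ?u = (\<Sum>s\<in>G. expectation (\<lambda>\<omega>. \<Sum>s'\<in>G. ?f s \<omega> * ?f s' \<omega>))"
    unfolding sq by (rule Bochner_Integration.integral_sum) (intro Bochner_Integration.integrable_sum int)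
  also have "\<dots> = (\<Sum>s\<in>G. \<Sum>s'\<in>G. expectation (\<lambda>\<omega>. ?f s \<omega> * ?f s' \<omega>))"
    by (intro sum.cong refl Bochner_Integration.integral_sum int)
  also have "\<dots> \<le> (\<Sum>s\<in>G. \<Sum>s'\<in>G. (if s' = s then 1 else 0) + 3 * \<kappa>)"
  proof (intro sum_mono)
    fix s s' assume s: "s \<in> G" "s' \<in> G"
    show "expectation (\<lambda>\<omega>. ?f s \<omega> * ?f s' \<omega>) \<le> (if s' = s then 1 else 0) + 3 * \<kappa>"
      using off[OF s] diag[OF s(1)] k0[OF s(1)] by (cases "s' = s") auto
  qed
  also have "\<dots> = real (card G) + 3 * \<kappa> * (real (card G))\<^sup>2"
    using G by (simp add: sum.distrib sum.delta power2_eq_square algebra_simps)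
  finally have eu: "expectation ?u \<le> real (card G) + 3 * \<kappa> * (real (card G))\<^sup>2" .
  have sub: "{\<omega> \<in> space M. real (card {s \<in> G. \<omega> \<in> A s}) \<le> m / 2} \<subseteq> {\<omega> \<in> space M. (m / 2)\<^sup>2 \<le> ?u \<omega>}"
  proof safe
    fix \<omega> assume "real (card {s \<in> G. \<omega> \<in> A s}) \<le> m / 2"
    moreover have "(\<Sum>s\<in>G. indicator (A s) \<omega>) = real (card {s \<in> G. \<omega> \<in> A s})"
      using G by (simp add: indicator_def sum.If_cases Int_def)
    ultimately have "m / 2 \<le> - (\<Sum>s\<in>G. ?f s \<omega>)" using m(2) by (simp add: sum_subtractf)
    then have "(m / 2)\<^sup>2 \<le> (- (\<Sum>s\<in>G. ?f s \<omega>))\<^sup>2" using m(1) by (intro power_mono) auto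
    then show "(m / 2)\<^sup>2 \<le> ?u \<omega>" by simp
  qed
  have "prob {\<omega> \<in> space M. real (card {s \<in> G. \<omega> \<in> A s}) \<le> m / 2} \<le> prob {\<omega> \<in> space M. (m / 2)\<^sup>2 \<le> ?u \<omega>}"
    by (intro finite_measure_mono[OF sub] borel_measurable_le borel_measurable_const borel_measurable_integrable[OF iu])
  also have "\<dots> \<le> expectation ?u / (m / 2)\<^sup>2"
    using iu m(1) by (intro integral_Markov_inequality_measure[where A = "space M"]) auto
  also have "\<dots> \<le> (real (card G) + 3 * \<kappa> * (real (card G))\<^sup>2) / (m / 2)\<^sup>2"
    using eu by (intro divide_right_mono) auto
  finally show ?thesis by (simp add: power_divide algebra_simps)
qed

subsection \<open>Isolated holes\<close>

text \<open>
  A square of side \<open>6 h\<close> whose \<open>20\<close> boundary cells contain sample points and whose \<open>16\<close> inner cells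
  contain none encloses a component of the superlevel set at height \<open>3 h / 2\<close> that reaches height
  \<open>2 h\<close>.
\<close>

definition block :: "int \<times> int \<Rightarrow> (int \<times> int) set" where
  "block s = {6 * fst s..6 * fst s + 5} \<times> {6 * snd s..6 * snd s + 5}"

definition inner_cells :: "int \<times> int \<Rightarrow> (int \<times> int) set" where
  "inner_cells s = {6 * fst s + 1..6 * fst s + 4} \<times> {6 * snd s + 1..6 * snd s + 4}"

definition ring_cells :: "int \<times> int \<Rightarrow> (int \<times> int) set" where
  "ring_cells s = block s - inner_cells s"

lemma block_finite: "finite (block s)" "finite (inner_cells s)" "finite (ring_cells s)"
  by (simp_all add: block_def inner_cells_def ring_cells_def)

lemma inner_cells_subset: "inner_cells s \<subseteq> block s"
  by (auto simp: block_def inner_cells_def)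

lemma card_ring_cells_le: "card (ring_cells s) \<le> 36"
proof -
  have "card (ring_cells s) \<le> card (block s)"
    by (intro card_mono block_finite) (auto simp: ring_cells_def)
  also have "\<dots> = 36" by (simp add: block_def card_cartesian_product)
  finally show ?thesis .
qed

lemma in_block_iff: "k \<in> block s \<longleftrightarrow> s = (fst k div 6, snd k div 6)"
proof -
  have "6 * a \<le> b \<and> b \<le> 6 * a + 5 \<longleftrightarrow> a = b div 6" for a b :: int by presburger
  then show ?thesis by (cases k; cases s) (auto simp: block_def)
qed

lemma block_disjoint: "s \<noteq> s' \<Longrightarrow> block s \<inter> block s' = {}"
  by (auto simp: in_block_iff simp del: prod.inject)

definition hole :: "real \<Rightarrow> (real ^ 2) set \<Rightarrow> int \<times> int \<Rightarrow> bool" where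
  "hole h X s \<longleftrightarrow> (\<forall>x\<in>X. grid_round h x \<notin> inner_cells s) \<and> (\<forall>k\<in>ring_cells s. \<exists>x\<in>X. grid_round h x = k)"

text \<open>Sample points outside the inner cells are at least \<open>2 * h\<close> away from the
  centre \<open>c\<close> in one coordinate. A frontier point shares a closed ring cell with a
  sample point, so its distance to \<open>X\<close> is at most
  \<open>sqrt 2 * h < 3 / 2 * h\<close>, and the component of \<open>c\<close> cannot cross the
  frontier.\<close>

lemma hole_component:
  fixes X :: "(real ^ 2) set"
  assumes h: "h > 0" and X: "finite X" "X \<noteq> {}" and hole: "hole h X s"
  defines "Q \<equiv> box (grid_point h (6 * fst s, 6 * snd s)) (grid_point h (6 * fst s + 6, 6 * snd s + 6))"
  obtains C where "C \<in> persistent_components X (3 / 2 * h) (2 * h)" "C \<subseteq> Q"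
proof -
  define i j where "i = 6 * fst s" "j = 6 * snd s"
  note ij = this
  define c where "c = grid_point h (i + 3, j + 3)"
  have Q: "Q = {x. h * of_int i < x $ 1 \<and> x $ 1 < h * (of_int i + 6) \<and> h * of_int j < x $ 2 \<and> x $ 2 < h * (of_int j + 6)}"
    unfolding Q_def by (auto simp: mem_box_cart forall_2 ij)
  have cb: "cbox (grid_point h (6 * fst s, 6 * snd s)) (grid_point h (6 * fst s + 6, 6 * snd s + 6)) =
      {x. h * of_int i \<le> x $ 1 \<and> x $ 1 \<le> h * (of_int i + 6) \<and> h * of_int j \<le> x $ 2 \<and> x $ 2 \<le> h * (of_int j + 6)}"
    by (auto simp: mem_box_cart forall_2 ij)
  have cQ: "c \<in> Q" using h by (simp add: Q c_def)
  have fr: "frontier Q = cbox (grid_point h (6 * fst s, 6 * snd s)) (grid_point h (6 * fst s + 6, 6 * snd s + 6)) - Q"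
    using cQ unfolding Q_def frontier_def by (subst closure_box) (auto simp: interior_open[OF open_box])
  have fl: "h * of_int \<lfloor>u / h\<rfloor> \<le> u" "u < h * (of_int \<lfloor>u / h\<rfloor> + 1)" for u
  proof -
    have "of_int \<lfloor>u / h\<rfloor> \<le> u / h" "u / h < of_int \<lfloor>u / h\<rfloor> + 1" by linarith+
    then show "h * of_int \<lfloor>u / h\<rfloor> \<le> u" "u < h * (of_int \<lfloor>u / h\<rfloor> + 1)"
      by (simp_all only: pos_le_divide_eq[OF h] pos_divide_less_eq[OF h] mult.commute)
  qed
  have far: "2 * h \<le> infdist c X"
  proof -
    obtain x where x: "x \<in> X" "infdist c X = dist c x" using infdist_finite_attained[OF X] by blast
    have out: "2 * h \<le> \<bar>h * (of_int a + 3) - u\<bar>" if n: "\<not> (a + 1 \<le> \<lfloor>u / h\<rfloor> \<and> \<lfloor>u / h\<rfloor> \<le> a + 4)" for a u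
    proof -
      consider "\<lfloor>u / h\<rfloor> + 1 \<le> a + 1" | "a + 5 \<le> \<lfloor>u / h\<rfloor>" using n by linarith
      then show ?thesis
      proof cases
        case 1
        then have "real_of_int \<lfloor>u / h\<rfloor> + 1 \<le> of_int a + 1" by linarith
        then have "h * (of_int \<lfloor>u / h\<rfloor> + 1) \<le> h * (of_int a + 1)" using h by (intro mult_left_mono) auto
        then have "u < h * (of_int a + 1)" using fl(2)[of u] by linarith
        then show ?thesis using h by (simp add: algebra_simps)
      next
        case 2
        then have "of_int a + 5 \<le> real_of_int \<lfloor>u / h\<rfloor>" by linarith
        then have "h * (of_int a + 5) \<le> h * of_int \<lfloor>u / h\<rfloor>" using h by (intro mult_left_mono) auto
        then have "h * (of_int a + 5) \<le> u" using fl(1)[of u] by linarith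
        then show ?thesis using h by (simp add: algebra_simps)
      qed
    qed
    have "grid_round h x \<notin> inner_cells s" using hole x(1) by (auto simp: hole_def)
    then have "\<not> (i + 1 \<le> \<lfloor>x $ 1 / h\<rfloor> \<and> \<lfloor>x $ 1 / h\<rfloor> \<le> i + 4) \<or> \<not> (j + 1 \<le> \<lfloor>x $ 2 / h\<rfloor> \<and> \<lfloor>x $ 2 / h\<rfloor> \<le> j + 4)"
      by (auto simp: inner_cells_def grid_round_def ij)
    then have "2 * h \<le> \<bar>(c - x) $ 1\<bar> \<or> 2 * h \<le> \<bar>(c - x) $ 2\<bar>"
      using out[of i "x $ 1"] out[of j "x $ 2"] by (auto simp: c_def)
    then have "2 * h \<le> norm (c - x)"
      using component_le_norm_cart[of "c - x" 1] component_le_norm_cart[of "c - x" 2] by linarith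
    then show ?thesis using x(2) by (simp add: dist_norm)
  qed
  have near: "infdist y X < 3 / 2 * h" if y: "y \<in> frontier Q" for y
  proof -
    \<comment> \<open>Flooring puts points of the upper and the right side into cells beyond the
      block; the minimum pulls them back into the adjacent ring cell.\<close>
    define k where "k = (min \<lfloor>y $ 1 / h\<rfloor> (i + 5), min \<lfloor>y $ 2 / h\<rfloor> (j + 5))"
    have yc: "h * of_int i \<le> y $ 1" "y $ 1 \<le> h * (of_int i + 6)" "h * of_int j \<le> y $ 2" "y $ 2 \<le> h * (of_int j + 6)"
      and yb: "y $ 1 \<le> h * of_int i \<or> h * (of_int i + 6) \<le> y $ 1 \<or> y $ 2 \<le> h * of_int j \<or> h * (of_int j + 6) \<le> y $ 2"
      using y unfolding fr cb unfolding Q by auto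
    have one: "h * of_int (min \<lfloor>u / h\<rfloor> (a + 5)) \<le> u" "u \<le> h * (of_int (min \<lfloor>u / h\<rfloor> (a + 5)) + 1)"
      "a \<le> min \<lfloor>u / h\<rfloor> (a + 5)" "min \<lfloor>u / h\<rfloor> (a + 5) \<le> a + 5"
      "u \<le> h * of_int a \<Longrightarrow> min \<lfloor>u / h\<rfloor> (a + 5) = a" "h * (of_int a + 6) \<le> u \<Longrightarrow> min \<lfloor>u / h\<rfloor> (a + 5) = a + 5"
      if u: "h * of_int a \<le> u" "u \<le> h * (of_int a + 6)" for a u
    proof -
      have lo: "of_int a \<le> u / h" using u(1) h by (simp add: pos_le_divide_eq mult.commute)
      then have a: "a \<le> \<lfloor>u / h\<rfloor>" by (simp add: le_floor_iff)
      then show "a \<le> min \<lfloor>u / h\<rfloor> (a + 5)" "min \<lfloor>u / h\<rfloor> (a + 5) \<le> a + 5" by auto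
      have "h * of_int (min \<lfloor>u / h\<rfloor> (a + 5)) \<le> h * of_int \<lfloor>u / h\<rfloor>" using h by (intro mult_left_mono) auto
      then show "h * of_int (min \<lfloor>u / h\<rfloor> (a + 5)) \<le> u" using fl(1)[of u] by linarith
      show "u \<le> h * (of_int (min \<lfloor>u / h\<rfloor> (a + 5)) + 1)"
        using fl(2)[of u] u(2) by (cases "\<lfloor>u / h\<rfloor> \<le> a + 5") (auto simp: min_def add.commute)
      show "min \<lfloor>u / h\<rfloor> (a + 5) = a" if "u \<le> h * of_int a"
      proof -
        have "u / h \<le> of_int a" using that h by (simp add: pos_divide_le_eq mult.commute)
        then have "\<lfloor>u / h\<rfloor> \<le> a" by linarith
        then show ?thesis using a by simp
      qed
      show "min \<lfloor>u / h\<rfloor> (a + 5) = a + 5" if "h * (of_int a + 6) \<le> u"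
      proof -
        have "of_int a + 6 \<le> u / h" using that h by (simp add: pos_le_divide_eq mult.commute)
        then have "a + 6 \<le> \<lfloor>u / h\<rfloor>" by linarith
        then show ?thesis by simp
      qed
    qed
    note o1 = one[OF yc(1,2)] and o2 = one[OF yc(3,4)]
    have "fst k \<in> {i, i + 5} \<or> snd k \<in> {j, j + 5}" using yb o1(5,6) o2(5,6) by (auto simp: k_def)
    then have "k \<in> ring_cells s"
      using o1(3,4) o2(3,4) by (auto simp: ring_cells_def block_def inner_cells_def k_def ij)
    then obtain x where x: "x \<in> X" "grid_round h x = k" using hole by (auto simp: hole_def)
    have "x \<in> cell h k" using x(2) by (simp add: cell_def)
    then have "x \<in> grid_square h k" using cell_subset_grid_square[OF h] by blast
    moreover have "y \<in> grid_square h k" using o1(1,2) o2(1,2) by (simp add: grid_square_def k_def)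
    ultimately have "\<bar>(y - x) $ 1\<bar> \<le> h" "\<bar>(y - x) $ 2\<bar> \<le> h"
      by (auto simp: grid_square_def algebra_simps abs_le_iff)
    then have "((y - x) $ 1)\<^sup>2 \<le> h\<^sup>2" "((y - x) $ 2)\<^sup>2 \<le> h\<^sup>2"
      by (metis abs_ge_zero power2_abs power_mono)+
    moreover have "(dist y x)\<^sup>2 = ((y - x) $ 1)\<^sup>2 + ((y - x) $ 2)\<^sup>2"
      unfolding dist_norm power2_norm_eq_inner inner_real2 by (simp add: power2_eq_square)
    moreover have "(3 / 2 * h)\<^sup>2 = 9 / 4 * h\<^sup>2" by (simp add: power2_eq_square)
    moreover have "h\<^sup>2 > 0" using h by simp
    ultimately have "(dist y x)\<^sup>2 < (3 / 2 * h)\<^sup>2" by linarith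
    then have "dist y x < 3 / 2 * h" by (rule power2_less_imp_less) (use h in simp)
    then show ?thesis using infdist_le[OF x(1), of y] by linarith
  qed
  define C where "C = level_component X (3 / 2 * h) c"
  have cK: "c \<in> superlevel X (3 / 2 * h)" "c \<in> superlevel X (2 * h)" using far h by (auto simp: superlevel_def)
  have cC: "c \<in> C" using cK by (simp add: C_def)
  have Csub: "C \<subseteq> superlevel X (3 / 2 * h)" unfolding C_def by (rule connected_component_subset)
  have "C \<inter> frontier Q = {}" using near Csub by (force simp: superlevel_def)
  moreover have "connected C" by (simp add: C_def)
  ultimately have CQ: "C \<subseteq> Q" using connected_Int_frontier[of C Q] cC cQ by blast
  then have "bounded C" unfolding Q_def using bounded_subset[OF bounded_box] by blast
  moreover have "C \<in> components (superlevel X (3 / 2 * h))" using cK by (auto simp: C_def components_def)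
  moreover have "C \<inter> superlevel X (2 * h) \<noteq> {}" using cC cK by blast
  ultimately have "C \<in> persistent_components X (3 / 2 * h) (2 * h)" by (simp add: persistent_components_def)
  then show ?thesis using that CQ by blast
qed

text \<open>The open boxes of different blocks are disjoint, so the components inside them
  differ.\<close>

lemma card_holes_le:
  fixes X :: "(real ^ 2) set"
  assumes h: "h > 0" and X: "finite X" "X \<noteq> {}" and G: "\<And>s. s \<in> G \<Longrightarrow> hole h X s"
  shows "card G \<le> card (persistent_components X (3 / 2 * h) (2 * h))"
proof -
  let ?Q = "\<lambda>s. box (grid_point h (6 * fst s, 6 * snd s)) (grid_point h (6 * fst s + 6, 6 * snd s + 6))"
  have "\<exists>C. C \<in> persistent_components X (3 / 2 * h) (2 * h) \<and> C \<subseteq> ?Q s" if "s \<in> G" for s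
    by (rule hole_component[OF h X G[OF that]]) blast
  then obtain C where C: "\<And>s. s \<in> G \<Longrightarrow> C s \<in> persistent_components X (3 / 2 * h) (2 * h) \<and> C s \<subseteq> ?Q s"
    by metis
  have dis: "a = b" if "h * of_int (6 * a) < u" "u < h * of_int (6 * a + 6)"
      "h * of_int (6 * b) < u" "u < h * of_int (6 * b + 6)" for a b :: int and u
  proof -
    have "h * of_int (6 * a) < h * of_int (6 * b + 6)" "h * of_int (6 * b) < h * of_int (6 * a + 6)"
      using that by linarith+
    then have "6 * a < 6 * b + 6" "6 * b < 6 * a + 6" using h by (simp_all only: mult_less_cancel_left_pos of_int_less_iff)
    then show ?thesis by presburger
  qed
  have "inj_on C G"
  proof (rule inj_onI)
    fix s s' assume s: "s \<in> G" "s' \<in> G" "C s = C s'"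
    have "C s \<noteq> {}" using C[OF s(1)] by (auto simp: persistent_components_def)
    then obtain x where "x \<in> ?Q s" "x \<in> ?Q s'" using C[OF s(1)] C[OF s(2)] s(3) by blast
    then show "s = s'"
      using dis[of "fst s" "x $ 1" "fst s'"] dis[of "snd s" "x $ 2" "snd s'"]
      by (simp add: mem_box_cart forall_2 prod_eq_iff)
  qed
  then show ?thesis
    using C h by (intro card_inj_on_le[OF _ _ finite_persistent_components[OF X]]) auto
qed

subsection \<open>Counting the usable squares\<close>

definition cells :: "real \<Rightarrow> (int \<times> int) set \<Rightarrow> (real ^ 2) set" where
  "cells h K = {x. grid_round h x \<in> K}"

lemma cells_UN: "cells h K = (\<Union>k\<in>K. cell h k)"
  by (auto simp: cells_def cell_def)

lemma cells_borel: "h > 0 \<Longrightarrow> finite K \<Longrightarrow> cells h K \<in> sets borel"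
  unfolding cells_UN by (intro sets.finite_UN cell_borel)

lemma measure_cells:
  assumes "h > 0" "finite K" "sets M = sets borel" "finite_measure M"
  shows "measure M (cells h K) = (\<Sum>k\<in>K. measure M (cell h k))"
proof -
  interpret finite_measure M by fact
  show ?thesis
    unfolding cells_UN using assms disjoint_cells cell_borel
    by (intro finite_measure_finite_Union) auto
qed

text \<open>
  At most a quarter of the squares contain a cell that is not half filled by \<open>T\<close>, and at most a
  quarter of them have mass above \<open>4 / N\<^sup>2\<close>.
\<close>

lemma usable_squares:
  fixes \<mu> :: "(real ^ 2) measure"
  assumes \<mu>: "prob_space \<mu>" "sets \<mu> = sets borel" and L: "L > 0" and T: "T \<in> sets borel"
    and full: "measure lborel (cell L p - T) \<le> 1 / 288 * L\<^sup>2" and N: "N > 0"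
  defines "h \<equiv> L / (6 * real N)"
  obtains G where "finite G" "card G \<le> N\<^sup>2" "real N ^ 2 / 2 \<le> real (card G)"
    "\<And>s. s \<in> G \<Longrightarrow> measure \<mu> (cells h (block s)) \<le> 4 / real N ^ 2"
    "\<And>s k. s \<in> G \<Longrightarrow> k \<in> block s \<Longrightarrow> h\<^sup>2 / 2 \<le> measure lborel (cell h k \<inter> T)"
proof -
  interpret \<mu>: prob_space \<mu> by fact
  have h: "h > 0" using L N by (simp add: h_def)
  have Lh: "L = 6 * real N * h" using N by (simp add: h_def)
  let ?N = "int N"
  define S where "S = {?N * fst p..<?N * fst p + ?N} \<times> {?N * snd p..<?N * snd p + ?N}"
  define K where "K = {6 * ?N * fst p..<6 * ?N * fst p + 6 * ?N} \<times> {6 * ?N * snd p..<6 * ?N * snd p + 6 * ?N}"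
  have fS: "finite S" "finite K" by (simp_all add: S_def K_def)
  have cS: "card S = N\<^sup>2" by (simp add: S_def card_cartesian_product power2_eq_square)
  have blockK: "block s \<subseteq> K" if "s \<in> S" for s
  proof -
    have "6 * ?N * a \<le> k \<and> k < 6 * ?N * a + 6 * ?N" if "?N * a \<le> i" "i < ?N * a + ?N" "6 * i \<le> k" "k \<le> 6 * i + 5" for a i k
      using that by linarith
    then show ?thesis using that unfolding S_def K_def block_def by fastforce
  qed
  have cellL: "cell L p = cells h K"
  proof -
    have "\<lfloor>u / L\<rfloor> = a \<longleftrightarrow> 6 * ?N * a \<le> \<lfloor>u / h\<rfloor> \<and> \<lfloor>u / h\<rfloor> < 6 * ?N * a + 6 * ?N" for u a
    proof -
      have "\<lfloor>u / L\<rfloor> = a \<longleftrightarrow> L * of_int a \<le> u \<and> u < L * (of_int a + 1)"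
        using L by (simp add: floor_eq_iff pos_le_divide_eq pos_divide_less_eq mult.commute)
      also have "\<dots> \<longleftrightarrow> of_int (6 * ?N * a) * h \<le> u \<and> u < of_int (6 * ?N * a + 6 * ?N) * h"
        unfolding Lh by (simp add: algebra_simps)
      also have "\<dots> \<longleftrightarrow> of_int (6 * ?N * a) \<le> u / h \<and> u / h < of_int (6 * ?N * a + 6 * ?N)"
        using h by (simp only: pos_le_divide_eq pos_divide_less_eq)
      also have "\<dots> \<longleftrightarrow> 6 * ?N * a \<le> \<lfloor>u / h\<rfloor> \<and> \<lfloor>u / h\<rfloor> < 6 * ?N * a + 6 * ?N"
        by (simp only: le_floor_iff floor_less_iff)
      finally show ?thesis .
    qed
    note fl = this
    have "x \<in> cell L p \<longleftrightarrow> x \<in> cells h K" for x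
      using fl[of "x $ 1" "fst p"] fl[of "x $ 2" "snd p"]
      unfolding cell_def cells_def grid_round_def K_def prod_eq_iff mem_Collect_eq mem_Times_iff fst_conv snd_conv
        atLeastLessThan_iff by blast
    then show ?thesis by blast
  qed
  have Tl: "T \<in> sets lborel" using T by simp
  have fmT: "cell h k \<inter> T \<in> fmeasurable lborel" "cell h k - T \<in> fmeasurable lborel" for k
    by (rule fmeasurable_Int_fmeasurable[OF fmeasurable_cell[OF h] Tl] fmeasurable_Diff[OF fmeasurable_cell[OF h] Tl])+
  have split: "measure lborel (cell h k \<inter> T) + measure lborel (cell h k - T) = h\<^sup>2" for k
  proof -
    have "measure lborel (cell h k \<inter> T) + measure lborel (cell h k - T) =
        measure lborel ((cell h k \<inter> T) \<union> (cell h k - T))"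
      using fmeasurableD[OF fmT(1)[of k]] fmeasurableD[OF fmT(2)[of k]]
        fmeasurableD2[OF fmT(1)[of k]] fmeasurableD2[OF fmT(2)[of k]]
      by (intro measure_Union[symmetric]) auto
    also have "(cell h k \<inter> T) \<union> (cell h k - T) = cell h k" by blast
    finally show ?thesis by (simp add: measure_cell[OF h])
  qed
  define bad where "bad = {k \<in> K. measure lborel (cell h k \<inter> T) < h\<^sup>2 / 2}"
  have fbad: "finite bad" using fS by (simp add: bad_def)
  have "real (card bad) * (h\<^sup>2 / 2) \<le> (\<Sum>k\<in>bad. measure lborel (cell h k - T))"
  proof (rule sum_bounded_below)
    fix k assume "k \<in> bad"
    then have "measure lborel (cell h k \<inter> T) < h\<^sup>2 / 2" by (simp add: bad_def)
    then show "h\<^sup>2 / 2 \<le> measure lborel (cell h k - T)" using split[of k] by linarith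
  qed
  also have "\<dots> \<le> (\<Sum>k\<in>K. measure lborel (cell h k - T))"
    using fS by (intro sum_mono2) (auto simp: bad_def)
  also have "\<dots> = measure lborel (\<Union>k\<in>K. cell h k - T)"
  proof (rule measure_finite_Union[symmetric, OF fS(2)])
    show "(\<lambda>k. cell h k - T) ` K \<subseteq> sets lborel" using fmeasurableD[OF fmT(2)] by blast
    show "disjoint_family_on (\<lambda>k. cell h k - T) K" by (auto simp: disjoint_family_on_def cell_def)
    show "emeasure lborel (cell h k - T) \<noteq> \<infinity>" for k using fmeasurableD2[OF fmT(2)[of k]] by simp
  qed
  also have "(\<Union>k\<in>K. cell h k - T) = cell L p - T" unfolding cellL cells_UN by blast
  also have "measure lborel (cell L p - T) \<le> 1 / 288 * L\<^sup>2" by (rule full)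
  \<comment> \<open>Since \<open>L = 6 * N * h\<close>, the constant \<open>288 = 36 * 8\<close>
    leaves room for \<open>N\<^sup>2 / 4\<close> cells that lack \<open>h\<^sup>2 / 2\<close>
    each.\<close>
  also have "1 / 288 * L\<^sup>2 = real N ^ 2 / 4 * (h\<^sup>2 / 2)" by (simp add: Lh power_mult_distrib)
  finally have "real (card bad) * (h\<^sup>2 / 2) \<le> real N ^ 2 / 4 * (h\<^sup>2 / 2)" .
  then have cbad: "real (card bad) \<le> real N ^ 2 / 4" using h by simp
  define S1 where "S1 = {s \<in> S. \<exists>k\<in>block s. k \<in> bad}"
  \<comment> \<open>Each cell lies in a single block, so the bad cells spoil at most as many
    blocks.\<close>
  have "S1 \<subseteq> (\<lambda>k. (fst k div 6, snd k div 6)) ` bad"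
  proof
    fix s assume "s \<in> S1"
    then obtain k where "k \<in> block s" "k \<in> bad" by (auto simp: S1_def)
    then show "s \<in> (\<lambda>k. (fst k div 6, snd k div 6)) ` bad" unfolding in_block_iff by (rule image_eqI)
  qed
  then have "card S1 \<le> card bad" using surj_card_le[OF fbad] by blast
  then have c1: "real (card S1) \<le> real N ^ 2 / 4" using cbad by linarith
  define S2 where "S2 = {s \<in> S. 4 / real N ^ 2 < measure \<mu> (cells h (block s))}"
  have mb: "cells h (block s) \<in> sets \<mu>" for s using cells_borel[OF h block_finite(1)] \<mu>(2) by simp
  have "real (card S2) * (4 / real N ^ 2) \<le> (\<Sum>s\<in>S2. measure \<mu> (cells h (block s)))"
    by (rule sum_bounded_below) (simp add: S2_def)
  also have "\<dots> = measure \<mu> (\<Union>s\<in>S2. cells h (block s))"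
  proof (rule \<mu>.finite_measure_finite_Union[symmetric])
    show "finite S2" using fS by (simp add: S2_def)
    show "disjoint_family_on (\<lambda>s. cells h (block s)) S2"
      by (auto simp: disjoint_family_on_def cells_def in_block_iff simp del: prod.inject)
  qed (use mb in auto)
  also have "\<dots> \<le> 1" by simp
  finally have "real (card S2) * 4 / real N ^ 2 \<le> 1" by simp
  then have c2: "real (card S2) \<le> real N ^ 2 / 4" using N pos_divide_le_eq[of "real N ^ 2" "real (card S2) * 4" 1] by simp
  define G where "G = S - (S1 \<union> S2)"
  have "card S \<le> card G + card (S1 \<union> S2)"
    using diff_card_le_card_Diff[of "S1 \<union> S2" S] fS by (simp add: G_def S1_def S2_def)
  also have "card (S1 \<union> S2) \<le> card S1 + card S2" by (rule card_Un_le)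
  finally have "N\<^sup>2 \<le> card G + (card S1 + card S2)" using cS by linarith
  then have "real (N\<^sup>2) \<le> real (card G + (card S1 + card S2))" by (rule of_nat_mono)
  then have "real N ^ 2 \<le> real (card G) + (real (card S1) + real (card S2))" by simp
  then have g3: "real N ^ 2 / 2 \<le> real (card G)" using c1 c2 by linarith
  have g12: "finite G" "card G \<le> N\<^sup>2" using fS cS card_mono[of S G] by (auto simp: G_def)
  have g4: "measure \<mu> (cells h (block s)) \<le> 4 / real N ^ 2" if "s \<in> G" for s
    using that by (auto simp: G_def S2_def)
  have g5: "h\<^sup>2 / 2 \<le> measure lborel (cell h k \<inter> T)" if "s \<in> G" "k \<in> block s" for s k
  proof -
    have "k \<in> K" "k \<notin> bad" using that blockK[of s] by (auto simp: G_def S1_def)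
    then show ?thesis by (auto simp: bad_def)
  qed
  show ?thesis by (rule that[OF g12 g3 g4 g5])
qed

lemma cells_Int_cell: "k \<notin> K \<Longrightarrow> cells h K \<inter> cell h k = {}"
  by (auto simp: cells_def cell_def)

lemma hole_if_occupancy:
  assumes "\<omega> \<in> occupancy P x n (cells h (inner_cells s)) (cell h) (ring_cells s)"
  shows "hole h ((\<lambda>j. x j \<omega>) ` {1..n}) s"
  using assms unfolding occupancy_def hole_def cells_def cell_def by blast

text \<open>\<open>g s\<close> is the probability of a hole for cells occupied independently, as by
  a Poisson process. It is at least the constant \<open>c\<close>, while all errors have order
  \<open>1 / N\<^sup>2\<close>. So a number of holes of order \<open>N\<^sup>2\<close> is expected,
  and its squared deviation has a mean of order \<open>N\<^sup>2\<close> only.\<close>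

lemma many_persistent_components:
  fixes x :: "nat \<Rightarrow> 'w \<Rightarrow> real ^ 2"
  assumes iid: "iid_samples \<mu> P x" and h: "h > 0" and N: "N > 0" and n: "n > 0" "n \<le> 4 * N\<^sup>2"
    and G: "finite G" "card G \<le> N\<^sup>2" "real N ^ 2 / 2 \<le> real (card G)"
    and light: "\<And>s. s \<in> G \<Longrightarrow> measure \<mu> (cells h (block s)) \<le> 4 / real N ^ 2"
    and heavy: "\<And>s k. s \<in> G \<Longrightarrow> k \<in> block s \<Longrightarrow> \<rho> \<le> real n * measure \<mu> (cell h k)" and \<rho>: "\<rho> > 0"
  defines "c \<equiv> exp (- 16) * (1 - exp (- \<rho>)) ^ 36"
  obtains B where "B \<in> sets P" "measure P B \<le> 16 * (1 + 3 * 2 ^ 80) / c\<^sup>2 / real N ^ 2"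
    "\<And>\<omega>. \<omega> \<in> space P \<Longrightarrow> \<omega> \<notin> B \<Longrightarrow>
      c * real N ^ 2 / 4 \<le> real (card (persistent_components ((\<lambda>j. x j \<omega>) ` {1..n}) (3 / 2 * h) (2 * h)))"
proof -
  interpret prob_space P using iid by (simp add: iid_samples_def)
  have x: "x j \<in> borel_measurable P" "distr P borel (x j) = \<mu>" for j
    using iid by (simp_all add: iid_samples_def)
  interpret \<mu>: prob_space \<mu> using prob_space_distr[OF x(1)[of 0]] x(2)[of 0] by simp
  have s\<mu>: "sets \<mu> = sets borel" using x(2)[of 0] by (metis sets_distr)
  note mc = measure_cells[OF h _ s\<mu> \<mu>.finite_measure_axioms]
  define q where "q = 1 - exp (- \<rho>)"
  have q: "0 < q" "q \<le> 1" using \<rho> by (simp_all add: q_def)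
  have c: "c = exp (- 16) * q ^ 36" "0 < c" using q by (simp_all add: c_def q_def)
  let ?A = "\<lambda>s. occupancy P x n (cells h (inner_cells s)) (cell h) (ring_cells s)"
  define e where "e s = measure \<mu> (cells h (inner_cells s))" for s
  define r where "r k = 1 - exp (- (real n * measure \<mu> (cell h k)))" for k
  define g where "g s = exp (- (real n * e s)) * (\<Prod>k\<in>ring_cells s. r k)" for s
  have r: "0 \<le> r k" "r k \<le> 1" for k by (simp_all add: r_def)
  have e0: "0 \<le> e s" for s by (simp add: e_def)
  have blk: "e s + (\<Sum>k\<in>ring_cells s. measure \<mu> (cell h k)) = measure \<mu> (cells h (block s))" for s
    unfolding e_def mc[OF block_finite(1)] mc[OF block_finite(2)] ring_cells_def
    using sum.subset_diff[OF inner_cells_subset[of s] block_finite(1)[of s], of "\<lambda>k. measure \<mu> (cell h k)"] by linarith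
  have v: "e s + (\<Sum>k\<in>ring_cells s. measure \<mu> (cell h k)) \<le> 4 / real N ^ 2" if "s \<in> G" for s
    using light[OF that] blk[of s] by linarith
  have nR: "real n \<le> 4 * real N ^ 2" using n(2) by (metis of_nat_le_iff of_nat_mult of_nat_numeral of_nat_power)
  have N2: "real N ^ 2 > 0" using N by simp
  have g01: "0 \<le> g s \<and> g s \<le> 1" for s
    using r e0[of s] unfolding g_def by (intro conjI mult_nonneg_nonneg mult_le_one prod_nonneg prod_le_1) auto
  \<comment> \<open>The exponent is at most \<open>16 = 4 * 4\<close>, from
    \<open>n \<le> 4 * N\<^sup>2\<close> and a mass of at most \<open>4 / N\<^sup>2\<close>;
    \<open>36\<close> is the number of cells of a block, which bounds that of the ring.\<close>
  have gc: "c \<le> g s" if s: "s \<in> G" for s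
  proof -
    have "e s \<le> 4 / real N ^ 2" using v[OF s] sum_nonneg[of "ring_cells s" "\<lambda>k. measure \<mu> (cell h k)"] by simp
    then have "real n * e s \<le> (4 * real N ^ 2) * (4 / real N ^ 2)" using nR e0[of s] N2 by (intro mult_mono) auto
    then have 1: "exp (- 16) \<le> exp (- (real n * e s))" using N2 by simp
    have "q ^ card (ring_cells s) = (\<Prod>k\<in>ring_cells s. q)" by simp
    also have "\<dots> \<le> (\<Prod>k\<in>ring_cells s. r k)"
      using q heavy[OF s] by (intro prod_mono) (auto simp: q_def r_def ring_cells_def)
    finally have "q ^ card (ring_cells s) \<le> (\<Prod>k\<in>ring_cells s. r k)" .
    moreover have "q ^ 36 \<le> q ^ card (ring_cells s)" using q card_ring_cells_le[of s] by (intro power_decreasing) auto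
    ultimately have 2: "q ^ 36 \<le> (\<Prod>k\<in>ring_cells s. r k)" by linarith
    show ?thesis unfolding c g_def using 1 2 q by (intro mult_mono) auto
  qed
  \<comment> \<open>\<open>2 ^ 72\<close> covers the doublings for two rings of at most
    \<open>36\<close> cells each, and \<open>2 ^ 8 = 4 * 8\<^sup>2\<close> comes from
    \<open>n \<le> 4 * N\<^sup>2\<close> and a total mass of at most
    \<open>8 / N\<^sup>2\<close>.\<close>
  define \<kappa> where "\<kappa> = 2 ^ 80 / real N ^ 2"
  have bnd: "2 ^ a * (real n * (d / real N ^ 2)\<^sup>2) \<le> \<kappa>" if "a \<le> 72" "0 \<le> d" "d \<le> 8" for a :: nat and d :: real
  proof -
    have "d\<^sup>2 \<le> 8\<^sup>2" using that by (intro power_mono) auto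
    then have "real n * d\<^sup>2 \<le> (4 * real N ^ 2) * 64" using nR by (intro mult_mono) auto
    then have "(real n * d\<^sup>2) / (real N ^ 2)\<^sup>2 \<le> ((4 * real N ^ 2) * 64) / (real N ^ 2)\<^sup>2" by (rule divide_right_mono) simp
    then have "real n * (d / real N ^ 2)\<^sup>2 \<le> 2 ^ 8 / real N ^ 2"
      using N by (simp add: power_divide power2_eq_square)
    moreover have "(2::real) ^ a \<le> 2 ^ 72" using that(1) by (intro power_increasing) auto
    ultimately have "2 ^ a * (real n * (d / real N ^ 2)\<^sup>2) \<le> 2 ^ 72 * (2 ^ 8 / real N ^ 2)" by (intro mult_mono) auto
    then show ?thesis by (simp add: \<kappa>_def)
  qed
  have near: "\<bar>measure P (?A s) - g s\<bar> \<le> \<kappa>" if s: "s \<in> G" for s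
  proof -
    have "\<bar>measure P (?A s) - g s\<bar> \<le> 2 ^ card (ring_cells s) * (real n * (4 / real N ^ 2)\<^sup>2)"
      unfolding g_def r_def e_def
      using v[OF s] unfolding e_def
      by (intro prob_occupancy[OF iid block_finite(3) cells_borel[OF h block_finite(2)] cell_borel[OF h]]
          cells_Int_cell disjoint_cells) (auto simp: ring_cells_def)
    also have "\<dots> \<le> \<kappa>" using card_ring_cells_le[of s] by (intro bnd) auto
    finally show ?thesis .
  qed
  have near2: "\<bar>measure P (?A s \<inter> ?A s') - g s * g s'\<bar> \<le> \<kappa>" if s: "s \<in> G" "s' \<in> G" "s \<noteq> s'" for s s'
  proof -
    note d = block_disjoint[OF s(3)]
    let ?I = "inner_cells s \<union> inner_cells s'" and ?R = "ring_cells s \<union> ring_cells s'"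
    have di: "inner_cells s \<inter> inner_cells s' = {}" "ring_cells s \<inter> ring_cells s' = {}"
      using d inner_cells_subset unfolding ring_cells_def by blast+
    have eI: "measure \<mu> (cells h ?I) = e s + e s'"
      unfolding e_def using block_finite(2)[of s] block_finite(2)[of s'] di(1) by (simp add: mc sum.union_disjoint)
    have sR: "(\<Sum>k\<in>?R. measure \<mu> (cell h k)) =
        (\<Sum>k\<in>ring_cells s. measure \<mu> (cell h k)) + (\<Sum>k\<in>ring_cells s'. measure \<mu> (cell h k))"
      by (rule sum.union_disjoint[OF block_finite(3) block_finite(3) di(2)])
    have pR: "(\<Prod>k\<in>?R. r k) = (\<Prod>k\<in>ring_cells s. r k) * (\<Prod>k\<in>ring_cells s'. r k)"
      by (rule prod.union_disjoint[OF block_finite(3) block_finite(3) di(2)])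
    have "exp (- (real n * (e s + e s'))) = exp (- (real n * e s)) * exp (- (real n * e s'))"
      by (simp add: mult_exp_exp algebra_simps)
    then have gg: "g s * g s' = exp (- (real n * measure \<mu> (cells h ?I))) * (\<Prod>k\<in>?R. r k)"
      unfolding g_def eI pR by simp
    \<comment> \<open>Two holes at once form a single occupancy event, so the same estimate gives
      their joint probability.\<close>
    have A: "?A s \<inter> ?A s' = occupancy P x n (cells h ?I) (cell h) ?R"
      unfolding occupancy_def cells_def by blast
    have fR: "finite ?R" "finite ?I" using block_finite by auto
    have dRI: "k \<notin> ?I" if "k \<in> ?R" for k
      using that d inner_cells_subset unfolding ring_cells_def by blast
    have vv: "measure \<mu> (cells h ?I) + (\<Sum>k\<in>?R. measure \<mu> (cell h k)) \<le> 8 / real N ^ 2"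
      using v[OF s(1)] v[OF s(2)] unfolding eI sR by (simp add: add_divide_distrib)
    have "\<bar>measure P (occupancy P x n (cells h ?I) (cell h) ?R) -
        exp (- (real n * measure \<mu> (cells h ?I))) * (\<Prod>k\<in>?R. 1 - exp (- (real n * measure \<mu> (cell h k))))\<bar>
        \<le> 2 ^ card ?R * (real n * (8 / real N ^ 2)\<^sup>2)"
      by (rule prob_occupancy[OF iid fR(1) cells_borel[OF h fR(2)] cell_borel[OF h] cells_Int_cell[OF dRI] disjoint_cells vv])
    moreover have "card ?R \<le> 72" using card_Un_le[of "ring_cells s" "ring_cells s'"] card_ring_cells_le[of s] card_ring_cells_le[of s'] by linarith
    then have "2 ^ card ?R * (real n * (8 / real N ^ 2)\<^sup>2) \<le> \<kappa>" by (intro bnd) auto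
    ultimately show ?thesis unfolding A gg r_def by linarith
  qed
  have As: "?A s \<in> sets P" for s
    by (intro occupancy_sets x(1) cells_borel[OF h] block_finite cell_borel[OF h])
  define m where "m = c * real N ^ 2 / 2"
  have m: "0 < m" "m \<le> sum g G"
  proof -
    show "0 < m" using c N2 by (simp add: m_def)
    have "m = real N ^ 2 / 2 * c" by (simp add: m_def)
    also have "\<dots> \<le> real (card G) * c" using G(3) c by (intro mult_right_mono) auto
    also have "\<dots> \<le> sum g G" by (rule sum_bounded_below) (rule gc)
    finally show "m \<le> sum g G" .
  qed
  define B where "B = {\<omega> \<in> space P. real (card {s \<in> G. \<omega> \<in> ?A s}) \<le> m / 2}"
  have "real (card {s \<in> G. \<omega> \<in> ?A s}) = (\<Sum>s\<in>G. indicator (?A s) \<omega>)" for \<omega>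
    using G(1) by (simp add: indicator_def sum.If_cases Int_def)
  then have "B = {\<omega> \<in> space P. (\<Sum>s\<in>G. indicator (?A s) \<omega>) \<le> m / 2}" by (simp add: B_def)
  moreover have "(\<lambda>\<omega>. \<Sum>s\<in>G. indicator (?A s) \<omega> :: real) \<in> borel_measurable P"
    using As by (intro borel_measurable_sum borel_measurable_indicator)
  ultimately have Bs: "B \<in> sets P" by simp
  have "measure P B \<le> 4 * (real (card G) + 3 * \<kappa> * (real (card G))\<^sup>2) / m\<^sup>2"
    unfolding B_def by (rule sum_indicator_deviation[OF G(1) As g01 near near2 m])
  also have "\<dots> \<le> 4 * (real N ^ 2 + 3 * \<kappa> * (real N ^ 2)\<^sup>2) / m\<^sup>2"
  proof -
    have "real (card G) \<le> real N ^ 2" using G(2) by (metis of_nat_le_iff of_nat_power)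
    then show ?thesis
      by (intro divide_right_mono mult_left_mono add_mono power_mono) (auto simp: \<kappa>_def)
  qed
  also have "\<dots> = 16 * (1 + 3 * 2 ^ 80) / c\<^sup>2 / real N ^ 2"
    using N c(2) by (simp add: m_def \<kappa>_def field_simps power2_eq_square)
  finally have pB: "measure P B \<le> 16 * (1 + 3 * 2 ^ 80) / c\<^sup>2 / real N ^ 2" .
  have "c * real N ^ 2 / 4 \<le> real (card (persistent_components ((\<lambda>j. x j \<omega>) ` {1..n}) (3 / 2 * h) (2 * h)))"
    if \<omega>: "\<omega> \<in> space P" "\<omega> \<notin> B" for \<omega>
  proof -
    have "card {s \<in> G. \<omega> \<in> ?A s} \<le> card (persistent_components ((\<lambda>j. x j \<omega>) ` {1..n}) (3 / 2 * h) (2 * h))"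
    proof (rule card_holes_le[OF h])
      show "(\<lambda>j. x j \<omega>) ` {1..n} \<noteq> {}" using n(1) by simp
      show "hole h ((\<lambda>j. x j \<omega>) ` {1..n}) s" if "s \<in> {s \<in> G. \<omega> \<in> ?A s}" for s
        using that by (intro hole_if_occupancy) blast
    qed simp
    moreover have "m / 2 < real (card {s \<in> G. \<omega> \<in> ?A s})" using \<omega> by (simp add: B_def)
    ultimately show ?thesis by (simp add: m_def)
  qed
  then show ?thesis using that Bs pB by blast
qed

section \<open>The lower bound in probability\<close>

lemma E_sum_lower_in_probability:
  fixes \<mu> :: "(real ^ 2) measure"
  assumes \<mu>: "prob_space \<mu>" "sets \<mu> = sets borel" "locally_bounded \<mu>" and \<alpha>: "0 < \<alpha>" "\<alpha> \<le> 2"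
  obtains \<gamma> C where "0 < \<gamma>"
    "\<And>(P :: 'w measure) x n. iid_samples \<mu> P x \<Longrightarrow> n > 0 \<Longrightarrow> \<exists>B\<in>sets P. measure P B \<le> C / real n \<and>
      (\<forall>\<omega>\<in>space P - B. \<gamma> \<le> real n powr (- ((2 - \<alpha>) / 2)) * E_sum TYPE('k::field) 1 \<alpha> ((\<lambda>j. x j \<omega>) ` {1..n}))"
proof -
  interpret \<mu>: prob_space \<mu> by fact
  obtain A a0 a1 where A: "A \<in> sets lebesgue" "emeasure lebesgue A > 0" and a0: "0 < a0"
    and dens: "\<And>B. B \<in> sets borel \<Longrightarrow> B \<subseteq> A \<Longrightarrow> ennreal a0 * emeasure lborel B \<le> emeasure \<mu> B"
    using \<mu>(3) unfolding locally_bounded_def by blast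
  obtain L p T where L: "L > 0" and T: "compact T" "T \<subseteq> A"
    and full: "measure lborel (cell L p - T) \<le> 1 / 288 * L\<^sup>2"
    by (rule nearly_full_cell[OF A, of "1 / 288"]) auto
  have Tb: "T \<in> sets borel" using T(1) by (simp add: compact_imp_closed)
  \<comment> \<open>A usable cell expects at least \<open>N\<^sup>2 * a0 * h\<^sup>2 / 2\<close>
    samples, which equals \<open>\<rho>\<close> because \<open>h = L / (6 * N)\<close>.\<close>
  define \<rho> where "\<rho> = a0 * L\<^sup>2 / 72"
  have \<rho>: "\<rho> > 0" using a0 L by (simp add: \<rho>_def)
  define c where "c = exp (- 16) * (1 - exp (- \<rho>)) ^ 36"
  have c: "c > 0" using \<rho> by (simp add: c_def)
  \<comment> \<open>The factor \<open>4\<close> turns \<open>1 / N\<^sup>2\<close> into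
    \<open>1 / n\<close>, as \<open>n \<le> 4 * N\<^sup>2\<close>.\<close>
  define C where "C = 4 * (16 * (1 + 3 * 2 ^ 80) / c\<^sup>2)"
  \<comment> \<open>There will be \<open>c * N\<^sup>2 / 4\<close> intervals of length at least
    \<open>h / 2 = L / (12 * N)\<close>; the last factor pays for replacing \<open>N\<close> by
    \<open>sqrt n\<close>, which is at most \<open>2 * N\<close>.\<close>
  define \<gamma> where "\<gamma> = c / 4 * (L / 12) powr \<alpha> * 2 powr (\<alpha> - 2)"
  have \<gamma>: "0 < \<gamma>" using c L by (simp add: \<gamma>_def)
  have "\<exists>B\<in>sets P. measure P B \<le> C / real n \<and>
      (\<forall>\<omega>\<in>space P - B. \<gamma> \<le> real n powr (- ((2 - \<alpha>) / 2)) * E_sum TYPE('k) 1 \<alpha> ((\<lambda>j. x j \<omega>) ` {1..n}))"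
    if iid: "iid_samples \<mu> P x" and n: "n > 0" for P :: "'w measure" and x n
  proof -
    \<comment> \<open>\<open>N\<^sup>2 \<le> n \<le> 4 * N\<^sup>2\<close>, so that a usable cell
      expects a number of samples that is bounded above and below.\<close>
    define N where "N = nat \<lfloor>sqrt (real n)\<rfloor>"
    have "1 \<le> sqrt (real n)" using n by simp
    then have N1: "1 \<le> \<lfloor>sqrt (real n)\<rfloor>" by (simp add: le_floor_iff)
    then have N: "N > 0" by (simp add: N_def)
    have Nr: "real N = of_int \<lfloor>sqrt (real n)\<rfloor>" using N1 by (simp add: N_def)
    have s1: "real N \<le> sqrt (real n)" unfolding Nr by linarith
    have s2: "sqrt (real n) \<le> 2 * real N"
      using real_of_int_floor_add_one_gt[of "sqrt (real n)"] N unfolding Nr[symmetric] by linarith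
    have n1: "real N ^ 2 \<le> real n" using power_mono[OF s1, of 2] by simp
    have n2: "real n \<le> 4 * real N ^ 2" using power_mono[OF s2, of 2] by (simp add: power_mult_distrib)
    then have n3: "n \<le> 4 * N\<^sup>2" by (metis of_nat_le_iff of_nat_mult of_nat_numeral of_nat_power)
    have N2: "real N ^ 2 > 0" using N by simp
    define h where "h = L / (6 * real N)"
    have h: "h > 0" using L N by (simp add: h_def)
    obtain G where G: "finite G" "card G \<le> N\<^sup>2" "real N ^ 2 / 2 \<le> real (card G)"
      "\<And>s. s \<in> G \<Longrightarrow> measure \<mu> (cells h (block s)) \<le> 4 / real N ^ 2"
      "\<And>s k. s \<in> G \<Longrightarrow> k \<in> block s \<Longrightarrow> h\<^sup>2 / 2 \<le> measure lborel (cell h k \<inter> T)"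
      unfolding h_def by (rule usable_squares[OF \<mu>(1,2) L Tb full N]) blast
    have heavy: "\<rho> \<le> real n * measure \<mu> (cell h k)" if "s \<in> G" "k \<in> block s" for s k
    proof -
      have bT: "cell h k \<inter> T \<in> sets borel" using cell_borel[OF h] Tb by blast
      have fm: "cell h k \<inter> T \<in> fmeasurable lborel"
        by (rule fmeasurable_Int_fmeasurable[OF fmeasurable_cell[OF h]]) (use Tb in simp)
      have "ennreal a0 * emeasure lborel (cell h k \<inter> T) \<le> emeasure \<mu> (cell h k \<inter> T)"
        using dens[OF bT] T(2) by blast
      also have "\<dots> \<le> emeasure \<mu> (cell h k)" using cell_borel[OF h] \<mu>(2) by (intro emeasure_mono) auto
      finally have "ennreal (a0 * measure lborel (cell h k \<inter> T)) \<le> ennreal (measure \<mu> (cell h k))"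
        using a0 emeasure_eq_measure2[OF fm] by (simp add: ennreal_mult \<mu>.emeasure_eq_measure)
      then have "a0 * measure lborel (cell h k \<inter> T) \<le> measure \<mu> (cell h k)" by simp
      moreover have "a0 * (h\<^sup>2 / 2) \<le> a0 * measure lborel (cell h k \<inter> T)"
        using G(5)[OF that] a0 by (intro mult_left_mono) auto
      ultimately have "a0 * (h\<^sup>2 / 2) \<le> measure \<mu> (cell h k)" by linarith
      then have "real N ^ 2 * (a0 * (h\<^sup>2 / 2)) \<le> real n * measure \<mu> (cell h k)"
        using n1 a0 by (intro mult_mono) auto
      moreover have "real N ^ 2 * (a0 * (h\<^sup>2 / 2)) = \<rho>"
        using N by (simp add: \<rho>_def h_def power_divide power_mult_distrib)
      ultimately show ?thesis by linarith
    qed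
    obtain B where B: "B \<in> sets P" "measure P B \<le> 16 * (1 + 3 * 2 ^ 80) / c\<^sup>2 / real N ^ 2"
      "\<And>\<omega>. \<omega> \<in> space P \<Longrightarrow> \<omega> \<notin> B \<Longrightarrow>
        c * real N ^ 2 / 4 \<le> real (card (persistent_components ((\<lambda>j. x j \<omega>) ` {1..n}) (3 / 2 * h) (2 * h)))"
      unfolding c_def by (rule many_persistent_components[OF iid h N n n3 G(1-4) heavy \<rho>]) blast+
    have "measure P B \<le> C / real n"
    proof -
      have "16 * (1 + 3 * 2 ^ 80) / c\<^sup>2 / real N ^ 2 \<le> 16 * (1 + 3 * 2 ^ 80) / c\<^sup>2 / (real n / 4)"
        using n2 n N by (intro divide_left_mono mult_pos_pos) auto
      also have "\<dots> = C / real n" unfolding C_def by simp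
      finally show ?thesis using B(2) by linarith
    qed
    moreover have "\<gamma> \<le> real n powr (- ((2 - \<alpha>) / 2)) * E_sum TYPE('k) 1 \<alpha> ((\<lambda>j. x j \<omega>) ` {1..n})"
      if \<omega>: "\<omega> \<in> space P - B" for \<omega>
    proof -
      let ?X = "(\<lambda>j. x j \<omega>) ` {1..n}"
      let ?E = "E_sum TYPE('k) 1 \<alpha> ?X"
      have "real (card (persistent_components ?X (3 / 2 * h) (2 * h))) * (2 * h - 3 / 2 * h) powr \<alpha> \<le> ?E"
        using h n by (intro E_sum_ge \<alpha>(1)) auto
      moreover have "c * real N ^ 2 / 4 * (h / 2) powr \<alpha> \<le>
          real (card (persistent_components ?X (3 / 2 * h) (2 * h))) * (h / 2) powr \<alpha>"
        using B(3)[of \<omega>] \<omega> by (intro mult_right_mono) auto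
      ultimately have lo: "c * real N ^ 2 / 4 * (h / 2) powr \<alpha> \<le> ?E" by simp
      have "(h / 2) powr \<alpha> = (L / 12 * (1 / real N)) powr \<alpha>" by (simp add: h_def)
      also have "\<dots> = (L / 12) powr \<alpha> * real N powr (- \<alpha>)"
        using L N by (subst powr_mult) (auto simp: powr_divide powr_minus_divide)
      finally have hp: "(h / 2) powr \<alpha> = (L / 12) powr \<alpha> * real N powr (- \<alpha>)" .
      have NN: "real N ^ 2 * real N powr (- \<alpha>) = real N powr (2 - \<alpha>)"
        using N by (simp add: powr_diff powr_minus_divide)
      have npow: "real n powr (- ((2 - \<alpha>) / 2)) = sqrt (real n) powr (\<alpha> - 2)"
        by (simp add: powr_half_sqrt[symmetric] powr_powr diff_divide_distrib)
      have key: "2 powr (\<alpha> - 2) \<le> sqrt (real n) powr (\<alpha> - 2) * real N powr (2 - \<alpha>)"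
      proof -
        \<comment> \<open>The exponent \<open>\<alpha> - 2\<close> is not positive, so
          \<open>u = 2\<close> is the worst case.\<close>
        define u where "u = sqrt (real n) / real N"
        have u: "1 \<le> u" "u \<le> 2" using s1 s2 N by (auto simp: u_def pos_le_divide_eq pos_divide_le_eq)
        have e: "sqrt (real n) powr (\<alpha> - 2) * real N powr (2 - \<alpha>) = u powr (\<alpha> - 2)"
          unfolding u_def using N n powr_minus_divide[of "real N" "\<alpha> - 2"]
          by (simp add: powr_divide)
        show ?thesis unfolding e using u \<alpha>(2) by (intro powr_mono2') auto
      qed
      have "\<gamma> \<le> c / 4 * (L / 12) powr \<alpha> * (sqrt (real n) powr (\<alpha> - 2) * real N powr (2 - \<alpha>))"
        unfolding \<gamma>_def using c by (intro mult_left_mono key) auto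
      also have "\<dots> = real n powr (- ((2 - \<alpha>) / 2)) * (c * real N ^ 2 / 4 * (h / 2) powr \<alpha>)"
        unfolding hp npow NN[symmetric] by simp
      also have "\<dots> \<le> real n powr (- ((2 - \<alpha>) / 2)) * ?E"
        by (intro mult_left_mono lo) simp
      finally show ?thesis .
    qed
    ultimately show ?thesis using B(1) by blast
  qed
  then show ?thesis using that \<gamma> by blast
qed

section \<open>Almost sure confinement to a disc and the two limits\<close>

lemma compactly_supported_cball:
  fixes \<mu> :: "'a::euclidean_space measure"
  assumes "compactly_supported \<mu>" "sets \<mu> = sets borel"
  obtains R where "R \<ge> 0" "emeasure \<mu> (- cball 0 R) = 0"
proof -
  obtain C where C: "compact C" "emeasure \<mu> (- C) = 0" using assms(1) by (auto simp: compactly_supported_def)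
  obtain R where R: "\<And>x. x \<in> C \<Longrightarrow> norm x \<le> R" using compact_imp_bounded[OF C(1)] by (auto simp: bounded_iff)
  have "emeasure \<mu> (- cball 0 (max 0 R)) \<le> emeasure \<mu> (- C)"
    using R C(1) assms(2) by (intro emeasure_mono) (force simp: compact_imp_closed)+
  then show ?thesis using C(2) that[of "max 0 R"] by simp
qed

lemma AE_samples_cball:
  fixes x :: "nat \<Rightarrow> 'w \<Rightarrow> 'a::euclidean_space"
  assumes iid: "iid_samples \<mu> P x" and R: "emeasure \<mu> (- cball 0 R) = 0"
  shows "AE \<omega> in P. \<forall>j. x j \<omega> \<in> cball 0 R"
proof -
  have "AE \<omega> in P. x j \<omega> \<in> cball 0 R" for j
  proof (rule AE_I[where N = "x j -` (- cball 0 R) \<inter> space P"])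
    have x: "x j \<in> borel_measurable P" "distr P borel (x j) = \<mu>" using iid by (simp_all add: iid_samples_def)
    have b: "- cball 0 R \<in> sets (borel :: 'a measure)" by simp
    show "emeasure P (x j -` (- cball 0 R) \<inter> space P) = 0"
      using emeasure_distr[OF x(1) b] x(2) R by simp
    show "x j -` (- cball 0 R) \<inter> space P \<in> sets P" by (rule measurable_sets[OF x(1) b])
  qed auto
  then show ?thesis by (simp add: AE_all_countable)
qed

theorem theorem4:
  fixes \<mu> :: "(real ^ 2) measure"
  assumes "prob_space \<mu>" and "sets \<mu> = sets borel"
    and "compactly_supported \<mu>" and "locally_bounded \<mu>"
  shows
    "(\<forall>\<alpha>::real. 0 < \<alpha> \<and> \<alpha> < 2 \<longrightarrow>
        (\<exists>\<gamma> \<Gamma> :: real. 0 < \<gamma> \<and> \<gamma> \<le> \<Gamma> \<and>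
           (\<forall>(P :: 'w measure) x. iid_samples \<mu> P x \<longrightarrow>
              ((\<lambda>n. measure P {\<omega> \<in> space P.
                   \<gamma> \<le> real n powr (- ((2 - \<alpha>) / 2)) * E_sum TYPE('k::field) 1 \<alpha> ((\<lambda>j. x j \<omega>) ` {1..n}) \<and>
                   real n powr (- ((2 - \<alpha>) / 2)) * E_sum TYPE('k) 1 \<alpha> ((\<lambda>j. x j \<omega>) ` {1..n}) \<le> \<Gamma>})
                 \<longlonglongrightarrow> 1) \<and>
              (AE \<omega> in P.
                 limsup (\<lambda>n. ereal (real n powr (- ((2 - \<alpha>) / 2)) *
                   E_sum TYPE('k) 1 \<alpha> ((\<lambda>j. x j \<omega>) ` {1..n}))) \<le> ereal \<Gamma>)))) \<and>
     (\<exists>D :: real. \<forall>(P :: 'w measure) x. iid_samples \<mu> P x \<longrightarrow>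
        (AE \<omega> in P.
           limsup (\<lambda>n. ereal (1 / ln (real n) * E_sum TYPE('k) 1 2 ((\<lambda>j. x j \<omega>) ` {1..n})))
             \<le> ereal D))"
proof -
  obtain R where R: "R \<ge> 0" "emeasure \<mu> (- cball 0 R) = 0"
    using compactly_supported_cball[OF assms(3,2)] by blast
  have card: "card ((\<lambda>j. x j \<omega>) ` {1..n}) \<le> n" for x :: "nat \<Rightarrow> 'w \<Rightarrow> real ^ 2" and \<omega> n
    using card_image_le[of "{1..n}" "\<lambda>j. x j \<omega>"] by simp
  have part1: "\<exists>\<gamma> \<Gamma> :: real. 0 < \<gamma> \<and> \<gamma> \<le> \<Gamma> \<and>
           (\<forall>(P :: 'w measure) x. iid_samples \<mu> P x \<longrightarrow>
              ((\<lambda>n. measure P {\<omega> \<in> space P.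
                   \<gamma> \<le> real n powr (- ((2 - \<alpha>) / 2)) * E_sum TYPE('k::field) 1 \<alpha> ((\<lambda>j. x j \<omega>) ` {1..n}) \<and>
                   real n powr (- ((2 - \<alpha>) / 2)) * E_sum TYPE('k) 1 \<alpha> ((\<lambda>j. x j \<omega>) ` {1..n}) \<le> \<Gamma>})
                 \<longlonglongrightarrow> 1) \<and>
              (AE \<omega> in P.
                 limsup (\<lambda>n. ereal (real n powr (- ((2 - \<alpha>) / 2)) *
                   E_sum TYPE('k) 1 \<alpha> ((\<lambda>j. x j \<omega>) ` {1..n}))) \<le> ereal \<Gamma>))"
    if \<alpha>: "0 < \<alpha>" "\<alpha> < 2" for \<alpha> :: real
  proof -
    obtain \<gamma> C where \<gamma>: "0 < \<gamma>" and low: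
      "\<And>(P :: 'w measure) x n. iid_samples \<mu> P x \<Longrightarrow> n > 0 \<Longrightarrow> \<exists>B\<in>sets P. measure P B \<le> C / real n \<and>
        (\<forall>\<omega>\<in>space P - B. \<gamma> \<le> real n powr (- ((2 - \<alpha>) / 2)) * E_sum TYPE('k) 1 \<alpha> ((\<lambda>j. x j \<omega>) ` {1..n}))"
      using E_sum_lower_in_probability[where 'k = 'k and 'w = 'w, OF assms(1,2,4) \<alpha>(1) less_imp_le[OF \<alpha>(2)]] by blast
    \<comment> \<open>The maximum with \<open>\<gamma>\<close> ensures
      \<open>\<gamma> \<le> \<Gamma>\<close>.\<close>
    define \<Gamma> where "\<Gamma> = max \<gamma> ((100 * R\<^sup>2) powr (\<alpha> / 2) * (2 powr (1 - \<alpha> / 2) / (1 - \<alpha> / 2)))"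
    let ?Z = "\<lambda>(x :: nat \<Rightarrow> 'w \<Rightarrow> real ^ 2) n \<omega>.
      real n powr (- ((2 - \<alpha>) / 2)) * E_sum TYPE('k) 1 \<alpha> ((\<lambda>j. x j \<omega>) ` {1..n})"
    \<comment> \<open>The upper bound is deterministic once all samples lie in the disc, so the
      limit superior needs no Borel-Cantelli argument.\<close>
    have up: "?Z x n \<omega> \<le> \<Gamma>" if "n > 0" "\<forall>j. x j \<omega> \<in> cball 0 R" for x :: "nat \<Rightarrow> 'w \<Rightarrow> real ^ 2" and n \<omega>
    proof -
      have "?Z x n \<omega> \<le> (100 * R\<^sup>2) powr (\<alpha> / 2) * (2 powr (1 - \<alpha> / 2) / (1 - \<alpha> / 2))"
        by (rule E_sum_upper[OF _ _ _ \<alpha> card that(1)]) (use that in auto)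
      then show ?thesis unfolding \<Gamma>_def le_max_iff_disj by (rule disjI2)
    qed
    have "((\<lambda>n. measure P {\<omega> \<in> space P. \<gamma> \<le> ?Z x n \<omega> \<and> ?Z x n \<omega> \<le> \<Gamma>}) \<longlonglongrightarrow> 1) \<and>
        (AE \<omega> in P. limsup (\<lambda>n. ereal (?Z x n \<omega>)) \<le> ereal \<Gamma>)"
      if iid: "iid_samples \<mu> P x" for P :: "'w measure" and x
    proof
      interpret prob_space P using iid by (simp add: iid_samples_def)
      have x: "x j \<in> borel_measurable P" for j using iid by (simp add: iid_samples_def)
      have ae: "AE \<omega> in P. \<forall>j. x j \<omega> \<in> cball 0 R" by (rule AE_samples_cball[OF iid R(2)])
      show "AE \<omega> in P. limsup (\<lambda>n. ereal (?Z x n \<omega>)) \<le> ereal \<Gamma>"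
        using ae
      proof eventually_elim
        case (elim \<omega>)
        have "eventually (\<lambda>n. ereal (?Z x n \<omega>) \<le> ereal \<Gamma>) sequentially"
          using eventually_gt_at_top[of 0] by eventually_elim (use up[of _ x \<omega>] elim in simp)
        then show ?case by (rule Limsup_bounded)
      qed
      have lo: "1 - C / real n \<le> measure P {\<omega> \<in> space P. \<gamma> \<le> ?Z x n \<omega> \<and> ?Z x n \<omega> \<le> \<Gamma>}" if n: "n > 0" for n
      proof -
        obtain B where B: "B \<in> sets P" "measure P B \<le> C / real n" "\<forall>\<omega>\<in>space P - B. \<gamma> \<le> ?Z x n \<omega>"
          using low[OF iid n] by blast
        \<comment> \<open>If the event were not measurable, its \<open>measure\<close> would be zero
          by convention, and the comparison with the complement of \<open>B\<close> would
          fail.\<close>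
        have Z: "?Z x n \<in> borel_measurable P"
          using n by (intro borel_measurable_times borel_measurable_const measurable_E_sum x) auto
        have "1 - C / real n \<le> prob (space P - B)" using B(1,2) prob_compl by simp
        also have "\<dots> \<le> prob {\<omega> \<in> space P. \<gamma> \<le> ?Z x n \<omega> \<and> ?Z x n \<omega> \<le> \<Gamma>}"
        proof (rule finite_measure_mono_AE)
          show "AE \<omega> in P. \<omega> \<in> space P - B \<longrightarrow> \<omega> \<in> {\<omega> \<in> space P. \<gamma> \<le> ?Z x n \<omega> \<and> ?Z x n \<omega> \<le> \<Gamma>}"
            using ae by eventually_elim (use B(3) up[OF n, of x] in blast)
          show "{\<omega> \<in> space P. \<gamma> \<le> ?Z x n \<omega> \<and> ?Z x n \<omega> \<le> \<Gamma>} \<in> sets P" using Z by measurable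
        qed
        finally show ?thesis .
      qed
      show "(\<lambda>n. measure P {\<omega> \<in> space P. \<gamma> \<le> ?Z x n \<omega> \<and> ?Z x n \<omega> \<le> \<Gamma>}) \<longlonglongrightarrow> 1"
      proof (rule tendsto_sandwich)
        show "eventually (\<lambda>n. 1 - C / real n \<le> measure P {\<omega> \<in> space P. \<gamma> \<le> ?Z x n \<omega> \<and> ?Z x n \<omega> \<le> \<Gamma>}) sequentially"
          using eventually_gt_at_top[of 0] by eventually_elim (rule lo)
        have "(\<lambda>n. 1 - C / real n) \<longlonglongrightarrow> 1 - 0" by (intro tendsto_intros lim_const_over_n)
        then show "(\<lambda>n. 1 - C / real n) \<longlonglongrightarrow> 1" by simp
      qed (use prob_le_1 in auto)
    qed
    moreover have "\<gamma> \<le> \<Gamma>" by (simp add: \<Gamma>_def)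
    ultimately show ?thesis using \<gamma> by blast
  qed
  have part2: "AE \<omega> in P. limsup (\<lambda>n. ereal (1 / ln (real n) * E_sum TYPE('k) 1 2 ((\<lambda>j. x j \<omega>) ` {1..n})))
      \<le> ereal (300 * R\<^sup>2)" if iid: "iid_samples \<mu> P x" for P :: "'w measure" and x
    using AE_samples_cball[OF iid R(2)]
  proof eventually_elim
    case (elim \<omega>)
    have "eventually (\<lambda>n. ereal (1 / ln (real n) * E_sum TYPE('k) 1 2 ((\<lambda>j. x j \<omega>) ` {1..n})) \<le> ereal (300 * R\<^sup>2)) sequentially"
      \<comment> \<open>The bound needs \<open>1 \<le> ln n\<close>; the limit superior does not see
        the smaller indices.\<close>
      using eventually_ge_at_top[of 3]
    proof eventually_elim
      case (elim n)
      have "(\<lambda>j. x j \<omega>) ` {1..n} \<subseteq> cball 0 R" using \<open>\<forall>j. x j \<omega> \<in> cball 0 R\<close> by blast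
      then show ?case unfolding ereal_less_eq using elim by (intro E_sum_2_upper card) auto
    qed
    then show ?case by (rule Limsup_bounded)
  qed
  show ?thesis
  proof (rule conjI)
    show "\<exists>D :: real. \<forall>(P :: 'w measure) x. iid_samples \<mu> P x \<longrightarrow>
        (AE \<omega> in P.
           limsup (\<lambda>n. ereal (1 / ln (real n) * E_sum TYPE('k) 1 2 ((\<lambda>j. x j \<omega>) ` {1..n})))
             \<le> ereal D)"
      using part2 by blast
  qed (use part1 in blast)
qed

end
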